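(* For each positive integer $N$ let $\alpha=\alpha(N)\in[0,1)$, and let $A\subset\{1,\dots,N\}$ be a random set in the model $B(N,\alpha)$. Then $|AA|\sim |A|^2/2$ with probability $1-o(1)$, as $N\to+\infty$, if and only if $$\frac{\log\big(\alpha^2(\log N)^{\log 4-1}\big)}{\sqrt{\log\log N}}\longrightarrow-\infty\quad (N\to+\infty).$$
   Context: For a positive integer $N$ and $\alpha\in[0,1)$, $B(N,\alpha)$ denotes the probabilistic model in which a random set $A\subset\{1,\dots,N\}$ is constructed by including each element of $\{1,\dots,N\}$ independently with probability $\alpha$. $AA=\{ab: a,b\in A\}$ is the product set. For two sequences of random variables $X_1=X_1^{(N)}$, $X_2=X_2^{(N)}$, "$X_1\sim X_2$ with probability $1-o(1)$" means: for every $\delta>0$, $\mathbb{P}(|X_1-X_2|\geq \delta X_2)\to 0$ as $N\to+\infty$. Here $\log$ is the natural logarithm.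
   Formalization: The hypothesis that Nα(N) tends to infinity is added; without it the claim is false, e.g. for α = 1/N the logarithmic quotient tends to −∞, but A is empty with probability tending to 1/e and |AA| ~ |A|²/2 fails. *)

theory Defs
  imports "HOL-Probability.Probability" "HOL-Library.Set_Algebras"
begin

text \<open>The model \<open>B(N, \<alpha>)\<close>, as the law of the random set on the subsets of \<open>{1..N}\<close>.\<close>

definition random_set_pmf :: "nat \<Rightarrow> real \<Rightarrow> nat set pmf" where
  "random_set_pmf N \<alpha> =
     map_pmf (\<lambda>f. {n \<in> {1..N}. f n}) (Pi_pmf {1..N} False (\<lambda>_. bernoulli_pmf \<alpha>))"

text \<open>\<open>X \<sim> Y\<close> with probability \<open>1 - o(1)\<close>. For each \<open>N\<close> the random variables \<open>X N\<close> and \<open>Y N\<close>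
  live on their own probability space \<open>M N\<close>. The inequality is not strict, so the event contains
  all outcomes with \<open>X N \<omega> = Y N \<omega> = 0\<close>.\<close>

definition asymp_whp ::
  "(nat \<Rightarrow> 'a measure) \<Rightarrow> (nat \<Rightarrow> 'a \<Rightarrow> real) \<Rightarrow> (nat \<Rightarrow> 'a \<Rightarrow> real) \<Rightarrow> bool" where
  "asymp_whp M X Y \<longleftrightarrow>
     (\<forall>\<delta>>0. (\<lambda>N. measure (M N) {\<omega> \<in> space (M N). \<bar>X N \<omega> - Y N \<omega>\<bar> \<ge> \<delta> * Y N \<omega>})
        \<longlonglongrightarrow> 0)"

end

theory Submission
  imports Defs "HOL-Real_Asymp.Real_Asymp"
begin

text \<open>Write \<open>L = ln N\<close> and \<open>l = ln (ln N)\<close>. A typical \<open>n \<le> N\<close> has \<open>l + O(\<surd>l)\<close> prime factors.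

  If the quotient tends to \<open>-\<infinity>\<close>, discard the pairs \<open>(a, b)\<close> with more than \<open>2 l + 2 K \<surd>l\<close> prime factors
  in \<open>a b\<close>: they are few. By Rankin's trick with the weight \<open>2\<^sup>-\<^sup>\<Omega>\<close>, the number of quadruples with \<open>a b = c d\<close> among
  the remaining pairs is at most \<open>N\<^sup>2\<close> times \<open>L\<close> to the power \<open>ln 4 - 1\<close>, up to a factor \<open>exp (O(\<surd>l))\<close>, so the expected
  number of collisions in the random set is \<open>o(\<alpha>\<^sup>2 N\<^sup>2)\<close>.

  If the quotient stays above some \<open>-K\<close> along a subsequence, a positive proportion of \<open>n \<le> N\<close> has at least
  \<open>l + K' \<surd>l\<close> prime factors, for any fixed \<open>K'\<close>. Products of two such numbers have about \<open>2 l + 2 K' \<surd>l\<close> distinct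
  prime factors, and since \<open>2\<^sup>\<omega> \<le> \<tau>\<close> has mean \<open>O(L)\<close>, there are only \<open>o(\<alpha>\<^sup>2 N\<^sup>2)\<close> such numbers up to \<open>N\<^sup>2\<close>
  when \<open>K'\<close> is large. Hence a positive proportion of the pairs is lost.\<close>

section \<open>Chebyshev and Mertens bounds\<close>

text \<open>The exponent \<open>ln 4 - 1\<close> comes from
  \<open>2 powr (2 * l) = L powr (ln 4)\<close> with one factor \<open>L\<close> removed: by the
  mean of \<open>2^-Omega\<close> in the quadruple count, by the mean of tau in the converse. The
  truncation is forced. Without it the quadruples number about N^2 L, dominated by entries with
  atypically many prime factors, and the first moment would only reach \<alpha>^2 L -> 0. The weight
  1/2 fits because a typical surviving quadruple splits into four factors with about l/2 prime
  factors each, the typical number under \<open>2^-Omega\<close>. The scale \<open>sqrt l\<close> in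
  the quotient is that of the fluctuations of the number of prime factors: moving the cut by
  \<open>K * sqrt l\<close> changes 2^(2l) by exp (O(K sqrt l)), which a quotient tending to
  -infinity absorbs for every fixed K. Multiplicities are counted in the first direction, since
  complete additivity lets the weight factor over the parametrised quadruples. The converse counts
  distinct primes from a chosen set, for which exponential moments expand over squarefree
  products.\<close>

abbreviation primes_upto :: "nat \<Rightarrow> nat set" where
  "primes_upto n \<equiv> {p. prime p \<and> p \<le> n}"

lemma finite_primes_upto [simp, intro]: "finite (primes_upto n)"
  by (rule finite_subset[of _ "{..n}"]) auto

lemma primes_upto_Suc:
  "primes_upto (Suc n) = (if prime (Suc n) then insert (Suc n) (primes_upto n) else primes_upto n)"
  by (auto simp: le_Suc_eq)

lemma primes_upto_1 [simp]: "primes_upto (Suc 0) = {}"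
  by (auto simp: le_Suc_eq prime_gt_0_nat)

lemma primes_upto_2: "primes_upto 2 = {2}"
proof safe
  fix p :: nat assume "prime p" "p \<le> 2"
  thus "p = 2" using prime_ge_2_nat[of p] by simp
qed auto

lemma primes_upto_0 [simp]: "primes_upto 0 = {}"
  by (auto dest: prime_gt_0_nat)

lemma ln_prime_ge_0: "prime p \<Longrightarrow> 0 \<le> ln (real p)" for p :: nat
  using prime_ge_1_nat[of p] by simp

section \<open>Chebyshev's upper bound for the sum of ln p\<close>

lemma prod_primes_dvd:
  fixes m :: nat
  assumes "finite S" "\<And>p. p \<in> S \<Longrightarrow> prime p" "\<And>p. p \<in> S \<Longrightarrow> p dvd m"
  shows "\<Prod>S dvd m"
  using assms
proof (induction S rule: finite_induct)
  case (insert p S)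
  have cop: "coprime q p" if "q \<in> S" for q
    using insert.hyps insert.prems(1) that by (metis insertCI primes_coprime)
  have "coprime (\<Prod>S) p"
    by (rule prod_coprime_left) (rule cop)
  moreover have "\<Prod>S dvd m" by (rule insert.IH) (use insert.prems in auto)
  moreover have "p dvd m" using insert.prems by simp
  ultimately have "p * \<Prod>S dvd m"
    by (simp add: divides_mult coprime_commute)
  thus ?case
    using insert.hyps by simp
qed simp

lemma prod_primes_dvd_iff:
  fixes m :: nat
  assumes "finite S" "\<And>p. p \<in> S \<Longrightarrow> prime p"
  shows "\<Prod>S dvd m \<longleftrightarrow> (\<forall>p\<in>S. p dvd m)"
proof
  assume *: "\<Prod>S dvd m"
  show "\<forall>p\<in>S. p dvd m"
  proof
    fix p assume "p \<in> S"
    hence "p dvd \<Prod>S" using assms(1) by (intro dvd_prodI)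
    thus "p dvd m" using * by (rule dvd_trans)
  qed
next
  assume "\<forall>p\<in>S. p dvd m"
  thus "\<Prod>S dvd m" using assms by (intro prod_primes_dvd) auto
qed

text \<open>The coefficient occurs twice in its row, at \<open>m\<close> and \<open>m + 1\<close>,
  and the row sums to \<open>2 * 4 ^ m\<close>.\<close>

lemma central_binomial_odd_le: "(2 * m + 1) choose m \<le> 4 ^ m"
proof -
  have "2 * ((2 * m + 1) choose m) = (\<Sum>k\<in>{m, m + 1}. (2 * m + 1) choose k)"
    using binomial_symmetric[of m "2 * m + 1"] by simp
  also have "\<dots> \<le> (\<Sum>k\<le>2 * m + 1. (2 * m + 1) choose k)"
    by (rule sum_mono2) auto
  also have "\<dots> = 2 * 4 ^ m"
    unfolding choose_row_sum by (simp add: power_mult)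
  finally show ?thesis by simp
qed

text \<open>Erdos's argument: for \<open>n = 2 * m + 1\<close>, every prime p with m + 1 < p \<le> n
  divides \<open>n choose m\<close>, because it divides \<open>fact n\<close> but neither
  \<open>fact m\<close> nor \<open>fact (m + 1)\<close>. The smaller primes are left to induction,
  and an even \<open>n > 2\<close> adds no prime.\<close>

lemma primorial_le: "\<Prod>(primes_upto n) \<le> 4 ^ n"
proof (induction n rule: less_induct)
  case (less n)
  consider "n \<le> 2" | "n > 2" "even n" | m where "n = 2 * m + 1" "m \<ge> 1"
  proof (cases "n \<le> 2 \<or> even n")
    case True
    thus ?thesis using that(1,2) by (cases "n \<le> 2") auto
  next
    case False
    then obtain m where "n = 2 * m + 1" by (auto elim: oddE)
    thus ?thesis using that(3)[of m] False by auto
  qed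
  thus ?case
  proof cases
    case 1
    consider "n = 0" | "n = 1" | "n = 2" using 1 by linarith
    thus ?thesis by cases (simp_all only: primes_upto_0 primes_upto_1 primes_upto_2 One_nat_def, auto)
  next
    case 2
    then obtain k where k: "n = Suc k" by (cases n) auto
    have "\<not> prime n" using 2 prime_odd_nat by blast
    hence "\<Prod>(primes_upto n) = \<Prod>(primes_upto k)"
      unfolding k by (subst primes_upto_Suc) simp
    also have "\<dots> \<le> 4 ^ k" by (rule less) (simp add: k)
    also have "\<dots> \<le> 4 ^ n" by (simp add: k)
    finally show ?thesis .
  next
    case (3 m)
    define B where "B = {p. prime p \<and> m + 1 < p \<and> p \<le> n}"
    have fB: "finite B" unfolding B_def by (rule finite_subset[of _ "{..n}"]) auto
    have un: "primes_upto n = primes_upto (m + 1) \<union> B"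
      using 3 by (auto simp: B_def)
    have "\<Prod>(primes_upto n) = \<Prod>(primes_upto (m + 1)) * \<Prod>B"
      unfolding un by (rule prod.union_disjoint) (use fB in \<open>auto simp: B_def\<close>)
    also have "\<Prod>(primes_upto (m + 1)) \<le> 4 ^ (m + 1)"
      by (rule less) (use 3 in auto)
    also have "\<Prod>B \<le> n choose m"
    proof (rule dvd_imp_le)
      show "\<Prod>B dvd n choose m"
      proof (rule prod_primes_dvd[OF fB])
        fix p assume p: "p \<in> B"
        have "fact m * fact (n - m) * (n choose m) = (fact n :: nat)"
          using 3 by (intro binomial_fact_lemma) auto
        moreover have pp: "prime p" "m + 1 < p" "p \<le> n" using p by (auto simp: B_def)
        moreover have "n - m = m + 1" using 3 by simp
        hence "p dvd (fact n :: nat)" "\<not> p dvd (fact m :: nat)" "\<not> p dvd (fact (n - m) :: nat)"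
          using pp by (simp_all only: prime_dvd_fact_iff)
        ultimately show "p dvd n choose m"
          by (metis prime_dvd_mult_iff)
      qed (auto simp: B_def)
    qed (use 3 in auto)
    also have "\<dots> \<le> 4 ^ m" using central_binomial_odd_le[of m] 3 by simp
    finally show ?thesis using 3 by (simp add: power_add mult_2)
  qed
qed

lemma theta_le: "(\<Sum>p\<in>primes_upto n. ln (real p)) \<le> real n * ln 4"
proof -
  have "(\<Sum>p\<in>primes_upto n. ln (real p)) = ln (\<Prod>p\<in>primes_upto n. real p)"
    by (rule ln_prod[symmetric]) (auto simp: prime_gt_0_nat)
  also have "(\<Prod>p\<in>primes_upto n. real p) = real (\<Prod>(primes_upto n))" by simp
  also have "ln \<dots> \<le> ln (real (4 ^ n))"
    using primorial_le[of n]
    by (subst ln_le_cancel_iff)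
      (auto simp: prime_gt_0_nat simp del: of_nat_power of_nat_prod intro!: prod_pos)
  also have "\<dots> = real n * ln 4" by (simp add: ln_realpow)
  finally show ?thesis .
qed

section \<open>Bounds of Mertens type for sums over primes\<close>

lemma multiples_eq_image: "{m \<in> {1..n}. d dvd m} = (*) d ` {1..n div d}" if "d > 0" for d n :: nat
proof safe
  fix m assume m: "m \<in> {1..n}" "d dvd m"
  then obtain k where "m = d * k" by blast
  thus "m \<in> (*) d ` {1..n div d}" using m that
    by (auto simp: less_eq_div_iff_mult_less_eq mult.commute intro!: imageI)
qed (use that in \<open>auto simp: less_eq_div_iff_mult_less_eq mult.commute Suc_le_eq\<close>)

lemma card_multiples: "card {m \<in> {1..n}. d dvd m} = n div d" if "d > 0" for d n :: nat
  unfolding multiples_eq_image[OF that] using that by (simp add: card_image inj_on_def)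

lemma sum_ln_prime_factors_le:
  assumes "m > 0"
  shows "(\<Sum>p\<in>prime_factors m. ln (real p)) \<le> ln (real m)"
proof -
  have "(\<Sum>p\<in>prime_factors m. ln (real p)) = ln (\<Prod>p\<in>prime_factors m. real p)"
    by (rule ln_prod[symmetric]) (auto simp: prime_factors_gt_0_nat)
  also have "(\<Prod>p\<in>prime_factors m. real p) = real (\<Prod>(prime_factors m))" by simp
  also have "\<Prod>(prime_factors m) dvd m"
    by (rule prod_primes_dvd) (auto simp: in_prime_factors_iff)
  hence "ln (real (\<Prod>(prime_factors m))) \<le> ln (real m)"
    using assms by (subst ln_le_cancel_iff) (auto simp: prime_factors_gt_0_nat dvd_imp_le simp del: of_nat_prod intro!: prod_pos)
  finally show ?thesis .
qed

lemma prime_factors_eq_filter: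
  assumes "m \<in> {1..n}"
  shows "prime_factors m = {p \<in> primes_upto n. p dvd m}"
proof safe
  fix p assume "p \<in> prime_factors m"
  thus "prime p" "p dvd m" "p \<le> n" using assms dvd_imp_le[of p m] by (auto simp: in_prime_factors_iff)
qed (use assms in \<open>auto simp: in_prime_factors_iff\<close>)

lemma div_ge_real: "real n / real d - 1 \<le> real (n div d)"
  using real_of_int_div3[of "int n" "int d"] by (simp flip: zdiv_int)

lemma div_le_real: "real (n div d) \<le> real n / real d"
  using real_of_int_div4[of "int n" "int d"] by (simp flip: zdiv_int)

text \<open>Double counting of the pairs p dvd m with m \<le> n. Each \<open>m\<close> contributes
  the logarithm of its radical, at most \<open>ln n\<close>, so prime powers can be ignored in this
  direction. Rounding \<open>n div p\<close> costs the sum bounded in \<open>theta_le\<close>, hence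
  the \<open>ln 4\<close>.\<close>

lemma sum_ln_div_primes_le:
  assumes "n \<ge> 1"
  shows "(\<Sum>p\<in>primes_upto n. ln (real p) / real p) \<le> ln (real n) + ln 4"
proof -
  have "real n * (\<Sum>p\<in>primes_upto n. ln (real p) / real p) - (\<Sum>p\<in>primes_upto n. ln (real p))
      = (\<Sum>p\<in>primes_upto n. ln (real p) * (real n / real p - 1))"
    by (simp add: sum_distrib_left algebra_simps flip: sum_subtractf)
  also have "\<dots> \<le> (\<Sum>p\<in>primes_upto n. ln (real p) * real (n div p))"
    by (intro sum_mono mult_left_mono div_ge_real) (auto simp: ln_prime_ge_0)
  also have "\<dots> = (\<Sum>p\<in>primes_upto n. \<Sum>m\<in>{m\<in>{1..n}. p dvd m}. ln (real p))"
    by (intro sum.cong) (simp_all only: sum_constant card_multiples prime_gt_0_nat mem_Collect_eq mult.commute)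
  also have "\<dots> = (\<Sum>m\<in>{1..n}. \<Sum>p\<in>{p\<in>primes_upto n. p dvd m}. ln (real p))"
    by (rule sum.swap_restrict) auto
  also have "\<dots> \<le> (\<Sum>m\<in>{1..n}. ln (real n))"
  proof (rule sum_mono)
    fix m assume m: "m \<in> {1..n}"
    have "(\<Sum>p\<in>{p\<in>primes_upto n. p dvd m}. ln (real p)) \<le> ln (real m)"
      using sum_ln_prime_factors_le[of m] m prime_factors_eq_filter[OF m] by simp
    also have "\<dots> \<le> ln (real n)" using m by simp
    finally show "(\<Sum>p\<in>{p\<in>primes_upto n. p dvd m}. ln (real p)) \<le> ln (real n)" .
  qed
  finally have "real n * (\<Sum>p\<in>primes_upto n. ln (real p) / real p) \<le> real n * (ln (real n) + ln 4)"
    using theta_le[of n] by (simp add: algebra_simps)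
  thus ?thesis using assms by simp
qed

text \<open>Replaces integrals of 1/x: applied to consecutive values, the right-hand side
  telescopes.\<close>

lemma one_minus_ln_ratio_le:
  fixes a b :: real
  assumes "0 < a" "0 < b"
  shows "1 - a / b \<le> ln b - ln a"
  using ln_le_minus_one[of "a / b"] assms by (simp add: ln_div)

lemma sum_inverse_primes_le:
  assumes "n \<ge> 2"
  shows "(\<Sum>p\<in>primes_upto n. 1 / real p) \<le> ln (ln (real n)) + 4"
proof -
  define A where "A n = (\<Sum>p\<in>primes_upto n. ln (real p) / real p)" for n
  define B where "B n = (\<Sum>p\<in>primes_upto n. 1 / real p)" for n
  \<comment> \<open>Abel summation in inductive form. A new prime adds the same amount to
    \<open>B\<close> and to \<open>A / v\<close>, so only the change of the logarithm counts,
    weighted by \<open>A n\<close>. The term \<open>- ln 4 / ln n\<close> telescopes away the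
    \<open>ln 4\<close> in the bound for \<open>A\<close>.\<close>
  have *: "B n - A n / ln (real n) \<le> ln (ln (real n)) + 3 - ln 4 / ln (real n)"
    using assms
  proof (induction n rule: dec_induct)
    case base
    have l4: "ln 4 = 2 * ln (2::real)" using ln_realpow[of 2 2] by simp
    have "-1 \<le> ln (1 / 2 :: real)" using one_minus_ln_ratio_le[of 1 "1/2"] by simp
    moreover have "ln (ln 2) \<ge> ln (1 / 2 :: real)"
      using ln2_ge_two_thirds by (subst ln_le_cancel_iff) auto
    ultimately have "ln (ln 2) \<ge> (-1 :: real)" by linarith
    thus ?case unfolding A_def B_def primes_upto_2 l4 by simp
  next
    case (step n)
    define u where "u = ln (real n)"
    define v where "v = ln (real (Suc n))"
    have uv: "0 < u" "u < v" using step by (auto simp: u_def v_def)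
    have "B (Suc n) - A (Suc n) / v = B n - A n / v"
      using uv by (auto simp: B_def A_def primes_upto_Suc v_def add_divide_distrib)
    also have "\<dots> = (B n - A n / u) + A n * (1 / u - 1 / v)"
      using uv by (simp add: field_simps)
    also have "A n * (1 / u - 1 / v) \<le> (u + ln 4) * (1 / u - 1 / v)"
      using sum_ln_div_primes_le[of n] step uv
      by (intro mult_right_mono) (auto simp: A_def u_def frac_le)
    also have "\<dots> = (1 - u / v) + ln 4 / u - ln 4 / v" using uv by (simp add: field_simps)
    also have "1 - u / v \<le> ln v - ln u" using uv by (intro one_minus_ln_ratio_le) auto
    finally show ?case using step.IH by (simp add: u_def v_def)
  qed
  have "A n / ln (real n) \<le> (ln (real n) + ln 4) / ln (real n)"
    using sum_ln_div_primes_le[of n] assms by (intro divide_right_mono) (auto simp: A_def)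
  also have "\<dots> = 1 + ln 4 / ln (real n)" using assms by (simp add: field_simps)
  finally show ?thesis using * by (simp add: B_def)
qed

lemma sum_inverse_squares_le:
  assumes "\<And>p. p \<in> P \<Longrightarrow> p \<ge> 2" "finite P"
  shows "(\<Sum>p\<in>P. 1 / (real p)\<^sup>2) \<le> 1"
proof -
  have *: "(\<Sum>k=2..n. 1 / (real k)\<^sup>2) \<le> 1 - 1 / real n" if "n \<ge> 1" for n
    using that
  proof (induction n rule: dec_induct)
    case (step n)
    have "1 / (real (Suc n))\<^sup>2 \<le> 1 / (real n * real (Suc n))"
      using step by (intro divide_left_mono) (auto simp: power2_eq_square)
    also have "\<dots> = 1 / real n - 1 / real (Suc n)" using step by (simp add: field_simps)
    finally show ?case using step by (simp add: sum.cl_ivl_Suc)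
  qed auto
  obtain n where n: "P \<subseteq> {..n}" using assms(2) finite_nat_iff_bounded_le by blast
  have "(\<Sum>p\<in>P. 1 / (real p)\<^sup>2) \<le> (\<Sum>k=2..Suc n. 1 / (real k)\<^sup>2)"
  proof (rule sum_mono2)
    show "P \<subseteq> {2..Suc n}"
    proof
      fix p assume "p \<in> P"
      thus "p \<in> {2..Suc n}" using n assms(1)[of p] by auto
    qed
  qed auto
  also have "\<dots> \<le> 1" using *[of "Suc n"] by (rule order_trans) auto
  finally show ?thesis .
qed

text \<open>In place of geometric series: dividing out one \<open>p\<close> maps the multiples of
  \<open>p\<close> in the set back into the same set, so its sum s satisfies s \<le> s0 + s / p,
  where s0 is the sum for \<open>Q\<close>. The cut at \<open>x\<close> keeps everything
  finite.\<close>

lemma sum_inverse_smooth_le: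
  assumes "finite Q" "\<And>p. p \<in> Q \<Longrightarrow> prime p"
  shows "(\<Sum>n\<in>{n\<in>{1..x}. prime_factors n \<subseteq> Q}. 1 / real n) \<le> (\<Prod>p\<in>Q. 1 / (1 - 1 / real p))"
  using assms
proof (induction Q rule: finite_induct)
  case empty
  have "{n\<in>{1..x}. prime_factors n \<subseteq> {}} \<subseteq> {1}"
    by (auto simp: prime_factorization_empty_iff)
  hence "(\<Sum>n\<in>{n\<in>{1..x}. prime_factors n \<subseteq> {}}. 1 / real n) \<le> (\<Sum>n\<in>{1}. 1 / real n)"
    by (intro sum_mono2) auto
  thus ?case by simp
next
  case (insert p Q)
  define S where "S = {n\<in>{1..x}. prime_factors n \<subseteq> insert p Q}"
  define S0 where "S0 = {n\<in>{1..x}. prime_factors n \<subseteq> Q}"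
  have p: "prime p" "p \<ge> 2" using insert prime_ge_2_nat by auto
  have "S \<subseteq> S0 \<union> (*) p ` S"
  proof
    fix n assume n: "n \<in> S"
    show "n \<in> S0 \<union> (*) p ` S"
    proof (cases "p dvd n")
      case True
      then obtain m where m: "n = p * m" by blast
      hence "prime_factors m \<subseteq> prime_factors n" using n p
        by (intro dvd_prime_factors) (auto simp: S_def)
      moreover have "m \<le> p * m" using p by simp
      moreover have "p * m \<le> x" "p * m \<ge> 1" "prime_factors (p * m) \<subseteq> insert p Q"
        using n m by (auto simp: S_def)
      ultimately have "m \<le> x" "m \<ge> 1" "prime_factors m \<subseteq> insert p Q"
        unfolding m by (linarith, simp add: Suc_le_eq, blast)
      hence "m \<in> S" by (simp add: S_def)
      thus ?thesis using m by auto
    next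
      case False
      thus ?thesis using n by (auto simp: S_def S0_def in_prime_factors_iff)
    qed
  qed
  hence "(\<Sum>n\<in>S. 1 / real n) \<le> (\<Sum>n\<in>S0 \<union> (*) p ` S. 1 / real n)"
    by (intro sum_mono2) (auto simp: S_def S0_def)
  also have "\<dots> \<le> (\<Sum>n\<in>S0. 1 / real n) + (\<Sum>n\<in>(*) p ` S. 1 / real n)"
    using sum.union_inter[of S0 "(*) p ` S" "\<lambda>n. 1 / real n"] sum_nonneg[of "S0 \<inter> (*) p ` S" "\<lambda>n. 1 / real n"]
    by (simp add: S_def S0_def)
  also have "(\<Sum>n\<in>(*) p ` S. 1 / real n) = (1 / real p) * (\<Sum>n\<in>S. 1 / real n)"
    using p by (subst sum.reindex) (auto simp: inj_on_def sum_distrib_left)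
  finally have "(\<Sum>n\<in>S. 1 / real n) * (1 - 1 / real p) \<le> (\<Sum>n\<in>S0. 1 / real n)"
    by (simp add: algebra_simps)
  also have "\<dots> \<le> (\<Prod>p\<in>Q. 1 / (1 - 1 / real p))" unfolding S0_def using insert by blast
  finally have "(\<Sum>n\<in>S. 1 / real n) \<le> (\<Prod>p\<in>Q. 1 / (1 - 1 / real p)) / (1 - 1 / real p)"
    using p by (subst pos_le_divide_eq) auto
  thus ?case using insert by (simp add: S_def mult.commute)
qed

lemma one_div_prime_less: "prime p \<Longrightarrow> 1 / real p < 1" for p :: nat
  using prime_gt_1_nat[of p] by simp

text \<open>Euler's argument: an integer up to \<open>n\<close> has only prime factors up to
  \<open>n\<close>, so the Euler product dominates the harmonic sum, which is at least
  \<open>ln n\<close>. The loss 2 comes from the quadratic terms in the logarithms of the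
  factors.\<close>

lemma sum_inverse_primes_ge:
  assumes "n \<ge> 2"
  shows "(\<Sum>p\<in>primes_upto n. 1 / real p) \<ge> ln (ln (real n)) - 2"
proof -
  have "ln (real n) \<le> ln (real n + 1)" using assms by simp
  also have "\<dots> \<le> harm n" by (rule ln_le_harm)
  also have "harm n = (\<Sum>m\<in>{m\<in>{1..n}. prime_factors m \<subseteq> primes_upto n}. 1 / real m)"
    unfolding harm_def by (intro sum.cong) (auto simp: prime_factors_eq_filter inverse_eq_divide)
  also have "\<dots> \<le> (\<Prod>p\<in>primes_upto n. 1 / (1 - 1 / real p))"
    by (rule sum_inverse_smooth_le) auto
  finally have "ln (ln (real n)) \<le> ln (\<Prod>p\<in>primes_upto n. 1 / (1 - 1 / real p))"
    using assms by (subst ln_le_cancel_iff) (auto intro!: prod_pos simp: one_div_prime_less)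
  also have "\<dots> = (\<Sum>p\<in>primes_upto n. ln (1 / (1 - 1 / real p)))"
    by (rule ln_prod) (auto simp: one_div_prime_less)
  also have "\<dots> \<le> (\<Sum>p\<in>primes_upto n. 1 / real p + 2 * (1 / (real p)\<^sup>2))"
  proof (rule sum_mono)
    fix p assume p: "p \<in> primes_upto n"
    hence "p \<ge> 2" using prime_ge_2_nat by auto
    hence "ln (1 - 1 / real p) \<ge> - (1 / real p) - 2 * (1 / real p)\<^sup>2"
      by (intro ln_one_minus_pos_lower_bound) (auto simp: field_simps)
    thus "ln (1 / (1 - 1 / real p)) \<le> 1 / real p + 2 * (1 / (real p)\<^sup>2)"
      using \<open>p \<ge> 2\<close> by (simp add: ln_div power_divide)
  qed
  also have "\<dots> = (\<Sum>p\<in>primes_upto n. 1 / real p) + 2 * (\<Sum>p\<in>primes_upto n. 1 / (real p)\<^sup>2)"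
    by (simp add: sum.distrib sum_distrib_left)
  also have "(\<Sum>p\<in>primes_upto n. 1 / (real p)\<^sup>2) \<le> 1"
    by (rule sum_inverse_squares_le) (auto simp: prime_ge_2_nat)
  finally show ?thesis by simp
qed

section \<open>Exponential moments of the number of prime divisors\<close>

text \<open>The set \<open>P\<close> is left free because upper bounds take all primes up to
  \<open>N\<close>, while the lower bound needs primes so small that products of many of them stay
  below \<open>N\<close>.\<close>

definition ndiv :: "nat set \<Rightarrow> nat \<Rightarrow> nat" where
  "ndiv P n = card {p \<in> P. p dvd n}"

lemma sum_Pow_div_prod:
  assumes "finite P"
  shows "(\<Sum>S\<in>Pow P. c ^ card S / real (\<Prod>S)) = (\<Prod>p\<in>P. 1 + c / real p)"
  using prod_add[OF assms, of "\<lambda>p. c / real p" "\<lambda>_. 1"]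
  by (simp add: prod_dividef add.commute)

text \<open>Write \<open>y = (y - 1) + 1\<close> at each prime of \<open>P\<close> dividing
  \<open>n\<close> and expand: the subset \<open>S\<close> contributes exactly when
  \<open>\<Prod>S\<close> divides \<open>n\<close>.\<close>

lemma sum_power_ndiv:
  fixes y :: real
  assumes "finite P" "\<And>p. p \<in> P \<Longrightarrow> prime p"
  shows "(\<Sum>n\<in>{1..N}. y ^ ndiv P n) = (\<Sum>S\<in>Pow P. (y - 1) ^ card S * real (N div \<Prod>S))"
proof -
  have "y ^ ndiv P n = (\<Sum>S\<in>{S\<in>Pow P. \<Prod>S dvd n}. (y - 1) ^ card S)" for n
  proof -
    have fin: "finite {p\<in>P. p dvd n}" using assms by simp
    have "y ^ ndiv P n = (\<Sum>S\<in>Pow {p\<in>P. p dvd n}. (y - 1) ^ card S)"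
      using prod_add[OF fin, of "\<lambda>_. y - 1" "\<lambda>_. 1"] by (simp add: ndiv_def)
    also have "Pow {p\<in>P. p dvd n} = {S\<in>Pow P. \<Prod>S dvd n}"
    proof (rule set_eqI)
      fix S
      have "\<Prod>S dvd n \<longleftrightarrow> (\<forall>p\<in>S. p dvd n)" if "S \<subseteq> P"
        using that assms finite_subset by (intro prod_primes_dvd_iff) auto
      thus "S \<in> Pow {p\<in>P. p dvd n} \<longleftrightarrow> S \<in> {S\<in>Pow P. \<Prod>S dvd n}" by auto
    qed
    finally show ?thesis .
  qed
  hence "(\<Sum>n\<in>{1..N}. y ^ ndiv P n) = (\<Sum>n\<in>{1..N}. \<Sum>S\<in>{S\<in>Pow P. \<Prod>S dvd n}. (y - 1) ^ card S)"
    by simp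
  also have "\<dots> = (\<Sum>S\<in>Pow P. \<Sum>n\<in>{n\<in>{1..N}. \<Prod>S dvd n}. (y - 1) ^ card S)"
    using assms(1) by (intro sum.swap_restrict) auto
  also have "\<dots> = (\<Sum>S\<in>Pow P. (y - 1) ^ card S * real (N div \<Prod>S))"
  proof (rule sum.cong[OF refl])
    fix S assume "S \<in> Pow P"
    hence "\<Prod>S > 0" using assms by (intro prod_pos) (auto simp: prime_gt_0_nat)
    thus "(\<Sum>n\<in>{n\<in>{1..N}. \<Prod>S dvd n}. (y - 1) ^ card S) = (y - 1) ^ card S * real (N div \<Prod>S)"
      unfolding sum_constant by (simp only: card_multiples mult.commute)
  qed
  finally show ?thesis .
qed

lemma prod_one_plus_le_exp:
  assumes "c \<ge> (0::real)"
  shows "(\<Prod>p\<in>P. 1 + c / real p) \<le> exp (c * (\<Sum>p\<in>P. 1 / real p))"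
proof (cases "finite P")
  case True
  have "(\<Prod>p\<in>P. 1 + c / real p) \<le> (\<Prod>p\<in>P. exp (c / real p))"
    by (intro prod_mono) (use assms exp_ge_add_one_self in auto)
  also have "\<dots> = exp (c * (\<Sum>p\<in>P. 1 / real p))"
    using True by (simp add: exp_sum sum_distrib_left)
  finally show ?thesis .
qed auto

lemma sum_power_ndiv_le:
  fixes y :: real
  assumes "finite P" "\<And>p. p \<in> P \<Longrightarrow> prime p" "y \<ge> 1"
  shows "(\<Sum>n\<in>{1..N}. y ^ ndiv P n) \<le> real N * exp ((y - 1) * (\<Sum>p\<in>P. 1 / real p))"
proof -
  have "(\<Sum>n\<in>{1..N}. y ^ ndiv P n) = (\<Sum>S\<in>Pow P. (y - 1) ^ card S * real (N div \<Prod>S))"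
    by (rule sum_power_ndiv) (use assms in auto)
  also have "\<dots> \<le> (\<Sum>S\<in>Pow P. (y - 1) ^ card S * (real N / real (\<Prod>S)))"
    using assms by (intro sum_mono mult_left_mono div_le_real) auto
  also have "\<dots> = real N * (\<Sum>S\<in>Pow P. (y - 1) ^ card S / real (\<Prod>S))"
    by (simp add: sum_distrib_left mult_ac)
  also have "\<dots> = real N * (\<Prod>p\<in>P. 1 + (y - 1) / real p)"
    using assms by (simp only: sum_Pow_div_prod)
  also have "\<dots> \<le> real N * exp ((y - 1) * (\<Sum>p\<in>P. 1 / real p))"
    using assms by (intro mult_left_mono prod_one_plus_le_exp) auto
  finally show ?thesis .
qed

section \<open>Lower bounds for exponential moments\<close>

lemma prod_one_plus_ge_exp:
  assumes "c \<ge> (0::real)" "c \<le> 1" "finite P" "\<And>p. p \<in> P \<Longrightarrow> p \<ge> 2"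
  shows "(\<Prod>p\<in>P. 1 + c / real p) \<ge> exp (c * (\<Sum>p\<in>P. 1 / real p) - c\<^sup>2)"
proof -
  have "c * (\<Sum>p\<in>P. 1 / real p) - c\<^sup>2 * 1
      \<le> c * (\<Sum>p\<in>P. 1 / real p) - c\<^sup>2 * (\<Sum>p\<in>P. 1 / (real p)\<^sup>2)"
    using assms by (intro diff_left_mono mult_left_mono sum_inverse_squares_le) auto
  also have "\<dots> = (\<Sum>p\<in>P. c / real p - (c / real p)\<^sup>2)"
    by (simp add: sum_distrib_left sum_subtractf power_divide)
  finally have "exp (c * (\<Sum>p\<in>P. 1 / real p) - c\<^sup>2) \<le> exp (\<Sum>p\<in>P. c / real p - (c / real p)\<^sup>2)"
    by simp
  also have "\<dots> = (\<Prod>p\<in>P. exp (c / real p - (c / real p)\<^sup>2))"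
    using assms by (simp add: exp_sum)
  also have "\<dots> \<le> (\<Prod>p\<in>P. 1 + c / real p)"
  proof (intro prod_mono conjI)
    fix p assume "p \<in> P"
    hence p: "p \<ge> 2" using assms by auto
    hence "c / real p \<le> 1" using assms by (simp add: field_simps)
    hence "c / real p - (c / real p)\<^sup>2 \<le> ln (1 + c / real p)"
      using assms by (intro ln_one_plus_pos_lower_bound) auto
    moreover have "1 + c / real p > 0" using assms by (simp add: add_pos_nonneg)
    ultimately show "exp (c / real p - (c / real p)\<^sup>2) \<le> 1 + c / real p"
      by (simp add: ln_ge_iff)
  qed auto
  finally show ?thesis .
qed

text \<open>Rounding \<open>N div \<Prod>S\<close> costs at most a factor 2 as long as
  \<open>2 * \<Prod>S\<close> is at most \<open>N\<close>, which is assumed only for sets of at most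
  \<open>R\<close> primes. The larger sets are removed from the full Euler product by Rankin's trick
  with 1 \<le> exp (card S - R); this produces the negative term.\<close>

lemma sum_power_ndiv_ge:
  fixes y :: real
  assumes P: "finite P" "\<And>p. p \<in> P \<Longrightarrow> prime p" and y: "1 \<le> y" "y \<le> 2"
    and small: "\<And>S. S \<subseteq> P \<Longrightarrow> card S \<le> R \<Longrightarrow> 2 * real (\<Prod>S) \<le> real N"
  defines "m \<equiv> \<Sum>p\<in>P. 1 / real p"
  shows "(\<Sum>n\<in>{1..N}. y ^ ndiv P n) \<ge>
     real N / 2 * (exp ((y - 1) * m - (y - 1)\<^sup>2) - exp (exp 1 * (y - 1) * m - real R))"
proof -
  define c where "c = y - 1"
  have c: "0 \<le> c" "c \<le> 1" using y by (auto simp: c_def)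
  define f where "f S = c ^ card S / real (\<Prod>S)" for S
  have f0: "f S \<ge> 0" for S using c by (auto simp: f_def prod_nonneg)
  have "exp (c * m - c\<^sup>2) - exp (exp 1 * c * m - real R) \<le> (\<Sum>S\<in>{S\<in>Pow P. card S \<le> R}. f S)"
  proof -
    have "exp (c * m - c\<^sup>2) \<le> (\<Prod>p\<in>P. 1 + c / real p)"
      unfolding m_def using P c by (intro prod_one_plus_ge_exp) (auto simp: prime_ge_2_nat)
    also have "\<dots> = (\<Sum>S\<in>Pow P. f S)" unfolding f_def using P by (simp only: sum_Pow_div_prod)
    also have "Pow P = {S\<in>Pow P. card S \<le> R} \<union> {S\<in>Pow P. card S > R}" by auto
    also have "(\<Sum>S\<in>\<dots>. f S) = (\<Sum>S\<in>{S\<in>Pow P. card S \<le> R}. f S) + (\<Sum>S\<in>{S\<in>Pow P. card S > R}. f S)"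
      using P by (intro sum.union_disjoint) auto
    also have "(\<Sum>S\<in>{S\<in>Pow P. card S > R}. f S)
        \<le> (\<Sum>S\<in>{S\<in>Pow P. card S > R}. exp (- real R) * ((exp 1 * c) ^ card S / real (\<Prod>S)))"
    proof (rule sum_mono)
      fix S assume S: "S \<in> {S\<in>Pow P. card S > R}"
      have "1 * f S \<le> exp (real (card S) - real R) * f S"
        using S f0 by (intro mult_right_mono) auto
      also have "\<dots> = exp (- real R) * ((exp 1 * c) ^ card S / real (\<Prod>S))"
        by (simp add: f_def exp_diff exp_minus power_mult_distrib field_simps flip: exp_of_nat_mult)
      finally show "f S \<le> exp (- real R) * ((exp 1 * c) ^ card S / real (\<Prod>S))" by simp
    qed
    also have "\<dots> \<le> (\<Sum>S\<in>Pow P. exp (- real R) * ((exp 1 * c) ^ card S / real (\<Prod>S)))"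
      using P c by (intro sum_mono2 mult_nonneg_nonneg divide_nonneg_nonneg) (auto simp: prod_nonneg)
    also have "\<dots> = exp (- real R) * (\<Prod>p\<in>P. 1 + exp 1 * c / real p)"
      unfolding sum_distrib_left[symmetric] using P by (simp only: sum_Pow_div_prod)
    also have "\<dots> \<le> exp (- real R) * exp (exp 1 * c * m)"
      unfolding m_def using c by (intro mult_left_mono prod_one_plus_le_exp) auto
    also have "\<dots> = exp (exp 1 * c * m - real R)" by (simp flip: exp_add)
    finally show ?thesis by simp
  qed
  hence "real N / 2 * (exp (c * m - c\<^sup>2) - exp (exp 1 * c * m - real R)) \<le>
      real N / 2 * (\<Sum>S\<in>{S\<in>Pow P. card S \<le> R}. f S)"
    by (intro mult_left_mono) auto
  also have "\<dots> = (\<Sum>S\<in>{S\<in>Pow P. card S \<le> R}. c ^ card S * (real N / real (\<Prod>S) / 2))"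
    unfolding sum_distrib_left f_def by (simp add: field_simps)
  also have "\<dots> \<le> (\<Sum>S\<in>{S\<in>Pow P. card S \<le> R}. c ^ card S * real (N div \<Prod>S))"
  proof (intro sum_mono mult_left_mono)
    fix S assume S: "S \<in> {S\<in>Pow P. card S \<le> R}"
    have "\<Prod>S > 0" using P S by (intro prod_pos) (auto simp: prime_gt_0_nat)
    moreover have "2 * real (\<Prod>S) \<le> real N" using S by (intro small) auto
    ultimately have "1 \<le> real N / real (\<Prod>S) / 2" by (simp add: field_simps del: of_nat_prod)
    thus "real N / real (\<Prod>S) / 2 \<le> real (N div \<Prod>S)"
      using div_ge_real[of N "\<Prod>S"] by linarith
  qed (use c in auto)
  also have "\<dots> \<le> (\<Sum>S\<in>Pow P. c ^ card S * real (N div \<Prod>S))"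
    using P c by (intro sum_mono2) auto
  also have "\<dots> = (\<Sum>n\<in>{1..N}. y ^ ndiv P n)"
    unfolding c_def by (rule sum_power_ndiv[symmetric]) (use P in auto)
  finally show ?thesis unfolding c_def .
qed

text \<open>Exponential tilting. With \<open>m = \<Sum>1/p\<close> and \<open>X = (ndiv P n - m) / \<surd>m\<close>, the mean of \<open>exp (v X)\<close> over
  \<open>n \<le> N\<close> is at most \<open>exp (v\<^sup>2/2) (1 + o(1))\<close> for each \<open>v > 0\<close>, while for \<open>t = K + 2\<close> it is at least half of
  \<open>exp (t\<^sup>2/2)\<close>. The upper bounds at \<open>t - 2\<close> and \<open>t + 2\<close> show that the part with \<open>\<bar>X - t\<bar> > 2\<close> contributes at most
  \<open>2 exp (-2) < 1/2\<close> of \<open>exp (t\<^sup>2/2)\<close>, so a positive proportion of \<open>n\<close> satisfies \<open>X \<ge> K\<close>.\<close>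

lemma ndiv_large_proportion:
  fixes K :: real
  assumes "K > 0"
  shows "\<exists>c>0. \<exists>M. \<forall>P N R. finite P \<and> (\<forall>p\<in>P. prime p) \<and> (\<Sum>p\<in>P. 1 / real p) \<ge> M \<and>
      (\<Sum>p\<in>P. 1 / real p) \<le> real R \<and>
      (\<forall>S\<subseteq>P. card S \<le> R \<longrightarrow> 2 * real (\<Prod>S) \<le> real N) \<longrightarrow>
      c * real N \<le> real (card {n\<in>{1..N}. real (ndiv P n) \<ge>
        (\<Sum>p\<in>P. 1 / real p) + K * sqrt (\<Sum>p\<in>P. 1 / real p)})"
proof -
  define t where "t = K + 2"
  define D where "D = exp (t\<^sup>2 / 2) * (1 / 2 - 2 * exp (-2))"
  have t: "t > 2" using assms by (simp add: t_def)
  have "exp (-2 :: real) < 1 / 4"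
  proof -
    have "(4::real) < (1 + 1 + 1/2)^2" by (simp add: power2_eq_square)
    also have "\<dots> \<le> exp 1 ^ 2"
      using exp_lower_Taylor_quadratic[of 1] by (intro power_mono) auto
    also have "\<dots> = exp (2::real)" by (simp flip: exp_of_nat_mult)
    finally show ?thesis by (simp add: exp_minus field_simps)
  qed
  hence D: "D > 0" by (simp add: D_def)
  \<comment> \<open>\<open>G v m\<close> bounds the mean of \<open>exp (v * X)\<close> from above,
    and \<open>L m / 2\<close> bounds it from below at \<open>v = t\<close>, with \<open>R\<close>
    replaced by the smaller \<open>m\<close>. As \<open>m\<close> grows, \<open>G v m\<close> and
    \<open>L m\<close> tend to the Gaussian values at \<open>v\<close> and \<open>t\<close>.\<close>
  define G where "G v m = exp (m * (exp (v / sqrt m) - 1) - v * sqrt m)" for v m :: real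
  define L where "L m = exp ((exp (t / sqrt m) - 1) * m - (exp (t / sqrt m) - 1)\<^sup>2 - t * sqrt m)
      - exp (exp 1 * (exp (t / sqrt m) - 1) * m - m - t * sqrt m)" for m :: real
  have G: "(G v \<longlongrightarrow> exp (v * v / 2)) at_top" if "v > 0" for v
    unfolding G_def using that by (intro tendsto_exp) real_asymp
  have L: "(L \<longlongrightarrow> exp (t * t / 2) - 0) at_top"
    unfolding L_def
  proof (intro tendsto_diff tendsto_exp)
    show "((\<lambda>m. (exp (t / sqrt m) - 1) * m - (exp (t / sqrt m) - 1)\<^sup>2 - t * sqrt m) \<longlongrightarrow> t * t / 2) at_top"
      using t by real_asymp
    show "((\<lambda>m. exp (exp 1 * (exp (t / sqrt m) - 1) * m - m - t * sqrt m)) \<longlongrightarrow> 0) at_top"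
      using t by real_asymp
  qed
  define T where "T m = L m / 2 - exp (- (2 * (t + 2))) * G (t + 2) m - exp (2 * (t - 2)) * G (t - 2) m" for m
  have "(T \<longlongrightarrow> (exp (t * t / 2) - 0) / 2 - exp (- (2 * (t + 2))) * exp ((t + 2) * (t + 2) / 2)
      - exp (2 * (t - 2)) * exp ((t - 2) * (t - 2) / 2)) at_top"
    unfolding T_def using t by (intro tendsto_intros G L) auto
  also have "(exp (t * t / 2) - 0) / 2 - exp (- (2 * (t + 2))) * exp ((t + 2) * (t + 2) / 2)
      - exp (2 * (t - 2)) * exp ((t - 2) * (t - 2) / 2) = D"
  proof -
    have "exp (- (2 * (t + 2))) * exp ((t + 2) * (t + 2) / 2) = exp (t\<^sup>2 / 2) * exp (-2)"
      "exp (2 * (t - 2)) * exp ((t - 2) * (t - 2) / 2) = exp (t\<^sup>2 / 2) * exp (-2)"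
      by (simp_all add: field_simps power2_eq_square flip: exp_add)
    thus ?thesis by (simp add: D_def power2_eq_square algebra_simps)
  qed
  finally have "eventually (\<lambda>m. T m > D / 2) at_top"
    using D by (intro order_tendstoD) auto
  moreover have "((\<lambda>m. exp (t / sqrt m)) \<longlongrightarrow> 1) at_top"
    using t by real_asymp
  hence "eventually (\<lambda>m. exp (t / sqrt m) < 2) at_top"
    by (rule order_tendstoD) auto
  ultimately have "eventually (\<lambda>m. T m > D / 2 \<and> exp (t / sqrt m) < 2) at_top"
    by (rule eventually_conj)
  then obtain M0 where M0: "\<And>m. m \<ge> M0 \<Longrightarrow> T m > D / 2 \<and> exp (t / sqrt m) < 2"
    by (auto simp: eventually_at_top_linorder)
  show ?thesis
  proof (rule exI[of _ "exp (- (t * (t + 2))) * (D / 2)"], rule conjI, use D in simp,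
      rule exI[of _ "max M0 1"], intro allI impI, elim conjE)
    fix P :: "nat set" and N R :: nat
    assume P: "finite P" "\<forall>p\<in>P. prime p"
      and ms: "(\<Sum>p\<in>P. 1 / real p) \<ge> max M0 1" "(\<Sum>p\<in>P. 1 / real p) \<le> real R"
      and small: "\<forall>S\<subseteq>P. card S \<le> R \<longrightarrow> 2 * real (\<Prod>S) \<le> real N"
    define m where "m = (\<Sum>p\<in>P. 1 / real p)"
    have m: "m \<ge> 1" "T m > D / 2" "exp (t / sqrt m) < 2" "m \<le> real R"
      using ms M0[of m] by (auto simp: m_def)
    define X where "X n = (real (ndiv P n) - m) / sqrt m" for n
    define W where "W v = (\<Sum>n\<in>{1..N}. exp (v * X n))" for v
    have expX: "exp (v * X n) = exp (v / sqrt m) ^ ndiv P n * exp (- (v * sqrt m))" for v n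
    proof -
      have "v * X n = v * real (ndiv P n) / sqrt m - v * (m / sqrt m)"
        by (simp add: X_def diff_divide_distrib algebra_simps)
      also have "m / sqrt m = sqrt m" using m by (simp add: real_div_sqrt)
      also have "v * real (ndiv P n) / sqrt m - v * sqrt m = real (ndiv P n) * (v / sqrt m) + - (v * sqrt m)"
        by simp
      finally show ?thesis by (simp only: exp_add exp_of_nat_mult)
    qed
    have W_le: "W v \<le> real N * G v m" if "v > 0" for v
    proof -
      have "W v = (\<Sum>n\<in>{1..N}. exp (v / sqrt m) ^ ndiv P n) * exp (- (v * sqrt m))"
        unfolding W_def expX by (simp add: sum_distrib_right)
      also have "\<dots> \<le> (real N * exp ((exp (v / sqrt m) - 1) * m)) * exp (- (v * sqrt m))"
        unfolding m_def using P that m by (intro mult_right_mono sum_power_ndiv_le) (auto simp: m_def)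
      also have "\<dots> = real N * G v m" by (simp add: G_def mult.assoc mult.commute[of m] flip: exp_add)
      finally show ?thesis .
    qed
    have W_ge: "real N * (L m / 2) \<le> W t"
    proof -
      define y where "y = exp (t / sqrt m)"
      have "real N * (L m / 2) = real N / 2 * (exp ((y - 1) * m - (y - 1)\<^sup>2) - exp (exp 1 * (y - 1) * m - m)) * exp (- (t * sqrt m))"
      proof -
        have "(exp a - exp b) * exp (- q) = exp (a - q) - exp (b - q)" for a b q :: real
          by (simp add: left_diff_distrib flip: exp_add)
        thus ?thesis unfolding L_def y_def mult.assoc by simp
      qed
      \<comment> \<open>Passing from \<open>m\<close> to \<open>R\<close> is free: by m \<le> R the
        second summand is not positive.\<close>
      also have "\<dots> \<le> real N / 2 * (exp ((y - 1) * m - (y - 1)\<^sup>2) - exp (exp 1 * (y - 1) * m - real R)) * exp (- (t * sqrt m)) + 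
         real N / 2 * (exp (exp 1 * (y - 1) * m - real R) - exp (exp 1 * (y - 1) * m - m)) * exp (- (t * sqrt m))"
        by (simp add: algebra_simps)
      also have "real N / 2 * (exp (exp 1 * (y - 1) * m - real R) - exp (exp 1 * (y - 1) * m - m)) * exp (- (t * sqrt m)) \<le> 0"
        using m by (intro mult_nonpos_nonneg mult_nonneg_nonpos) auto
      also have "real N / 2 * (exp ((y - 1) * m - (y - 1)\<^sup>2) - exp (exp 1 * (y - 1) * m - real R)) * exp (- (t * sqrt m))
         \<le> (\<Sum>n\<in>{1..N}. y ^ ndiv P n) * exp (- (t * sqrt m))"
        unfolding m_def using P small m(3) t m(1)
        by (intro mult_right_mono sum_power_ndiv_ge) (auto simp: y_def m_def)
      also have "\<dots> = W t" unfolding W_def expX y_def by (simp add: sum_distrib_right)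
      finally show ?thesis by simp
    qed
    define Q where "Q = {n\<in>{1..N}. real (ndiv P n) \<ge> m + K * sqrt m}"
    have Q: "n \<in> Q \<longleftrightarrow> X n \<ge> t - 2" if "n \<in> {1..N}" for n
      using that m by (auto simp: Q_def X_def t_def field_simps)
    \<comment> \<open>Chernoff's trick on both sides of the window from \<open>t - 2\<close> to
      \<open>t + 2\<close>: below it t X \<le> 2 (t - 2) + (t - 2) X, above it t X \<le> (t + 2) X -
      2 (t + 2), inside it t X \<le> t (t + 2).\<close>
    have "W t \<le> (\<Sum>n\<in>{1..N}. exp (t * (t + 2)) * (if n \<in> Q then 1 else 0) + exp (- (2 * (t + 2))) * exp ((t + 2) * X n)
         + exp (2 * (t - 2)) * exp ((t - 2) * X n))"
      unfolding W_def
    proof (rule sum_mono)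
      fix n assume n: "n \<in> {1..N}"
      have nonneg: "exp (t * (t + 2)) * (if n \<in> Q then 1 else 0) \<ge> 0"
        "exp (- (2 * (t + 2))) * exp ((t + 2) * X n) \<ge> 0" "exp (2 * (t - 2)) * exp ((t - 2) * X n) \<ge> 0"
        by auto
      consider "X n < t - 2" | "X n > t + 2" | "t - 2 \<le> X n" "X n \<le> t + 2" by linarith
      thus "exp (t * X n) \<le> exp (t * (t + 2)) * (if n \<in> Q then 1 else 0) + exp (- (2 * (t + 2))) * exp ((t + 2) * X n)
         + exp (2 * (t - 2)) * exp ((t - 2) * X n)"
      proof cases
        case 1
        have "exp (t * X n) \<le> exp (2 * (t - 2)) * exp ((t - 2) * X n)"
          using 1 by (simp add: algebra_simps flip: exp_add)
        thus ?thesis using nonneg by linarith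
      next
        case 2
        have "exp (t * X n) \<le> exp (- (2 * (t + 2))) * exp ((t + 2) * X n)"
          using 2 by (simp add: algebra_simps flip: exp_add)
        thus ?thesis using nonneg by linarith
      next
        case 3
        have "exp (t * X n) \<le> exp (t * (t + 2)) * (if n \<in> Q then 1 else 0)"
          using Q[OF n] 3 t by simp
        thus ?thesis using nonneg by linarith
      qed
    qed
    also have "\<dots> = exp (t * (t + 2)) * real (card Q) + exp (- (2 * (t + 2))) * W (t + 2) + exp (2 * (t - 2)) * W (t - 2)"
    proof -
      have "(\<Sum>n\<in>{1..N}. if n \<in> Q then 1 else 0 :: real) = real (card Q)"
        by (simp add: sum.If_cases Q_def Int_def cong: conj_cong)
      thus ?thesis unfolding W_def by (simp only: sum.distrib sum_distrib_left[symmetric])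
    qed
    also have "\<dots> \<le> exp (t * (t + 2)) * real (card Q) + exp (- (2 * (t + 2))) * (real N * G (t + 2) m) + exp (2 * (t - 2)) * (real N * G (t - 2) m)"
      using t by (intro add_mono mult_left_mono W_le) auto
    finally have "real N * T m \<le> exp (t * (t + 2)) * real (card Q)"
      using W_ge unfolding T_def by (simp add: algebra_simps)
    moreover have "real N * (D / 2) \<le> real N * T m" using m by (intro mult_left_mono) auto
    ultimately have "real N * (D / 2) \<le> exp (t * (t + 2)) * real (card Q)" by linarith
    hence "exp (- (t * (t + 2))) * (real N * (D / 2)) \<le> exp (- (t * (t + 2))) * (exp (t * (t + 2)) * real (card Q))"
      by (intro mult_left_mono) auto
    also have "\<dots> = real (card Q)" by (simp add: exp_minus)
    finally show "exp (- (t * (t + 2))) * (D / 2) * real N \<le> real (card {n\<in>{1..N}. real (ndiv P n) \<ge>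
        (\<Sum>p\<in>P. 1 / real p) + K * sqrt (\<Sum>p\<in>P. 1 / real p)})"
      by (simp add: Q_def m_def mult_ac)
  qed
qed

text \<open>Only primes up to \<open>N\<close> to the power \<open>1 / (2R)\<close> with \<open>R\<close> about \<open>ln (ln N)\<close> are used, so that products of
  \<open>R\<close> of them stay below \<open>\<surd>N\<close>. This changes \<open>\<Sum>1/p\<close> only by \<open>O(ln (ln (ln N)))\<close>.\<close>

lemma many_prime_factors_proportion:
  fixes K :: real
  assumes "K > 0"
  obtains c where "c > 0"
    "eventually (\<lambda>N. \<exists>P. finite P \<and> (\<forall>p\<in>P. prime p) \<and> c * real N \<le>
       real (card {n\<in>{1..N}. real (ndiv P n) \<ge> ln (ln (real N)) + K * sqrt (ln (ln (real N)))})) sequentially"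
proof -
  \<comment> \<open>With \<open>m\<close> the sum of 1/p over the chosen primes, m \<ge> l - sqrt l
    and sqrt m \<ge> sqrt l / 2, so \<open>2 * K + 2\<close> standard deviations above
    \<open>m\<close> reach \<open>l + K * sqrt l\<close>.\<close>
  have pos: "2 * K + 2 > 0" using assms by simp
  obtain c M where c: "c > 0" and proportion:
    "\<forall>P N R. finite P \<and> (\<forall>p\<in>P. prime p) \<and> (\<Sum>p\<in>P. 1 / real p) \<ge> M \<and>
      (\<Sum>p\<in>P. 1 / real p) \<le> real R \<and>
      (\<forall>S\<subseteq>P. card S \<le> R \<longrightarrow> 2 * real (\<Prod>S) \<le> real N) \<longrightarrow>
      c * real N \<le> real (card {n\<in>{1..N}. real (ndiv P n) \<ge>
        (\<Sum>p\<in>P. 1 / real p) + (2 * K + 2) * sqrt (\<Sum>p\<in>P. 1 / real p)})"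
    using ndiv_large_proportion[OF pos] by blast
  have "eventually (\<lambda>l::real. l \<ge> 1) at_top" by real_asymp
  moreover have "eventually (\<lambda>l::real. exp l / (4 * (l + 5)) \<ge> 1) at_top" by real_asymp
  moreover have "eventually (\<lambda>l::real. l - ln (4 * (l + 5)) - 2 \<ge> l - sqrt l) at_top" by real_asymp
  moreover have "eventually (\<lambda>l::real. l - sqrt l \<ge> l / 4) at_top" by real_asymp
  moreover have "eventually (\<lambda>l::real. l / 4 \<ge> M) at_top" by real_asymp
  ultimately have "eventually (\<lambda>l::real. l \<ge> 1 \<and> exp l / (4 * (l + 5)) \<ge> 1 \<and>
      l - ln (4 * (l + 5)) - 2 \<ge> l - sqrt l \<and> l - sqrt l \<ge> l / 4 \<and> l / 4 \<ge> M) at_top"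
    by (simp only: eventually_conj_iff)
  moreover have "filterlim (\<lambda>N. ln (ln (real N))) at_top sequentially" by real_asymp
  ultimately have "eventually (\<lambda>N. ln (ln (real N)) \<ge> 1 \<and> exp (ln (ln (real N))) / (4 * (ln (ln (real N)) + 5)) \<ge> 1 \<and>
      ln (ln (real N)) - ln (4 * (ln (ln (real N)) + 5)) - 2 \<ge> ln (ln (real N)) - sqrt (ln (ln (real N))) \<and>
      ln (ln (real N)) - sqrt (ln (ln (real N))) \<ge> ln (ln (real N)) / 4 \<and> ln (ln (real N)) / 4 \<ge> M) sequentially"
    using eventually_compose_filterlim by blast
  moreover have "eventually (\<lambda>N::nat. N \<ge> 3) sequentially" by (rule eventually_ge_at_top)
  ultimately have "eventually (\<lambda>N. \<exists>P. finite P \<and> (\<forall>p\<in>P. prime p) \<and> c * real N \<le>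
       real (card {n\<in>{1..N}. real (ndiv P n) \<ge> ln (ln (real N)) + K * sqrt (ln (ln (real N)))})) sequentially"
  proof eventually_elim
    case (elim N)
    define l where "l = ln (ln (real N))"
    \<comment> \<open>The sum of 1/p will be at most \<open>l + 4\<close>, so this \<open>R\<close>
      dominates it, as the proportion bound demands, and still grows only like
      \<open>l\<close>.\<close>
    define R where "R = nat \<lceil>l + 4\<rceil>"
    define x where "x = exp (ln (real N) / (2 * real R))"
    define z where "z = nat \<lfloor>x\<rfloor>"
    have l: "l \<ge> 1" "exp l / (4 * (l + 5)) \<ge> 1" "l - ln (4 * (l + 5)) - 2 \<ge> l - sqrt l"
      "l - sqrt l \<ge> l / 4" "l / 4 \<ge> M"
      using elim by (auto simp: l_def)
    have N: "N \<ge> 3" using elim by blast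
    have expl: "exp l = ln (real N)" using N by (simp add: l_def)
    have R: "l + 4 \<le> real R" "real R \<le> l + 5" using l by (auto simp: R_def) linarith+
    have lnN: "ln (real N) \<ge> 4 * (l + 5)" using l by (simp add: expl field_simps)
    have q: "ln (real N) / (4 * real R) \<ge> 1" using lnN R l by (simp add: field_simps)
    have "exp 1 \<ge> (2::real)" using exp_ge_add_one_self[of 1] by simp
    hence "exp 1 ^ 2 \<ge> (2::real) ^ 2" by (intro power_mono) auto
    hence "exp 2 \<ge> (4::real)" by (simp flip: exp_of_nat_mult)
    moreover have "exp 2 \<le> x" using q by (simp add: x_def)
    ultimately have x4: "x \<ge> 4" by linarith
    have zx: "real z \<le> x" "real z \<ge> x / 2" "z \<ge> 2"
      using x4 unfolding z_def by linarith+
    have "ln (real N) / (4 * real R) \<le> ln (real N) / (2 * real R) - 1" using q by simp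
    also have "\<dots> \<le> ln x - ln 2" using ln_2_less_1 by (simp add: x_def)
    also have "\<dots> = ln (x / 2)" using x4 by (simp add: ln_div)
    also have "\<dots> \<le> ln (real z)" using zx x4 by simp
    finally have "ln (ln (real N) / (4 * real R)) \<le> ln (ln (real z))"
      using q by simp
    moreover have "ln (ln (real N) / (4 * real R)) = l - ln (4 * real R)"
      using N R l lnN by (simp add: ln_div l_def)
    moreover have "ln (4 * real R) \<le> ln (4 * (l + 5))" using R l by simp
    ultimately have llz: "ln (ln (real z)) \<ge> l - ln (4 * (l + 5))" by linarith
    have "x \<le> exp (ln (real N))" using R l lnN by (simp add: x_def field_simps)
    hence "z \<le> N" using zx N by simp
    hence "ln (ln (real z)) \<le> l" unfolding l_def using zx by simp
    define m where "m = (\<Sum>p\<in>primes_upto z. 1 / real p)"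
    have m: "m \<le> l + 4" "m \<ge> l - sqrt l" "m \<ge> l / 4"
      using sum_inverse_primes_le[of z] sum_inverse_primes_ge[of z] zx llz l \<open>ln (ln (real z)) \<le> l\<close>
      unfolding m_def by linarith+
    have "c * real N \<le> real (card {n\<in>{1..N}. real (ndiv (primes_upto z) n) \<ge> m + (2 * K + 2) * sqrt m})"
      unfolding m_def
    proof (rule proportion[rule_format], intro conjI allI impI ballI)
      show "(\<Sum>p\<in>primes_upto z. 1 / real p) \<ge> M" "(\<Sum>p\<in>primes_upto z. 1 / real p) \<le> real R"
        using m l R by (simp_all add: m_def)
      fix S assume S: "S \<subseteq> primes_upto z" "card S \<le> R"
      have "real (\<Prod>S) = (\<Prod>p\<in>S. real p)" by simp
      also have "\<dots> \<le> (\<Prod>p\<in>S. real z)" using S by (intro prod_mono) auto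
      also have "\<dots> = real z ^ card S" by simp
      also have "\<dots> \<le> real z ^ R" using S zx by (intro power_increasing) auto
      also have "\<dots> \<le> x ^ R" using zx by (intro power_mono) auto
      also have "\<dots> = exp (ln (real N) / 2)" using R l by (simp add: x_def flip: exp_of_nat_mult)
      finally have "2 * real (\<Prod>S) \<le> 2 * exp (ln (real N) / 2)" by simp
      also have "2 \<le> exp (ln (real N) / 2)"
        using exp_ge_add_one_self[of "ln (real N) / 2"] lnN l(1) by argo
      hence "2 * exp (ln (real N) / 2) \<le> exp (ln (real N) / 2) * exp (ln (real N) / 2)"
        by (intro mult_right_mono) auto
      also have "\<dots> = real N" using N by (simp flip: exp_add)
      finally show "2 * real (\<Prod>S) \<le> real N" .
    qed auto
    also have "\<dots> \<le> real (card {n\<in>{1..N}. real (ndiv (primes_upto z) n) \<ge> l + K * sqrt l})"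
    proof -
      have "sqrt (l / 4) \<le> sqrt m" using m by simp
      hence "sqrt l / 2 \<le> sqrt m" by (simp add: real_sqrt_divide)
      hence "(2 * K + 2) * (sqrt l / 2) \<le> (2 * K + 2) * sqrt m"
        using assms by (intro mult_left_mono) auto
      hence "l + K * sqrt l \<le> m + (2 * K + 2) * sqrt m"
        using m by (simp add: algebra_simps)
      hence "card {n\<in>{1..N}. real (ndiv (primes_upto z) n) \<ge> m + (2 * K + 2) * sqrt m} \<le>
        card {n\<in>{1..N}. real (ndiv (primes_upto z) n) \<ge> l + K * sqrt l}"
        by (intro card_mono) auto
      thus ?thesis by simp
    qed
    finally show ?case unfolding l_def by (intro exI[of _ "primes_upto z"]) auto
  qed
  thus ?thesis using that c by blast
qed

section \<open>Prime factors counted with multiplicity\<close>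

definition bigomega :: "nat \<Rightarrow> nat" where
  "bigomega n = size (prime_factorization n)"

lemma bigomega_mult: "m > 0 \<Longrightarrow> n > 0 \<Longrightarrow> bigomega (m * n) = bigomega m + bigomega n"
  by (simp add: bigomega_def prime_factorization_mult)

lemma bigomega_eq_sum:
  assumes "n \<in> {1..N}"
  shows "bigomega n = (\<Sum>p\<in>primes_upto N. multiplicity p n)"
proof -
  have "bigomega n = (\<Sum>p\<in>prime_factors n. count (prime_factorization n) p)"
    by (simp add: bigomega_def size_multiset_overloaded_eq)
  also have "\<dots> = (\<Sum>p\<in>prime_factors n. multiplicity p n)"
    by (intro sum.cong) (auto simp: count_prime_factorization in_prime_factors_iff)
  also have "\<dots> = (\<Sum>p\<in>primes_upto N. multiplicity p n)"
    unfolding prime_factors_eq_filter[OF assms]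
    by (intro sum.mono_neutral_left) (auto simp: not_dvd_imp_multiplicity_0)
  finally show ?thesis .
qed

lemma sum_multiples:
  fixes d n :: nat
  assumes "d > 0" "\<And>m. \<not> d dvd m \<Longrightarrow> f m = 0"
  shows "(\<Sum>m\<in>{1..n}. f m) = (\<Sum>m\<in>{1..n div d}. f (d * m))"
proof -
  have "(\<Sum>m\<in>{1..n}. f m) = (\<Sum>m\<in>{m\<in>{1..n}. d dvd m}. f m)"
    using assms by (intro sum.mono_neutral_right) auto
  also have "\<dots> = (\<Sum>m\<in>{1..n div d}. f (d * m))"
    unfolding multiples_eq_image[OF assms(1)]
    using assms(1) by (subst sum.reindex) (auto simp: inj_on_def)
  finally show ?thesis .
qed

lemma sum_multiplicity_Suc:
  assumes "prime (p::nat)"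
  shows "(\<Sum>n\<in>{1..x}. multiplicity p n) = (\<Sum>m\<in>{1..x div p}. Suc (multiplicity p m))"
proof -
  have "(\<Sum>n\<in>{1..x}. multiplicity p n) = (\<Sum>m\<in>{1..x div p}. multiplicity p (p * m))"
    using assms by (intro sum_multiples) (auto simp: prime_gt_0_nat not_dvd_imp_multiplicity_0)
  also have "\<dots> = (\<Sum>m\<in>{1..x div p}. Suc (multiplicity p m))"
    using assms by (intro sum.cong multiplicity_times_same) (auto simp: prime_gt_0_nat)
  finally show ?thesis .
qed

text \<open>Induction from \<open>x div p\<close> to \<open>x\<close>: each multiple of
  \<open>p\<close> gives up one factor \<open>p\<close>, so a mean q would satisfy q = (1 + q) / p,
  with solution \<open>1 / (p - 1)\<close>.\<close>

lemma sum_multiplicity_le: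
  assumes "prime (p::nat)"
  shows "real (\<Sum>n\<in>{1..x}. multiplicity p n) \<le> real x / (real p - 1)"
proof (induction x rule: less_induct)
  case (less x)
  have p: "p > 1" "real p > 1" using assms prime_gt_1_nat by auto
  show ?case
  proof (cases "x = 0")
    case False
    have "real (\<Sum>n\<in>{1..x}. multiplicity p n) = real (x div p) + real (\<Sum>m\<in>{1..x div p}. multiplicity p m)"
      by (subst sum_multiplicity_Suc[OF assms]) (simp only: Suc_eq_plus1 sum.distrib, simp)
    also have "\<dots> \<le> real (x div p) + real (x div p) / (real p - 1)"
      using False p by (intro add_left_mono less) auto
    also have "\<dots> = real (x div p) * (1 + 1 / (real p - 1))" by (simp add: algebra_simps)
    also have "\<dots> \<le> real x / real p * (1 + 1 / (real p - 1))"
      using p by (intro mult_right_mono div_le_real) auto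
    also have "\<dots> = real x / (real p - 1)" using p by (simp add: field_simps)
    finally show ?thesis .
  qed auto
qed

section \<open>Prime factors with and without multiplicity\<close>

lemma ndiv_primes_upto_le_bigomega:
  assumes "n \<in> {1..N}"
  shows "ndiv (primes_upto N) n \<le> bigomega n"
proof -
  have "ndiv (primes_upto N) n = (\<Sum>p\<in>primes_upto N. if p dvd n then 1 else 0)"
    by (simp add: ndiv_def sum.If_cases Int_def)
  also have "\<dots> \<le> (\<Sum>p\<in>primes_upto N. multiplicity p n)"
    using assms by (intro sum_mono) (auto simp: prime_multiplicity_gt_zero_iff Suc_le_eq)
  finally show ?thesis using bigomega_eq_sum[OF assms] by simp
qed

text \<open>One occurrence of each prime cancels, which leaves a contribution of order N / p^2 for
  the prime p. With Markov's inequality this carries bounds for distinct primes over to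
  \<open>bigomega\<close>.\<close>

lemma sum_bigomega_minus_ndiv_le:
  "(\<Sum>n\<in>{1..N}. real (bigomega n) - real (ndiv (primes_upto N) n)) \<le> 2 * real N"
proof -
  have "(\<Sum>n\<in>{1..N}. real (bigomega n) - real (ndiv (primes_upto N) n))
     = (\<Sum>n\<in>{1..N}. (\<Sum>p\<in>primes_upto N. real (multiplicity p n)) - (\<Sum>p\<in>primes_upto N. if p dvd n then 1 else 0))"
  proof (intro sum.cong arg_cong2[of _ _ _ _ "(-)"] refl)
    fix n assume "n \<in> {1..N}"
    thus "real (bigomega n) = (\<Sum>p\<in>primes_upto N. real (multiplicity p n))"
      by (simp only: bigomega_eq_sum of_nat_sum)
    show "real (ndiv (primes_upto N) n) = (\<Sum>p\<in>primes_upto N. if p dvd n then 1 else 0)"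
      by (simp add: ndiv_def sum.If_cases Int_def)
  qed
  also have "\<dots> = (\<Sum>p\<in>primes_upto N. (\<Sum>n\<in>{1..N}. real (multiplicity p n) - (if p dvd n then 1 else 0)))"
    by (simp only: sum_subtractf[symmetric] sum.swap[of _ "{1..N}"])
  also have "\<dots> \<le> (\<Sum>p\<in>primes_upto N. 2 * real N * (1 / (real p)\<^sup>2))"
  proof (rule sum_mono)
    fix p assume "p \<in> primes_upto N"
    hence p: "prime p" "p \<ge> 2" "p > 0" using prime_ge_2_nat prime_gt_0_nat by auto
    have "(\<Sum>n\<in>{1..N}. real (multiplicity p n) - (if p dvd n then 1 else 0))
        = (\<Sum>m\<in>{1..N div p}. real (multiplicity p (p * m)) - (if p dvd p * m then 1 else 0))"
      using p by (intro sum_multiples) (auto simp: not_dvd_imp_multiplicity_0)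
    also have "\<dots> = (\<Sum>m\<in>{1..N div p}. real (multiplicity p m))"
      using p by (intro sum.cong refl) (simp add: multiplicity_times_same)
    also have "\<dots> \<le> real (N div p) / (real p - 1)"
      using sum_multiplicity_le[OF p(1), of "N div p"] by simp
    also have "\<dots> \<le> (real N / real p) / (real p / 2)"
      using p by (intro frac_le div_le_real) auto
    also have "\<dots> = 2 * real N * (1 / (real p)\<^sup>2)" by (simp add: power2_eq_square)
    finally show "(\<Sum>n\<in>{1..N}. real (multiplicity p n) - (if p dvd n then 1 else 0)) \<le> 2 * real N * (1 / (real p)\<^sup>2)" .
  qed
  also have "\<dots> = 2 * real N * (\<Sum>p\<in>primes_upto N. 1 / (real p)\<^sup>2)"
    by (simp only: sum_distrib_left)
  also have "\<dots> \<le> 2 * real N * 1"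
    by (intro mult_left_mono sum_inverse_squares_le) (auto simp: prime_ge_2_nat)
  finally show ?thesis by simp
qed

text \<open>Either the number of distinct primes reaches \<open>l + (K - 1) * sqrt l\<close>, or
  repetitions account for at least \<open>sqrt l\<close>. The first set is small by a Chernoff bound
  with parameter \<open>1 / sqrt l\<close>, the second by Markov's inequality for the excess of
  \<open>bigomega\<close> over \<open>ndiv\<close>.\<close>

lemma bigomega_large_proportion:
  fixes e :: real
  assumes "e > 0"
  obtains K where "K > 0"
    "eventually (\<lambda>N. real (card {n\<in>{1..N}. real (bigomega n) > ln (ln (real N)) + K * sqrt (ln (ln (real N)))})
       \<le> e * real N) sequentially"
proof -
  \<comment> \<open>The Chernoff bound below is \<open>exp (2 - (K - 1))\<close>: the part of the
    exponent without \<open>K\<close> tends to 1/2 and is eventually below 2.\<close>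
  define K where "K = max 1 (3 - ln (e / 2))"
  have K: "K > 0" "exp (3 - K) \<le> e / 2"
  proof -
    have "exp (3 - K) \<le> exp (ln (e / 2))" by (simp add: K_def)
    thus "exp (3 - K) \<le> e / 2" using assms by simp
  qed (simp add: K_def)
  have "((\<lambda>l::real. (exp (1 / sqrt l) - 1) * (l + 4) - sqrt l) \<longlongrightarrow> 1 / 2) at_top" by real_asymp
  hence "eventually (\<lambda>l::real. (exp (1 / sqrt l) - 1) * (l + 4) - sqrt l < 2) at_top"
    by (rule order_tendstoD) auto
  moreover have "eventually (\<lambda>l::real. l \<ge> 1) at_top" by real_asymp
  moreover have "eventually (\<lambda>l::real. 2 / sqrt l \<le> e / 2) at_top" using assms by real_asymp
  ultimately have "eventually (\<lambda>l::real. (exp (1 / sqrt l) - 1) * (l + 4) - sqrt l < 2 \<and> l \<ge> 1 \<and> 2 / sqrt l \<le> e / 2) at_top"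
    by (simp only: eventually_conj_iff)
  moreover have "filterlim (\<lambda>N. ln (ln (real N))) at_top sequentially" by real_asymp
  ultimately have "eventually (\<lambda>N. (exp (1 / sqrt (ln (ln (real N)))) - 1) * (ln (ln (real N)) + 4) - sqrt (ln (ln (real N))) < 2 \<and>
      ln (ln (real N)) \<ge> 1 \<and> 2 / sqrt (ln (ln (real N))) \<le> e / 2) sequentially"
    using eventually_compose_filterlim by blast
  moreover have "eventually (\<lambda>N::nat. N \<ge> 3) sequentially" by (rule eventually_ge_at_top)
  ultimately have "eventually (\<lambda>N. real (card {n\<in>{1..N}. real (bigomega n) > ln (ln (real N)) + K * sqrt (ln (ln (real N)))})
       \<le> e * real N) sequentially"
  proof eventually_elim
    case (elim N)
    define l where "l = ln (ln (real N))"
    have l: "(exp (1 / sqrt l) - 1) * (l + 4) - sqrt l < 2" "l \<ge> 1" "2 / sqrt l \<le> e / 2"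
      using elim by (auto simp: l_def)
    define w where "w n = ndiv (primes_upto N) n" for n
    define A where "A = {n\<in>{1..N}. real (w n) \<ge> l + (K - 1) * sqrt l}"
    define B where "B = {n\<in>{1..N}. real (bigomega n) - real (w n) \<ge> sqrt l}"
    have "{n\<in>{1..N}. real (bigomega n) > l + K * sqrt l} \<subseteq> A \<union> B"
      by (auto simp: A_def B_def algebra_simps)
    hence "card {n\<in>{1..N}. real (bigomega n) > l + K * sqrt l} \<le> card (A \<union> B)"
      by (intro card_mono) (auto simp: A_def B_def)
    also have "\<dots> \<le> card A + card B" by (rule card_Un_le)
    finally have *: "real (card {n\<in>{1..N}. real (bigomega n) > l + K * sqrt l}) \<le> real (card A) + real (card B)"
      by simp
    have "sqrt l * real (card B) = (\<Sum>n\<in>B. sqrt l)" by simp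
    also have "\<dots> \<le> (\<Sum>n\<in>B. real (bigomega n) - real (w n))" by (intro sum_mono) (auto simp: B_def)
    also have "\<dots> \<le> (\<Sum>n\<in>{1..N}. real (bigomega n) - real (w n))"
      using ndiv_primes_upto_le_bigomega by (intro sum_mono2) (auto simp: B_def w_def)
    also have "\<dots> \<le> 2 * real N" unfolding w_def by (rule sum_bigomega_minus_ndiv_le)
    finally have "real (card B) \<le> (2 / sqrt l) * real N" using l by (simp add: field_simps)
    also have "\<dots> \<le> e / 2 * real N" using l by (intro mult_right_mono) auto
    finally have B: "real (card B) \<le> e / 2 * real N" .
    have "exp (sqrt l + (K - 1)) * real (card A) = (\<Sum>n\<in>A. exp (sqrt l + (K - 1)))" by simp
    also have "\<dots> \<le> (\<Sum>n\<in>A. exp (1 / sqrt l) ^ w n)"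
    proof (rule sum_mono)
      fix n assume "n \<in> A"
      hence "(l + (K - 1) * sqrt l) / sqrt l \<le> real (w n) / sqrt l"
        using l by (intro divide_right_mono) (auto simp: A_def)
      also have "(l + (K - 1) * sqrt l) / sqrt l = sqrt l + (K - 1)"
        using l by (simp add: add_divide_distrib real_div_sqrt)
      finally have "exp (sqrt l + (K - 1)) \<le> exp (real (w n) * (1 / sqrt l))" by simp
      also have "\<dots> = exp (1 / sqrt l) ^ w n" by (rule exp_of_nat_mult)
      finally show "exp (sqrt l + (K - 1)) \<le> exp (1 / sqrt l) ^ w n" .
    qed
    also have "\<dots> \<le> (\<Sum>n\<in>{1..N}. exp (1 / sqrt l) ^ w n)"
      by (intro sum_mono2) (auto simp: A_def)
    also have "\<dots> \<le> real N * exp ((exp (1 / sqrt l) - 1) * (\<Sum>p\<in>primes_upto N. 1 / real p))"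
      unfolding w_def using l by (intro sum_power_ndiv_le) auto
    also have "\<dots> \<le> real N * exp ((exp (1 / sqrt l) - 1) * (l + 4))"
    proof -
      have "(exp (1 / sqrt l) - 1) * (\<Sum>p\<in>primes_upto N. 1 / real p) \<le> (exp (1 / sqrt l) - 1) * (l + 4)"
        using sum_inverse_primes_le[of N] elim(2) l(2) unfolding l_def[symmetric] by (intro mult_left_mono) auto
      thus ?thesis by (simp add: mult_left_mono)
    qed
    finally have "real (card A) \<le> real N * exp ((exp (1 / sqrt l) - 1) * (l + 4)) / exp (sqrt l + (K - 1))"
      by (simp add: field_simps)
    also have "\<dots> = real N * exp ((exp (1 / sqrt l) - 1) * (l + 4) - (sqrt l + (K - 1)))"
      by (simp add: exp_diff)
    also have "\<dots> \<le> real N * exp (3 - K)" using l by (intro mult_left_mono) auto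
    also have "\<dots> \<le> real N * (e / 2)" using K by (intro mult_left_mono) auto
    finally have "real (card A) \<le> e / 2 * real N" by (simp add: mult.commute)
    thus ?case using * B by (simp add: l_def)
  qed
  thus ?thesis using that K by blast
qed

section \<open>Divisor sums\<close>

lemma card_divisors_prime_mult_le:
  fixes p m :: nat
  assumes "prime p" "m > 0"
  shows "card {d. d dvd p * m} \<le> 2 * card {d. d dvd m}"
proof -
  have fin: "finite {d. d dvd m}" using assms by (simp add: finite_divisors_nat)
  have "{d. d dvd p * m} \<subseteq> {d. d dvd m} \<union> (*) p ` {d. d dvd m}"
  proof
    fix d assume d: "d \<in> {d. d dvd p * m}"
    show "d \<in> {d. d dvd m} \<union> (*) p ` {d. d dvd m}"
    proof (cases "p dvd d")
      case True
      then obtain e where "d = p * e" by blast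
      thus ?thesis using d assms by (auto simp: prime_gt_0_nat)
    next
      case False
      hence "coprime d p" using prime_imp_coprime[OF assms(1)] coprime_commute by blast
      thus ?thesis using d by (simp add: coprime_dvd_mult_right_iff)
    qed
  qed
  hence "card {d. d dvd p * m} \<le> card ({d. d dvd m} \<union> (*) p ` {d. d dvd m})"
    using fin by (intro card_mono) auto
  also have "\<dots> \<le> card {d. d dvd m} + card ((*) p ` {d. d dvd m})" by (rule card_Un_le)
  also have "card ((*) p ` {d. d dvd m}) \<le> card {d. d dvd m}" using fin by (rule card_image_le)
  finally show ?thesis by simp
qed

lemma bigomega_prime_mult: "prime p \<Longrightarrow> m > 0 \<Longrightarrow> bigomega (p * m) = Suc (bigomega m)"
  by (simp add: bigomega_def prime_factorization_mult prime_factorization_prime prime_gt_0_nat)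

lemma card_divisors_le:
  assumes "n > 0"
  shows "card {d. d dvd n} \<le> 2 ^ bigomega n"
  using assms
proof (induction n rule: less_induct)
  case (less n)
  show ?case
  proof (cases "n = 1")
    case False
    then obtain p where p: "prime p" "p dvd n" using prime_factor_nat by blast
    then obtain m where m: "n = p * m" by blast
    have "m > 0" "m < n" using less.prems m prime_gt_1_nat[OF p(1)] by auto
    hence "card {d. d dvd m} \<le> 2 ^ bigomega m" by (intro less)
    moreover have "card {d. d dvd n} \<le> 2 * card {d. d dvd m}"
      unfolding m by (intro card_divisors_prime_mult_le p \<open>m > 0\<close>)
    ultimately show ?thesis unfolding m bigomega_prime_mult[OF p(1) \<open>m > 0\<close>] by simp
  qed auto
qed

text \<open>Different sets of prime factors have different products, and each product is a
  divisor.\<close>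

lemma two_power_card_prime_factors_le:
  fixes n :: nat
  assumes "n > 0"
  shows "2 ^ card (prime_factors n) \<le> card {d. d dvd n}"
proof -
  have "inj_on Prod (Pow (prime_factors n))"
  proof (rule inj_onI)
    fix A B assume AB: "A \<in> Pow (prime_factors n)" "B \<in> Pow (prime_factors n)" "\<Prod>A = \<Prod>B"
    have *: "p \<in> C \<longleftrightarrow> prime p \<and> p dvd \<Prod>C" if C: "C \<in> Pow (prime_factors n)" for C p
    proof
      assume "p \<in> C"
      moreover have "finite C" using C by (auto intro: finite_subset)
      ultimately show "prime p \<and> p dvd \<Prod>C" using C dvd_prodI[of C p "\<lambda>x. x"] by auto
    next
      assume p: "prime p \<and> p dvd \<Prod>C"
      moreover have "finite C" using C by (auto intro: finite_subset)
      ultimately obtain q where q: "q \<in> C" "p dvd q" using prime_dvd_prod_iff[of C p "\<lambda>x. x"] by auto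
      have "prime q" using q C by auto
      hence "p = q" using p q by (intro primes_dvd_imp_eq) auto
      thus "p \<in> C" using q by simp
    qed
    show "A = B"
    proof (rule set_eqI)
      fix p
      show "p \<in> A \<longleftrightarrow> p \<in> B" unfolding *[OF AB(1)] *[OF AB(2)] AB(3) ..
    qed
  qed
  hence "card (Pow (prime_factors n)) = card (Prod ` Pow (prime_factors n))"
    by (simp add: card_image)
  also have "\<dots> \<le> card {d. d dvd n}"
  proof (rule card_mono)
    show "Prod ` Pow (prime_factors n) \<subseteq> {d. d dvd n}"
    proof safe
      fix S assume "S \<subseteq> prime_factors n"
      thus "\<Prod>S dvd n" using finite_subset[of S "prime_factors n"]
        by (intro prod_primes_dvd) (auto simp: in_prime_factors_iff)
    qed
  qed (use assms in \<open>simp add: finite_divisors_nat\<close>)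
  finally show ?thesis by (simp add: card_Pow)
qed

lemma sum_inverse_le: "x \<ge> 1 \<Longrightarrow> (\<Sum>n\<in>{1..x}. 1 / real n) \<le> 1 + ln (real x)"
proof (induction x rule: dec_induct)
  case (step n)
  have "1 - real n / real (Suc n) \<le> ln (real (Suc n)) - ln (real n)"
    using step by (intro one_minus_ln_ratio_le) auto
  moreover have "1 - real n / real (Suc n) = 1 / real (Suc n)" by (simp add: field_simps)
  ultimately show ?case using step.IH by simp
qed auto

lemma sum_card_divisors_le:
  assumes "x \<ge> 1"
  shows "(\<Sum>n\<in>{1..x}. real (card {d. d dvd n})) \<le> real x * (1 + ln (real x))"
proof -
  have "(\<Sum>n\<in>{1..x}. real (card {d. d dvd n})) = (\<Sum>n\<in>{1..x}. \<Sum>d\<in>{d\<in>{1..x}. d dvd n}. 1)"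
  proof (rule sum.cong[OF refl])
    fix n assume n: "n \<in> {1..x}"
    have "{d. d dvd n} = {d\<in>{1..x}. d dvd n}"
    proof safe
      fix d assume "d dvd n"
      thus "d \<in> {1..x}" using n dvd_imp_le[of d n] dvd_pos_nat[of n d] by auto
    qed
    thus "real (card {d. d dvd n}) = (\<Sum>d\<in>{d\<in>{1..x}. d dvd n}. 1)" by simp
  qed
  also have "\<dots> = (\<Sum>d\<in>{1..x}. \<Sum>n\<in>{n\<in>{1..x}. d dvd n}. 1)"
    by (rule sum.swap_restrict) auto
  also have "\<dots> = (\<Sum>d\<in>{1..x}. real (card {n\<in>{1..x}. d dvd n}))" by simp
  also have "\<dots> = (\<Sum>d\<in>{1..x}. real (x div d))"
    by (intro sum.cong arg_cong[of _ _ real] card_multiples) auto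
  also have "\<dots> \<le> (\<Sum>d\<in>{1..x}. real x * (1 / real d))"
    using div_le_real by (intro sum_mono) simp
  also have "\<dots> = real x * (\<Sum>d\<in>{1..x}. 1 / real d)" by (simp only: sum_distrib_left)
  also have "\<dots> \<le> real x * (1 + ln (real x))"
    using sum_inverse_le[OF assms] by (intro mult_left_mono) auto
  finally show ?thesis .
qed

text \<open>Markov's inequality for the divisor function, whose mean is at most
  \<open>1 + ln x\<close>. It is applied at \<open>x = N * N\<close>, to products of two numbers
  with many prime factors.\<close>

lemma card_many_prime_factors_le:
  assumes "x \<ge> 1"
  shows "2 powr T * real (card {n\<in>{1..x}. real (card (prime_factors n)) \<ge> T}) \<le> real x * (1 + ln (real x))"
proof -
  define B where "B = {n\<in>{1..x}. real (card (prime_factors n)) \<ge> T}"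
  have "2 powr T * real (card B) = (\<Sum>n\<in>B. 2 powr T)" by simp
  also have "\<dots> \<le> (\<Sum>n\<in>B. real (card {d. d dvd n}))"
  proof (rule sum_mono)
    fix n assume n: "n \<in> B"
    have "2 powr T \<le> 2 powr real (card (prime_factors n))" using n by (simp add: B_def)
    also have "\<dots> = real (2 ^ card (prime_factors n))" by (simp add: powr_realpow)
    also have "\<dots> \<le> real (card {d. d dvd n})"
      using n two_power_card_prime_factors_le[of n] by (simp add: B_def del: of_nat_power)
    finally show "2 powr T \<le> real (card {d. d dvd n})" .
  qed
  also have "\<dots> \<le> (\<Sum>n\<in>{1..x}. real (card {d. d dvd n}))"
    by (intro sum_mono2) (auto simp: B_def)
  also have "\<dots> \<le> real x * (1 + ln (real x))" by (rule sum_card_divisors_le[OF assms])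
  finally show ?thesis unfolding B_def .
qed

section \<open>Mean values of \<open>2\<^sup>-\<^sup>\<Omega>\<close>\<close>

text \<open>Completely multiplicative, and the reciprocal of the bound in
  \<open>card_divisors_le\<close>, so that its product with the divisor function is at most 1. This
  makes the sum of \<open>half_wt n / n\<close> accessible by squaring.\<close>

definition half_wt :: "nat \<Rightarrow> real" where
  "half_wt n = (1 / 2) ^ bigomega n"

definition half_sum :: "nat \<Rightarrow> real" where
  "half_sum x = (\<Sum>n\<in>{1..x}. half_wt n)"

lemma half_wt_nonneg [simp]: "half_wt n \<ge> 0"
  and half_wt_le_1: "half_wt n \<le> 1"
  by (auto simp: half_wt_def power_le_one)

lemma half_wt_mult: "m > 0 \<Longrightarrow> n > 0 \<Longrightarrow> half_wt (m * n) = half_wt m * half_wt n"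
  by (simp add: half_wt_def bigomega_mult power_add)

lemma half_wt_prime_mult: "prime p \<Longrightarrow> n > 0 \<Longrightarrow> half_wt (p * n) = half_wt n / 2"
  by (simp add: half_wt_def bigomega_prime_mult)

lemma half_sum_nonneg [simp]: "half_sum x \<ge> 0"
  by (auto simp: half_sum_def intro: sum_nonneg)

lemma half_sum_le: "half_sum x \<le> real x"
  using sum_bounded_above[of "{1..x}" half_wt 1] half_wt_le_1 by (simp add: half_sum_def)

lemma half_wt_mult_card_divisors_le: "n > 0 \<Longrightarrow> half_wt n * real (card {d. d dvd n}) \<le> 1"
  using card_divisors_le[of n] by (simp add: half_wt_def power_divide divide_le_eq_1 flip: of_nat_le_iff)

text \<open>The square of the sum is \<open>\<Sum>2\<^sup>-\<^sup>\<Omega>\<^sup>(\<^sup>n\<^sup>) \<tau>(n) / n\<close> over some \<open>n \<le> x\<^sup>2\<close>, and \<open>\<tau> \<le> 2\<^sup>\<Omega>\<close>.\<close>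

lemma sum_half_wt_div_le:
  assumes "x \<ge> 1"
  shows "(\<Sum>n\<in>{1..x}. half_wt n / real n) \<le> sqrt (1 + 2 * ln (real x))"
proof -
  define g where "g n = half_wt n / real n" for n
  have g0: "g n \<ge> 0" for n by (simp add: g_def)
  define X where "X = {1..x} \<times> {1..x}"
  define h where "h = (\<lambda>(a, b). a * b :: nat)"
  have hX: "h ` X \<subseteq> {1..x * x}"
    by (auto simp: X_def h_def mult_le_mono intro: Suc_le_eq[THEN iffD2])
  have "(\<Sum>n\<in>{1..x}. g n)\<^sup>2 = (\<Sum>(a, b)\<in>X. g a * g b)"
    by (simp add: power2_eq_square sum_product sum.cartesian_product X_def)
  also have "\<dots> = (\<Sum>z\<in>X. g (h z))"
    by (intro sum.cong) (auto simp: X_def h_def g_def half_wt_mult)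
  also have "\<dots> = (\<Sum>n\<in>{1..x * x}. \<Sum>z\<in>{z\<in>X. h z = n}. g (h z))"
    by (rule sum.group[symmetric]) (use hX in \<open>auto simp: X_def\<close>)
  also have "\<dots> \<le> (\<Sum>n\<in>{1..x * x}. 1 / real n)"
  proof (rule sum_mono)
    fix n assume n: "n \<in> {1..x * x}"
    have "(\<Sum>z\<in>{z\<in>X. h z = n}. g (h z)) = real (card {z\<in>X. h z = n}) * g n" by simp
    also have "card {z\<in>X. h z = n} \<le> card {d. d dvd n}"
    proof (rule card_inj_on_le[of fst])
      show "inj_on fst {z\<in>X. h z = n}" using n by (auto simp: inj_on_def h_def X_def)
      show "finite {d. d dvd n}" using n by (simp add: finite_divisors_nat)
    qed (auto simp: h_def)
    hence "real (card {z\<in>X. h z = n}) * g n \<le> real (card {d. d dvd n}) * g n"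
      using g0 by (intro mult_right_mono) auto
    also have "\<dots> = (half_wt n * real (card {d. d dvd n})) / real n" by (simp add: g_def)
    also have "\<dots> \<le> 1 / real n"
      using n half_wt_mult_card_divisors_le[of n] by (intro divide_right_mono) auto
    finally show "(\<Sum>z\<in>{z\<in>X. h z = n}. g (h z)) \<le> 1 / real n" .
  qed
  also have "\<dots> \<le> 1 + ln (real (x * x))" using assms by (intro sum_inverse_le) simp
  also have "\<dots> = 1 + 2 * ln (real x)" using assms by (simp add: ln_mult)
  finally show ?thesis unfolding g_def by (rule real_le_rsqrt)
qed

text \<open>Writing \<open>D(x)\<close> for the left-hand side and \<open>F\<close> for \<^const>\<open>half_sum\<close>, the substitution \<open>n = p m\<close> gives
  \<open>D(x) = (F(x div p) + D(x div p)) / 2\<close>, and \<open>D(x div p) \<le> D(x)\<close>.\<close>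

lemma sum_half_wt_multiplicity_le:
  assumes "prime p"
  shows "(\<Sum>n\<in>{1..x}. half_wt n * real (multiplicity p n)) \<le> half_sum (x div p)"
proof -
  define D where "D x = (\<Sum>n\<in>{1..x}. half_wt n * real (multiplicity p n))" for x
  have "D x = (\<Sum>m\<in>{1..x div p}. half_wt (p * m) * real (multiplicity p (p * m)))"
    unfolding D_def using assms by (intro sum_multiples) (auto simp: prime_gt_0_nat not_dvd_imp_multiplicity_0)
  also have "\<dots> = (\<Sum>m\<in>{1..x div p}. half_wt m / 2 + (half_wt m * real (multiplicity p m)) / 2)"
  proof (intro sum.cong refl)
    fix m assume "m \<in> {1..x div p}"
    hence "m > 0" by simp
    hence "multiplicity p (p * m) = Suc (multiplicity p m)" "half_wt (p * m) = half_wt m / 2"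
      using assms half_wt_prime_mult[of p m] by (auto intro!: multiplicity_times_same simp: prime_gt_0_nat)
    thus "half_wt (p * m) * real (multiplicity p (p * m)) = half_wt m / 2 + (half_wt m * real (multiplicity p m)) / 2"
      by (simp add: field_simps)
  qed
  also have "\<dots> = half_sum (x div p) / 2 + D (x div p) / 2"
    by (simp add: sum.distrib half_sum_def D_def sum_divide_distrib)
  also have "D (x div p) \<le> D x"
    unfolding D_def by (intro sum_mono2) (auto intro: order_trans)
  finally show ?thesis by (simp add: D_def)
qed

lemma ln_eq_sum_multiplicity:
  assumes "n \<in> {1..N}"
  shows "ln (real n) = (\<Sum>p\<in>primes_upto N. real (multiplicity p n) * ln (real p))"
proof -
  have "real n = real (\<Prod>p\<in>prime_factors n. p ^ multiplicity p n)"
    using assms by (subst prod_prime_factors) auto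
  also have "ln \<dots> = (\<Sum>p\<in>prime_factors n. ln (real (p ^ multiplicity p n)))"
    unfolding of_nat_prod by (rule ln_prod) (auto simp: prime_factors_gt_0_nat)
  also have "\<dots> = (\<Sum>p\<in>prime_factors n. real (multiplicity p n) * ln (real p))"
    by (intro sum.cong) (auto simp: ln_realpow prime_factors_gt_0_nat)
  also have "\<dots> = (\<Sum>p\<in>primes_upto N. real (multiplicity p n) * ln (real p))"
    unfolding prime_factors_eq_filter[OF assms]
    by (intro sum.mono_neutral_left) (auto simp: not_dvd_imp_multiplicity_0)
  finally show ?thesis .
qed

text \<open>Split ln x = ln n + ln (x / n). The first part is a sum over primes, controlled by
  Chebyshev's bound after exchanging the sums; the second is at most \<open>x / n\<close>. Both
  reduce to the sum of \<open>half_wt n / n\<close>, of order at most \<open>sqrt (ln x)\<close>, so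
  \<open>half_sum x\<close> is of order at most \<open>x / sqrt (ln x)\<close>. The 3 bounds
  \<open>1 + ln 4\<close>.\<close>

lemma half_sum_mult_ln_le:
  assumes "x \<ge> 1"
  shows "half_sum x * ln (real x) \<le> 3 * real x * sqrt (1 + 2 * ln (real x))"
proof -
  have "(\<Sum>n\<in>{1..x}. half_wt n * ln (real n))
      = (\<Sum>n\<in>{1..x}. \<Sum>p\<in>primes_upto x. ln (real p) * (half_wt n * real (multiplicity p n)))"
    by (intro sum.cong) (auto simp: ln_eq_sum_multiplicity sum_distrib_left mult_ac)
  also have "\<dots> = (\<Sum>p\<in>primes_upto x. ln (real p) * (\<Sum>n\<in>{1..x}. half_wt n * real (multiplicity p n)))"
    by (subst sum.swap) (simp add: sum_distrib_left)
  also have "\<dots> \<le> (\<Sum>p\<in>primes_upto x. ln (real p) * half_sum (x div p))"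
    by (intro sum_mono mult_left_mono sum_half_wt_multiplicity_le) (auto simp: ln_prime_ge_0)
  also have "\<dots> = (\<Sum>p\<in>primes_upto x. \<Sum>m\<in>{m\<in>{1..x}. m * p \<le> x}. ln (real p) * half_wt m)"
  proof (rule sum.cong[OF refl])
    fix p assume p: "p \<in> primes_upto x"
    have "{1..x div p} = {m\<in>{1..x}. m * p \<le> x}"
    proof (intro set_eqI)
      fix m
      have "m \<le> x div p \<longleftrightarrow> m * p \<le> x"
        using p prime_gt_0_nat by (intro less_eq_div_iff_mult_less_eq) auto
      moreover have "m * p \<le> x \<Longrightarrow> m \<le> x"
        using p prime_gt_0_nat[of p] by (metis (no_types, lifting) Suc_leI mem_Collect_eq mult.right_neutral mult_le_mono2 One_nat_def order_trans)
      ultimately show "m \<in> {1..x div p} \<longleftrightarrow> m \<in> {m\<in>{1..x}. m * p \<le> x}" by auto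
    qed
    thus "ln (real p) * half_sum (x div p) = (\<Sum>m\<in>{m\<in>{1..x}. m * p \<le> x}. ln (real p) * half_wt m)"
      by (simp add: half_sum_def sum_distrib_left)
  qed
  also have "\<dots> = (\<Sum>m\<in>{1..x}. \<Sum>p\<in>{p\<in>primes_upto x. m * p \<le> x}. ln (real p) * half_wt m)"
    by (rule sum.swap_restrict) auto
  also have "\<dots> \<le> (\<Sum>m\<in>{1..x}. (real x * ln 4) * (half_wt m / real m))"
  proof (rule sum_mono)
    fix m assume m: "m \<in> {1..x}"
    have "(\<Sum>p\<in>{p\<in>primes_upto x. m * p \<le> x}. ln (real p)) \<le> (\<Sum>p\<in>primes_upto (x div m). ln (real p))"
      using m by (intro sum_mono2 finite_primes_upto) (auto simp: ln_prime_ge_0 less_eq_div_iff_mult_less_eq mult.commute)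
    also have "\<dots> \<le> real (x div m) * ln 4" by (rule theta_le)
    also have "\<dots> \<le> real x / real m * ln 4" by (intro mult_right_mono div_le_real) auto
    finally have "(\<Sum>p\<in>{p\<in>primes_upto x. m * p \<le> x}. ln (real p)) * half_wt m \<le> real x / real m * ln 4 * half_wt m"
      by (intro mult_right_mono) auto
    thus "(\<Sum>p\<in>{p\<in>primes_upto x. m * p \<le> x}. ln (real p) * half_wt m) \<le> (real x * ln 4) * (half_wt m / real m)"
      by (simp add: sum_distrib_right)
  qed
  also have "\<dots> = (real x * ln 4) * (\<Sum>m\<in>{1..x}. half_wt m / real m)"
    by (simp only: sum_distrib_left)
  finally have 1: "(\<Sum>n\<in>{1..x}. half_wt n * ln (real n)) \<le> (real x * ln 4) * (\<Sum>m\<in>{1..x}. half_wt m / real m)" .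
  have "(\<Sum>n\<in>{1..x}. half_wt n * (ln (real x) - ln (real n))) \<le> (\<Sum>n\<in>{1..x}. real x * (half_wt n / real n))"
  proof (rule sum_mono)
    fix n assume n: "n \<in> {1..x}"
    have "ln (real x / real n) \<le> real x / real n"
      using n ln_le_minus_one[of "real x / real n"] by auto
    hence "half_wt n * ln (real x / real n) \<le> half_wt n * (real x / real n)"
      by (intro mult_left_mono) auto
    thus "half_wt n * (ln (real x) - ln (real n)) \<le> real x * (half_wt n / real n)"
      using n by (simp add: ln_div mult.commute)
  qed
  also have "\<dots> = real x * (\<Sum>m\<in>{1..x}. half_wt m / real m)" by (simp only: sum_distrib_left)
  also have "(\<Sum>n\<in>{1..x}. half_wt n * (ln (real x) - ln (real n)))
      = half_sum x * ln (real x) - (\<Sum>n\<in>{1..x}. half_wt n * ln (real n))"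
    by (simp add: half_sum_def sum_distrib_right right_diff_distrib sum_subtractf)
  finally have "half_sum x * ln (real x) \<le> (real x * (1 + ln 4)) * (\<Sum>m\<in>{1..x}. half_wt m / real m)"
    using 1 by (simp add: algebra_simps)
  also have "\<dots> \<le> (real x * 3) * sqrt (1 + 2 * ln (real x))"
  proof (intro mult_mono mult_left_mono sum_half_wt_div_le assms)
    have "ln 4 = 2 * ln (2::real)" using ln_realpow[of 2 2] by simp
    thus "1 + ln 4 \<le> (3::real)" using ln_2_less_1 by simp
  qed (auto intro!: sum_nonneg)
  finally show ?thesis by (simp add: mult_ac)
qed

text \<open>The 8 keeps the logarithm positive at \<open>x = 1\<close> and prepares the use at
  \<open>x = N div m\<close>, where 4 N / m \<le> 8 x. For \<open>x < 8\<close> the trivial bound by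
  \<open>x\<close> suffices, as then ln (8 x) \<le> 9.\<close>

lemma half_sum_bound:
  assumes "x \<ge> 1"
  shows "half_sum x \<le> 9 * real x / sqrt (ln (8 * real x))"
proof (cases "x \<ge> 8")
  case True
  define L where "L = ln (real x)"
  have "exp (1::real) \<le> 3" using exp_le by simp
  hence "ln (exp 1) \<le> ln (real x)" using True by (subst ln_le_cancel_iff) auto
  hence L: "L \<ge> 1" by (simp add: L_def)
  have "ln 8 \<le> L" unfolding L_def using True by simp
  hence L8: "ln (8 * real x) \<le> 2 * L" using True by (simp add: ln_mult L_def)
  have L8': "0 < ln (8 * real x)" using True by simp
  have "half_sum x * sqrt (ln (8 * real x)) * L = (half_sum x * L) * sqrt (ln (8 * real x))" by simp
  also have "\<dots> \<le> (3 * real x * sqrt (1 + 2 * L)) * sqrt (ln (8 * real x))"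
    using half_sum_mult_ln_le[OF assms] L8' by (intro mult_right_mono) (auto simp: L_def)
  also have "\<dots> = 3 * real x * sqrt ((1 + 2 * L) * ln (8 * real x))" by (simp add: real_sqrt_mult)
  also have "\<dots> \<le> 3 * real x * sqrt ((3 * L) * (3 * L))"
    using L L8 L8' by (intro mult_left_mono real_sqrt_le_mono mult_mono) auto
  also have "\<dots> = 9 * real x * L" using L by (simp only: real_sqrt_abs2)
  finally have "half_sum x * sqrt (ln (8 * real x)) \<le> 9 * real x" using L by simp
  thus ?thesis using L8' by (simp add: field_simps)
next
  case False
  have "ln (8 * real x) \<le> ln (2 ^ 6)" using False assms by (subst ln_le_cancel_iff) auto
  also have "\<dots> = 6 * ln 2" by (subst ln_realpow) auto
  also have "\<dots> \<le> 6" using ln_2_less_1 by simp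
  finally have "ln (8 * real x) \<le> 3\<^sup>2" by simp
  hence "sqrt (ln (8 * real x)) \<le> 3" by (rule real_le_lsqrt[rotated]) simp
  moreover have pos: "ln (8 * real x) > 0" using assms by simp
  ultimately have "real x * sqrt (ln (8 * real x)) \<le> real x * 9" by (intro mult_left_mono) auto
  hence "real x \<le> 9 * real x / sqrt (ln (8 * real x))" using pos by (simp add: field_simps)
  thus ?thesis using half_sum_le[of x] by simp
qed

text \<open>Abel summation: domination of partial sums survives a nonnegative non-increasing weight.
  It is needed because \<open>half_wt\<close> is small only on average, and it allows
  \<open>half_wt k\<close> to be replaced by the mean density
  \<open>9 / sqrt (ln (8 * k))\<close>.\<close>

lemma sum_mult_decreasing_le:
  fixes f g u :: "nat \<Rightarrow> real"
  assumes le: "\<And>m. 1 \<le> m \<Longrightarrow> m \<le> n \<Longrightarrow> (\<Sum>k\<in>{1..m}. f k) \<le> (\<Sum>k\<in>{1..m}. g k)"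
    and dec: "\<And>m. 1 \<le> m \<Longrightarrow> m < n \<Longrightarrow> u (Suc m) \<le> u m"
    and nonneg: "u n \<ge> 0" and "n \<ge> 1"
  shows "(\<Sum>k\<in>{1..n}. f k * u k) \<le> (\<Sum>k\<in>{1..n}. g k * u k)"
proof -
  define D where "D m = (\<Sum>k\<in>{1..m}. g k) - (\<Sum>k\<in>{1..m}. f k)" for m
  have "D m * u m \<le> (\<Sum>k\<in>{1..m}. (g k - f k) * u k)" if "1 \<le> m" "m \<le> n" for m
    using that
  proof (induction m rule: dec_induct)
    case (step m)
    have "D (Suc m) * u (Suc m) = D m * u (Suc m) + (g (Suc m) - f (Suc m)) * u (Suc m)"
      by (simp add: D_def algebra_simps)
    also have "D m * u (Suc m) \<le> D m * u m"
      using step le[of m] dec[of m] by (intro mult_left_mono) (auto simp: D_def)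
    also have "D m * u m \<le> (\<Sum>k\<in>{1..m}. (g k - f k) * u k)" using step by simp
    finally show ?case by simp
  qed (simp add: D_def)
  from this[of n] have "D n * u n \<le> (\<Sum>k\<in>{1..n}. (g k - f k) * u k)" using assms by simp
  moreover have "D n * u n \<ge> 0" using le[of n] nonneg assms by (intro mult_nonneg_nonneg) (auto simp: D_def)
  ultimately show ?thesis by (simp add: left_diff_distrib sum_subtractf)
qed

section \<open>Sums with logarithmic denominators\<close>

lemma ln_Suc_diff_ge: "n > 0 \<Longrightarrow> ln (real (Suc n)) - ln (real n) \<ge> 1 / real (Suc n)"
  using one_minus_ln_ratio_le[of "real n" "real (Suc n)"] by (simp add: field_simps)

lemma ln_8_ge_1: "ln (8::real) \<ge> 1" and ln_4_ge_1: "ln (4::real) \<ge> 1"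
proof -
  have "exp (1::real) \<le> 3" by (rule exp_le)
  thus "ln (4::real) \<ge> 1" by (subst ln_ge_iff) auto
  thus "ln (8::real) \<ge> 1" by (smt (verit) ln_le_cancel_iff)
qed

lemma sum_inverse_ln_le:
  assumes "N \<ge> 1"
  shows "(\<Sum>m\<in>{1..N}. 1 / (real m * ln (8 * real m))) \<le> 1 + ln (ln (8 * real N))"
  using assms
proof (induction N rule: dec_induct)
  case base
  have "1 / ln 8 \<le> (1::real)" using ln_8_ge_1 by (simp add: field_simps)
  moreover have "ln (ln 8) \<ge> (0::real)" using ln_8_ge_1 by simp
  ultimately have "1 / ln 8 \<le> 1 + ln (ln (8::real))" by linarith
  thus ?case by simp
next
  case (step n)
  define a b where "a = ln (8 * real n)" and "b = ln (8 * real (Suc n))"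
  have ab: "a > 0" "b > 0" using step by (auto simp: a_def b_def)
  have "1 / (real (Suc n) * b) = (1 / real (Suc n)) / b" by simp
  also have "b - a = ln (real (Suc n)) - ln (real n)"
    using step by (simp add: a_def b_def ln_mult del: of_nat_Suc)
  hence "1 / real (Suc n) \<le> b - a"
    using ln_Suc_diff_ge[of n] step by simp
  hence "(1 / real (Suc n)) / b \<le> (b - a) / b" using ab by (intro divide_right_mono) auto
  also have "\<dots> = 1 - a / b" using ab by (simp add: field_simps)
  also have "\<dots> \<le> ln b - ln a" using ab by (intro one_minus_ln_ratio_le)
  finally show ?case using step.IH by (simp add: a_def b_def)
qed

text \<open>Discrete form of an integral with antiderivative \<open>- ln (ln (4 * N / x))\<close>.
  The decrements of \<open>v\<close> are bounded below by \<open>1 / (m + 1)\<close> instead of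
  \<open>1 / m\<close>, whence the factor 2; the summand 2 bounds
  \<open>- 2 * ln (v (Suc N))\<close>.\<close>

lemma sum_inverse_ln_quot_le:
  assumes "N \<ge> 1"
  shows "(\<Sum>m\<in>{1..N}. 1 / (real m * ln (4 * real N / real m))) \<le> 2 * ln (ln (4 * real N)) + 2"
proof -
  define v where "v m = ln (4 * real N / real m)" for m
  have v: "v m > 0" if "1 \<le> m" "m \<le> Suc N" for m
    using that assms by (simp add: v_def field_simps)
  have "(\<Sum>m\<in>{1..n}. 1 / (real m * v m)) \<le> 2 * (ln (v 1) - ln (v (Suc n)))" if "n \<le> N" for n
    using that
  proof (induction n)
    case (Suc n)
    define m where "m = Suc n"
    have m: "m > 0" "m \<le> N" using Suc by (auto simp: m_def)
    have vm: "v m > 0" "v (Suc m) > 0" using m by (auto intro!: v)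
    have "1 / real m \<le> 2 * (1 / real (Suc m))" using m by (simp add: field_simps)
    hence "1 / real m / v m \<le> 2 * (1 / real (Suc m)) / v m"
      using vm by (intro divide_right_mono) auto
    hence "1 / (real m * v m) \<le> 2 * ((1 / real (Suc m)) / v m)" by simp
    also have "1 / real (Suc m) \<le> v m - v (Suc m)"
      using ln_Suc_diff_ge[of m] m assms by (simp add: v_def ln_div)
    hence "2 * ((1 / real (Suc m)) / v m) \<le> 2 * ((v m - v (Suc m)) / v m)"
      using vm by (intro mult_left_mono divide_right_mono) auto
    also have "(v m - v (Suc m)) / v m = 1 - v (Suc m) / v m" using vm by (simp add: field_simps)
    also have "\<dots> \<le> ln (v m) - ln (v (Suc m))" using vm by (intro one_minus_ln_ratio_le)
    finally show ?case using Suc by (simp add: m_def)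
  qed auto
  from this[of N] have "(\<Sum>m\<in>{1..N}. 1 / (real m * v m)) \<le> 2 * (ln (v 1) - ln (v (Suc N)))" by simp
  also have "ln (v (Suc N)) \<ge> -1"
  proof -
    have "2 \<le> 4 * real N / real (Suc N)" using assms by (simp add: field_simps)
    hence "ln 2 \<le> v (Suc N)" unfolding v_def using assms by (subst ln_le_cancel_iff) auto
    hence "1 / 2 \<le> v (Suc N)" using ln2_ge_two_thirds by simp
    hence "ln (1 / 2) \<le> ln (v (Suc N))" by (subst ln_le_cancel_iff) auto
    moreover have "-1 \<le> ln (1 / 2 :: real)" using one_minus_ln_ratio_le[of 1 "1/2"] by simp
    ultimately show ?thesis by linarith
  qed
  hence "2 * (ln (v 1) - ln (v (Suc N))) \<le> 2 * ln (v 1) + 2" by simp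
  finally show ?thesis by (simp add: v_def)
qed

text \<open>The bounds for \<open>half_sum\<close> leave a sum of \<open>half_wt m\<close> over m
  sqrt(U) V with \<open>U = ln (8 * m)\<close> and \<open>V = ln (4 * N / m)\<close>. Replacing
  \<open>half_wt\<close> by its mean density turns sqrt(U) into U. Since
  \<open>U + V = ln (32 * N)\<close>, the identity 1/(U V) = (1/U + 1/V) / (U + V) extracts the
  saving of a full logarithm and leaves two sums of size ln ln N. The constant is 9^3 from three
  values of \<open>half_sum\<close>, times 9 from the density, times 3 from the final sums.\<close>

lemma sum_half_wt_half_sum_le:
  assumes "N \<ge> 1"
  shows "(\<Sum>m\<in>{1..N}. half_wt m * half_sum m * (half_sum (N div m))\<^sup>2)
     \<le> 19683 * (real N)\<^sup>2 * (1 + ln (ln (8 * real N))) / ln (32 * real N)"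
proof -
  define u where "u m = 1 / (real m * sqrt (ln (8 * real m)) * ln (4 * real N / real m))" for m
  have lnN: "ln (4 * real N / real m) \<ge> 1" if "1 \<le> m" "m \<le> N" for m
  proof -
    have "ln 4 \<le> ln (4 * real N / real m)" using that by (subst ln_le_cancel_iff) (auto simp: field_simps)
    thus ?thesis using ln_4_ge_1 by linarith
  qed
  have ln8: "ln (8 * real m) > 0" if "1 \<le> m" for m using that by simp
  have "(\<Sum>m\<in>{1..N}. half_wt m * half_sum m * (half_sum (N div m))\<^sup>2)
      \<le> (\<Sum>m\<in>{1..N}. 729 * (real N)\<^sup>2 * (half_wt m * u m))"
  proof (rule sum_mono)
    fix m assume m: "m \<in> {1..N}"
    define y where "y = N div m"
    have y: "y \<ge> 1" using m by (simp add: y_def Suc_le_eq div_greater_zero_iff)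
    have "real N / real m \<le> real y + 1" using div_ge_real[of N m] by (simp add: y_def)
    also have "\<dots> \<le> 2 * real y" using y by simp
    finally have "4 * real N / real m \<le> 8 * real y" by simp
    hence "ln (4 * real N / real m) \<le> ln (8 * real y)" using m y by (subst ln_le_cancel_iff) auto
    moreover have pos: "ln (4 * real N / real m) > 0" using lnN[of m] m by simp
    ultimately have "half_sum y \<le> 9 * (real N / real m) / sqrt (ln (4 * real N / real m))"
      using div_le_real[of N m] half_sum_bound[OF y]
      by (intro order_trans[OF half_sum_bound[OF y]] frac_le) (auto simp: y_def)
    hence "(half_sum y)\<^sup>2 \<le> (9 * (real N / real m) / sqrt (ln (4 * real N / real m)))\<^sup>2"
      by (intro power_mono) auto
    also have "\<dots> = 81 * (real N)\<^sup>2 / (real m)\<^sup>2 / ln (4 * real N / real m)"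
      using pos by (simp add: power_divide power_mult_distrib)
    finally have "half_sum m * (half_sum y)\<^sup>2 \<le>
        (9 * real m / sqrt (ln (8 * real m))) * (81 * (real N)\<^sup>2 / (real m)\<^sup>2 / ln (4 * real N / real m))"
      using m half_sum_bound[of m] pos ln8[of m] by (intro mult_mono) auto
    also have "\<dots> = 729 * (real N)\<^sup>2 * u m" using m by (simp add: u_def power2_eq_square)
    finally have "half_wt m * (half_sum m * (half_sum y)\<^sup>2) \<le> half_wt m * (729 * (real N)\<^sup>2 * u m)"
      by (intro mult_left_mono) auto
    thus "half_wt m * half_sum m * (half_sum (N div m))\<^sup>2 \<le> 729 * (real N)\<^sup>2 * (half_wt m * u m)"
      by (simp add: y_def mult_ac)
  qed
  also have "\<dots> = 729 * (real N)\<^sup>2 * (\<Sum>m\<in>{1..N}. half_wt m * u m)" by (simp only: sum_distrib_left)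
  finally have 1: "(\<Sum>m\<in>{1..N}. half_wt m * half_sum m * (half_sum (N div m))\<^sup>2)
      \<le> 729 * (real N)\<^sup>2 * (\<Sum>m\<in>{1..N}. half_wt m * u m)" .
  have "(\<Sum>m\<in>{1..N}. half_wt m * u m) \<le> (\<Sum>m\<in>{1..N}. 9 / sqrt (ln (8 * real m)) * u m)"
  proof (rule sum_mult_decreasing_le)
    fix m assume m: "1 \<le> m" "m \<le> N"
    have "(\<Sum>k\<in>{1..m}. half_wt k) = half_sum m" by (simp add: half_sum_def)
    also have "\<dots> \<le> real m * (9 / sqrt (ln (8 * real m)))" using half_sum_bound[OF m(1)] by (simp add: mult.commute)
    also have "\<dots> = (\<Sum>k\<in>{1..m}. 9 / sqrt (ln (8 * real m)))" by simp
    also have "\<dots> \<le> (\<Sum>k\<in>{1..m}. 9 / sqrt (ln (8 * real k)))"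
      using ln8 m by (intro sum_mono divide_left_mono mult_pos_pos) auto
    finally show "(\<Sum>k\<in>{1..m}. half_wt k) \<le> (\<Sum>k\<in>{1..m}. 9 / sqrt (ln (8 * real k)))" .
  next
    fix m assume m: "1 \<le> m" "m < N"
    \<comment> \<open>Monotonicity of \<open>u\<close> rests on \<open>m * ln (4 * N / m)\<close>,
      which increases as long as the logarithm stays at least 1; the factor 4 guarantees this up to
      \<open>m = N\<close>.\<close>
    define A where "A = ln (4 * real N / real m)"
    define B where "B = ln (4 * real N / real (Suc m))"
    have AB: "A > 0" "B \<ge> 1" using lnN[of m] lnN[of "Suc m"] m by (auto simp: A_def B_def)
    have "A - B \<le> 1 / real m"
      using m ln_le_minus_one[of "real (Suc m) / real m"] by (simp add: A_def B_def ln_div field_simps)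
    hence "real m * A \<le> real m * B + 1" using m by (simp add: field_simps)
    also have "\<dots> \<le> real (Suc m) * B" using AB by (simp add: algebra_simps)
    finally have 1: "real m * A \<le> real (Suc m) * B" .
    have 2: "sqrt (ln (8 * real m)) \<le> sqrt (ln (8 * real (Suc m)))" using m by simp
    have "sqrt (ln (8 * real m)) * (real m * A) \<le> sqrt (ln (8 * real (Suc m))) * (real (Suc m) * B)"
      using 1 2 AB ln8[of "Suc m"] m by (intro mult_mono[OF 2 1]) auto
    thus "u (Suc m) \<le> u m"
      unfolding u_def A_def[symmetric] B_def[symmetric]
      using AB m ln8[of m] by (intro divide_left_mono) (auto simp: mult_ac)
  next
    show "u N \<ge> 0" using lnN[of N] ln8[of N] assms by (simp add: u_def)
  qed (use assms in auto)
  also have "(\<Sum>m\<in>{1..N}. 9 / sqrt (ln (8 * real m)) * u m)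
      = 9 / ln (32 * real N) * (\<Sum>m\<in>{1..N}. 1 / (real m * ln (8 * real m)) + 1 / (real m * ln (4 * real N / real m)))"
    unfolding sum_distrib_left
  proof (rule sum.cong[OF refl])
    fix m assume m: "m \<in> {1..N}"
    define U V where "U = ln (8 * real m)" and "V = ln (4 * real N / real m)"
    have UV: "U > 0" "V > 0" using lnN[of m] ln8[of m] m by (auto simp: U_def V_def)
    have "ln (32 * real N) = ln ((8 * real m) * (4 * real N / real m))" using m by simp
    also have "\<dots> = U + V" unfolding U_def V_def using m by (intro ln_mult_pos) auto
    finally have s: "ln (32 * real N) = U + V" .
    have "9 / sqrt U * (1 / (real m * sqrt U * V)) = 9 / (real m * U * V)" using UV by (simp add: field_simps)
    also have "\<dots> = 9 / (U + V) * (1 / (real m * U) + 1 / (real m * V))"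
      using UV m by (simp add: divide_simps add_pos_pos)
    finally show "9 / sqrt (ln (8 * real m)) * u m
      = 9 / ln (32 * real N) * (1 / (real m * ln (8 * real m)) + 1 / (real m * ln (4 * real N / real m)))"
      unfolding u_def s U_def[symmetric] V_def[symmetric] .
  qed
  also have "\<dots> = 9 / ln (32 * real N) * ((\<Sum>m\<in>{1..N}. 1 / (real m * ln (8 * real m))) + (\<Sum>m\<in>{1..N}. 1 / (real m * ln (4 * real N / real m))))"
    by (simp only: sum.distrib)
  also have "\<dots> \<le> 9 / ln (32 * real N) * (3 * (1 + ln (ln (8 * real N))))"
  proof (intro mult_left_mono)
    have "ln 4 \<le> ln (4 * real N)" using assms by simp
    hence "0 < ln (4 * real N)" using ln_4_ge_1 by linarith
    moreover have "ln (4 * real N) \<le> ln (8 * real N)" using assms by simp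
    ultimately have "ln (ln (4 * real N)) \<le> ln (ln (8 * real N))" by (subst ln_le_cancel_iff) auto
    moreover have "s \<le> 1 + b \<Longrightarrow> t \<le> 2 * c + 2 \<Longrightarrow> c \<le> b \<Longrightarrow> s + t \<le> 3 * (1 + b)" for s t b c :: real
      by argo
    ultimately show "(\<Sum>m\<in>{1..N}. 1 / (real m * ln (8 * real m))) + (\<Sum>m\<in>{1..N}. 1 / (real m * ln (4 * real N / real m)))
        \<le> 3 * (1 + ln (ln (8 * real N)))"
      using sum_inverse_ln_le[OF assms] sum_inverse_ln_quot_le[OF assms] by blast
    show "9 / ln (32 * real N) \<ge> 0" using assms by simp
  qed
  finally have "729 * (real N)\<^sup>2 * (\<Sum>m\<in>{1..N}. half_wt m * u m)
      \<le> 729 * (real N)\<^sup>2 * (9 / ln (32 * real N) * (3 * (1 + ln (ln (8 * real N)))))"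
    by (intro mult_left_mono) auto
  with 1 show ?thesis by (simp add: field_simps)
qed

section \<open>Multiplicative quadruples\<close>

text \<open>The summand is symmetric in \<open>g\<close> and \<open>j\<close>, so the sum splits
  according to which of them is the maximum; the diagonal is counted twice.\<close>

lemma sum_sum_max_le:
  fixes w u :: "nat \<Rightarrow> real"
  assumes w: "\<And>m. w m \<ge> 0" and u: "\<And>m. u m \<ge> 0"
  shows "(\<Sum>g\<in>{1..N}. \<Sum>j\<in>{1..N}. w g * w j * u (max g j)) \<le> 2 * (\<Sum>m\<in>{1..N}. w m * (\<Sum>k\<in>{1..m}. w k) * u m)"
proof -
  have *: "(\<Sum>j\<in>{1..N}. if j \<le> g then w g * w j * u g else 0) = w g * (\<Sum>k\<in>{1..g}. w k) * u g"
    if "g \<in> {1..N}" for g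
  proof -
    have "(\<Sum>j\<in>{1..N}. if j \<le> g then w g * w j * u g else 0) = (\<Sum>j\<in>{j\<in>{1..N}. j \<le> g}. w g * w j * u g)"
      by (rule sum.inter_filter[symmetric]) simp
    also have "{j\<in>{1..N}. j \<le> g} = {1..g}" using that by auto
    finally show ?thesis by (simp add: sum_distrib_left sum_distrib_right)
  qed
  have "(\<Sum>g\<in>{1..N}. \<Sum>j\<in>{1..N}. w g * w j * u (max g j))
     \<le> (\<Sum>g\<in>{1..N}. \<Sum>j\<in>{1..N}. (if j \<le> g then w g * w j * u g else 0) + (if g \<le> j then w j * w g * u j else 0))"
    using w u by (intro sum_mono) (auto simp: max_def)
  also have "\<dots> = (\<Sum>g\<in>{1..N}. \<Sum>j\<in>{1..N}. if j \<le> g then w g * w j * u g else 0)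
      + (\<Sum>g\<in>{1..N}. \<Sum>j\<in>{1..N}. if g \<le> j then w j * w g * u j else 0)"
    by (simp add: sum.distrib)
  also have "(\<Sum>g\<in>{1..N}. \<Sum>j\<in>{1..N}. if g \<le> j then w j * w g * u j else 0)
     = (\<Sum>j\<in>{1..N}. \<Sum>g\<in>{1..N}. if g \<le> j then w j * w g * u j else 0)"
    by (rule sum.swap)
  also have "(\<Sum>g\<in>{1..N}. \<Sum>j\<in>{1..N}. if j \<le> g then w g * w j * u g else 0) = (\<Sum>m\<in>{1..N}. w m * (\<Sum>k\<in>{1..m}. w k) * u m)"
    by (intro sum.cong refl *)
  finally show ?thesis by simp
qed

definition mult_quads :: "nat \<Rightarrow> (nat \<times> nat \<times> nat \<times> nat) set" where
  "mult_quads N = {(a, b, c, d). a \<in> {1..N} \<and> b \<in> {1..N} \<and> c \<in> {1..N} \<and> d \<in> {1..N} \<and> a * b = c * d}"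

lemma finite_mult_quads [simp]: "finite (mult_quads N)"
  by (rule finite_subset[of _ "{1..N} \<times> {1..N} \<times> {1..N} \<times> {1..N}"]) (auto simp: mult_quads_def)

text \<open>Take \<open>g\<close> as the gcd of \<open>a\<close> and \<open>c\<close>. The cofactors
  \<open>h\<close> and \<open>i\<close> are coprime, so \<open>h * b = i * d\<close> forces
  \<open>i\<close> to divide \<open>b\<close>.\<close>

lemma mult_quadE:
  fixes a b c d :: nat
  assumes "a * b = c * d" "a > 0" "c > 0"
  obtains g h i j where "a = g * h" "b = i * j" "c = g * i" "d = h * j"
proof -
  define g where "g = gcd a c"
  have g: "g > 0" using assms by (simp add: g_def)
  define h where "h = a div g"
  define i where "i = c div g"
  have h: "a = g * h" and i: "c = g * i" by (simp_all add: h_def i_def g_def)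
  have cop: "coprime h i" using assms by (simp add: h_def i_def g_def div_gcd_coprime)
  have e: "h * b = i * d" using assms(1) g unfolding h i by (simp add: mult.assoc)
  hence "i dvd h * b" by simp
  hence "i dvd b" using cop by (simp add: coprime_dvd_mult_right_iff coprime_commute)
  then obtain j where j: "b = i * j" by blast
  have "i > 0" using i assms by auto
  hence "d = h * j" using e unfolding j by (simp add: mult.left_commute)
  thus ?thesis using that h i j by blast
qed

text \<open>In the factorisation of \<open>mult_quadE\<close>, the bounds on the four products
  confine \<open>h\<close> and \<open>i\<close> to \<open>N div max g j\<close>, and
  \<open>half_wt a * half_wt b\<close> is the product of the four weights. Coprimality of
  \<open>h\<close> and \<open>i\<close> is given up, so a quadruple may be counted several
  times.\<close>

lemma sum_mult_quads_le:
  "(\<Sum>(a, b, c, d)\<in>mult_quads N. half_wt a * half_wt b)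
     \<le> (\<Sum>g\<in>{1..N}. \<Sum>j\<in>{1..N}. half_wt g * half_wt j * (half_sum (N div max g j))\<^sup>2)"
proof -
  define K where "K = (SIGMA g:{1..N}. SIGMA j:{1..N}. {1..N div max g j} \<times> {1..N div max g j})"
  define f where "f = (\<lambda>(g, j, h, i). (g * h, i * j, g * i, h * j) :: nat \<times> nat \<times> nat \<times> nat)"
  define q :: "nat \<times> nat \<times> nat \<times> nat \<Rightarrow> real" where "q = (\<lambda>(a, b, c, d). half_wt a * half_wt b)"
  have finK: "finite K" by (auto simp: K_def)
  have sub: "mult_quads N \<subseteq> f ` K"
  proof
    fix z assume "z \<in> mult_quads N"
    then obtain a b c d where z: "z = (a, b, c, d)" "a \<in> {1..N}" "b \<in> {1..N}" "c \<in> {1..N}" "d \<in> {1..N}" "a * b = c * d"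
      by (auto simp: mult_quads_def)
    have "a > 0" "c > 0" using z by auto
    then obtain g h i j where *: "a = g * h" "b = i * j" "c = g * i" "d = h * j"
      by (rule mult_quadE[OF z(6)])
    have pos: "g > 0" "h > 0" "i > 0" "j > 0" using * z by (auto intro: Nat.gr0I)
    have le: "g * h \<le> N" "i * j \<le> N" "g * i \<le> N" "h * j \<le> N" using * z by auto
    have "g \<le> N" "j \<le> N" using le pos
      by (metis le_trans mult.commute mult.right_neutral mult_le_mono2 Suc_leI One_nat_def)+
    moreover have "h \<le> N div max g j" "i \<le> N div max g j"
      using le pos by (simp_all add: less_eq_div_iff_mult_less_eq max_def mult.commute)
    ultimately have "(g, j, h, i) \<in> K" using pos by (auto simp: K_def)
    moreover have "z = f (g, j, h, i)" using z * by (simp add: f_def)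
    ultimately show "z \<in> f ` K" by blast
  qed
  have "(\<Sum>z\<in>mult_quads N. q z) \<le> (\<Sum>z\<in>f ` K. q z)"
    using sub finK by (intro sum_mono2) (auto simp: q_def)
  also have "\<dots> \<le> (\<Sum>z\<in>K. (q \<circ> f) z)"
    using finK by (intro sum_image_le) (auto simp: q_def split: prod.split)
  also have "\<dots> = (\<Sum>(g, j, h, i)\<in>K. half_wt g * half_wt j * (half_wt h * half_wt i))"
    by (intro sum.cong) (auto simp: K_def q_def f_def half_wt_mult)
  also have "\<dots> = (\<Sum>g\<in>{1..N}. \<Sum>j\<in>{1..N}. \<Sum>h\<in>{1..N div max g j}. \<Sum>i\<in>{1..N div max g j}.
      half_wt g * half_wt j * (half_wt h * half_wt i))"
    unfolding K_def by (simp add: sum.Sigma[symmetric])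
  also have "\<dots> = (\<Sum>g\<in>{1..N}. \<Sum>j\<in>{1..N}. half_wt g * half_wt j * (half_sum (N div max g j))\<^sup>2)"
  proof -
    have "(half_sum y)\<^sup>2 = (\<Sum>h\<in>{1..y}. \<Sum>i\<in>{1..y}. half_wt h * half_wt i)" for y
      by (simp only: half_sum_def power2_eq_square sum_product)
    thus ?thesis by (simp only: sum_distrib_left)
  qed
  finally show ?thesis unfolding q_def .
qed

text \<open>Rankin's trick: on the counted quadruples, \<open>2 powr T * half_wt (a * b)\<close> is
  at least 1.\<close>

lemma card_mult_quads_le:
  assumes "N \<ge> 1"
  shows "real (card {(a, b, c, d) \<in> mult_quads N. real (bigomega (a * b)) \<le> T})
     \<le> 2 powr T * (39366 * (real N)\<^sup>2 * (1 + ln (ln (8 * real N))) / ln (32 * real N))"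
proof -
  define Q where "Q = {(a, b, c, d) \<in> mult_quads N. real (bigomega (a * b)) \<le> T}"
  have Q: "Q \<subseteq> mult_quads N" by (auto simp: Q_def)
  have "2 powr (-T) * real (card Q) = (\<Sum>z\<in>Q. 2 powr (-T))" by simp
  also have "\<dots> \<le> (\<Sum>(a, b, c, d)\<in>Q. half_wt a * half_wt b)"
  proof (rule sum_mono)
    fix z assume z: "z \<in> Q"
    then obtain a b c d where abcd: "z = (a, b, c, d)" "a > 0" "b > 0" "real (bigomega (a * b)) \<le> T"
      by (auto simp: Q_def mult_quads_def)
    have "2 powr (-T) \<le> 2 powr (- real (bigomega (a * b)))" using abcd by simp
    also have "\<dots> = half_wt (a * b)"
      by (simp add: half_wt_def powr_minus powr_realpow power_one_over inverse_eq_divide)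
    finally show "2 powr (-T) \<le> (case z of (a, b, c, d) \<Rightarrow> half_wt a * half_wt b)"
      using abcd by (simp add: half_wt_mult)
  qed
  also have "\<dots> \<le> (\<Sum>(a, b, c, d)\<in>mult_quads N. half_wt a * half_wt b)"
    using Q by (intro sum_mono2) auto
  also have "\<dots> \<le> (\<Sum>g\<in>{1..N}. \<Sum>j\<in>{1..N}. half_wt g * half_wt j * (half_sum (N div max g j))\<^sup>2)"
    by (rule sum_mult_quads_le)
  also have "\<dots> \<le> 2 * (\<Sum>m\<in>{1..N}. half_wt m * (\<Sum>k\<in>{1..m}. half_wt k) * (half_sum (N div m))\<^sup>2)"
    by (rule sum_sum_max_le) auto
  also have "\<dots> \<le> 2 * (19683 * (real N)\<^sup>2 * (1 + ln (ln (8 * real N))) / ln (32 * real N))"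
    using sum_half_wt_half_sum_le[OF assms] unfolding half_sum_def[of "_ :: nat"] by (intro mult_left_mono) auto
  also have "\<dots> = 39366 * (real N)\<^sup>2 * (1 + ln (ln (8 * real N))) / ln (32 * real N)" by simp
  finally have "2 powr T * (2 powr (-T) * real (card Q)) \<le>
      2 powr T * (39366 * (real N)\<^sup>2 * (1 + ln (ln (8 * real N))) / ln (32 * real N))"
    by (intro mult_left_mono) auto
  moreover have "2 powr T * (2 powr (-T) * real (card Q)) = real (card Q)"
    by (simp add: powr_minus)
  ultimately show ?thesis unfolding Q_def[symmetric] by (simp only:)
qed

section \<open>Combinatorics of the product set\<close>

text \<open>Choose one representative in each fibre; every other element is recorded by its
  colliding pair with the representative.\<close>

lemma card_le_card_image_plus_collisions:
  assumes "finite X"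
  shows "card X \<le> card (f ` X) + card {(x, y) \<in> X \<times> X. x \<noteq> y \<and> f x = f y}"
proof -
  define r where "r = inv_into X f"
  define Y where "Y = {x\<in>X. r (f x) \<noteq> x}"
  have r: "r (f x) \<in> X" "f (r (f x)) = f x" if "x \<in> X" for x
    using that by (auto simp: r_def inv_into_into f_inv_into_f)
  have "X \<subseteq> r ` f ` X \<union> Y" 
  proof
    fix x assume "x \<in> X"
    thus "x \<in> r ` f ` X \<union> Y" by (cases "r (f x) = x") (auto simp: Y_def intro: rev_image_eqI)
  qed
  hence "card X \<le> card (r ` f ` X \<union> Y)" using assms by (intro card_mono) (auto simp: Y_def)
  also have "\<dots> \<le> card (r ` f ` X) + card Y" by (rule card_Un_le)
  also have "card (r ` f ` X) \<le> card (f ` X)" using assms by (intro card_image_le) auto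
  also have "card Y \<le> card {(x, y) \<in> X \<times> X. x \<noteq> y \<and> f x = f y}"
  proof (rule card_inj_on_le[of "\<lambda>x. (x, r (f x))"])
    show "finite {(x, y) \<in> X \<times> X. x \<noteq> y \<and> f x = f y}"
      by (rule finite_subset[of _ "X \<times> X"]) (use assms in auto)
  qed (use r in \<open>auto simp: Y_def inj_on_def\<close>)
  finally show ?thesis by simp
qed

lemma card_less_pairs:
  fixes A :: "nat set"
  assumes "finite A"
  shows "2 * real (card {(a, b) \<in> A \<times> A. a < b}) = (real (card A))\<^sup>2 - real (card A)"
proof -
  define L where "L = {(a, b) \<in> A \<times> A. a < b}"
  define D where "D = (\<lambda>a. (a, a)) ` A"
  have fin: "finite L" by (rule finite_subset[of _ "A \<times> A"]) (use assms in \<open>auto simp: L_def\<close>)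
  have "A \<times> A = L \<union> prod.swap ` L \<union> D"
    by (auto simp: L_def D_def image_iff)
  hence "card (A \<times> A) = card (L \<union> prod.swap ` L \<union> D)" by simp
  also have "\<dots> = card (L \<union> prod.swap ` L) + card D"
    using fin assms by (intro card_Un_disjoint) (auto simp: L_def D_def)
  also have "card (L \<union> prod.swap ` L) = card L + card (prod.swap ` L)"
    using fin by (intro card_Un_disjoint) (auto simp: L_def)
  also have "card (prod.swap ` L) = card L" by (intro card_image) (auto simp: inj_on_def)
  also have "card D = card A" unfolding D_def by (intro card_image) (auto simp: inj_on_def)
  finally have "card A * card A = card L + card L + card A" by (simp add: card_cartesian_product)
  hence "real (card A) * real (card A) = 2 * real (card L) + real (card A)"
    by (simp flip: of_nat_mult)
  thus ?thesis by (simp add: L_def power2_eq_square)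
qed

text \<open>With pairs ordered by \<open>a < b\<close>, two different pairs with equal product
  automatically have four distinct entries. Hence a collision survives in the random set with
  probability \<alpha>^4, and a discarded pair with probability \<alpha>^2. \<open>G\<close> marks
  the products that are kept.\<close>

lemma card_product_set_ge:
  fixes A :: "nat set"
  assumes A: "A \<subseteq> {1..N}"
  shows "(real (card A))\<^sup>2 / 2 \<le> real (card (A * A)) + real (card A) / 2
     + real (card {(a, b) \<in> A \<times> A. a \<noteq> b \<and> \<not> G (a * b)})
     + real (card {(a, b, c, d) \<in> A \<times> A \<times> A \<times> A. distinct [a, b, c, d] \<and> a * b = c * d \<and> G (a * b)})"
proof -
  have fin: "finite A" using A finite_subset by blast
  define L where "L = {(a, b) \<in> A \<times> A. a < b}"
  define X where "X = {(a, b) \<in> A \<times> A. a < b \<and> G (a * b)}"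
  define B where "B = {(a, b) \<in> A \<times> A. a \<noteq> b \<and> \<not> G (a * b)}"
  define C where "C = {(a, b, c, d) \<in> A \<times> A \<times> A \<times> A. distinct [a, b, c, d] \<and> a * b = c * d \<and> G (a * b)}"
  define f where "f = (\<lambda>(a, b). a * b :: nat)"
  have finX: "finite X" by (rule finite_subset[of _ "A \<times> A"]) (use fin in \<open>auto simp: X_def\<close>)
  have finB: "finite B" by (rule finite_subset[of _ "A \<times> A"]) (use fin in \<open>auto simp: B_def\<close>)
  have finC: "finite C" by (rule finite_subset[of _ "A \<times> A \<times> A \<times> A"]) (use fin in \<open>auto simp: C_def\<close>)
  have finAA: "finite (A * A)" by (rule finite_set_times[OF fin fin])
  have "card L \<le> card (X \<union> B)"
    using finX finB by (intro card_mono) (auto simp: L_def X_def B_def)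
  also have "\<dots> \<le> card X + card B" by (rule card_Un_le)
  also have "card X \<le> card (f ` X) + card {(x, y) \<in> X \<times> X. x \<noteq> y \<and> f x = f y}"
    by (rule card_le_card_image_plus_collisions[OF finX])
  also have "card (f ` X) \<le> card (A * A)"
    using finAA by (intro card_mono) (auto simp: f_def X_def set_times_def)
  also have "card {(x, y) \<in> X \<times> X. x \<noteq> y \<and> f x = f y} \<le> card C"
  proof (rule card_inj_on_le[of "\<lambda>((a, b), (c, d)). (a, b, c, d)"])
    show "(\<lambda>((a, b), (c, d)). (a, b, c, d)) ` {(x, y) \<in> X \<times> X. x \<noteq> y \<and> f x = f y} \<subseteq> C"
    proof
      fix z assume "z \<in> (\<lambda>((a, b), (c, d)). (a, b, c, d)) ` {(x, y) \<in> X \<times> X. x \<noteq> y \<and> f x = f y}"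
      then obtain a b c d where z: "z = (a, b, c, d)"
        and *: "(a, b) \<in> X" "(c, d) \<in> X" "(a, b) \<noteq> (c, d)" "f (a, b) = f (c, d)"
        by auto
      have pos: "a > 0" "b > 0" "c > 0" "d > 0" using * A by (auto simp: X_def)
      have e: "a * b = c * d" "a < b" "c < d" using * by (auto simp: f_def X_def)
      have "a \<noteq> c" using e pos *(3) by auto
      moreover have "a \<noteq> d" using e pos by (auto simp: mult.commute)
      moreover have "b \<noteq> c" using e pos by (auto simp: mult.commute)
      moreover have "b \<noteq> d" using e pos *(3) by auto
      ultimately show "z \<in> C" using * e by (auto simp: z C_def X_def)
    qed
  qed (use finC in \<open>auto simp: inj_on_def\<close>)
  finally have "2 * real (card L) \<le> 2 * (real (card (A * A)) + real (card C) + real (card B))" by simp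
  thus ?thesis using card_less_pairs[OF fin] unfolding L_def[symmetric] B_def[symmetric] C_def[symmetric] by simp
qed

text \<open>Pairs from \<open>S\<close> with product in \<open>H\<close> yield at most
  \<open>card H\<close> products together instead of one each; only pairs from \<open>S\<close>
  whose product escapes \<open>H\<close> spoil this saving. With both sets empty it is the trivial
  bound used in the other direction.\<close>

lemma card_product_set_le:
  fixes A :: "nat set"
  assumes "finite A" "finite H"
  shows "real (card (A * A)) \<le> (real (card A))\<^sup>2 / 2 + real (card A) / 2
     - ((real (card (A \<inter> S)))\<^sup>2 - real (card (A \<inter> S))) / 2 + real (card H)
     + real (card {(a, b) \<in> A \<times> A. a \<in> S \<and> b \<in> S \<and> a \<noteq> b \<and> a * b \<notin> H})"
proof -
  define L where "L = {(a, b) \<in> A \<times> A. a < b}"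
  define D where "D = (\<lambda>a. (a, a)) ` A"
  define LS where "LS = {(a, b) \<in> (A \<inter> S) \<times> (A \<inter> S). a < b}"
  define V where "V = {(a, b) \<in> L. a \<in> S \<and> b \<in> S \<and> a * b \<in> H}"
  define E where "E = {(a, b) \<in> A \<times> A. a \<in> S \<and> b \<in> S \<and> a \<noteq> b \<and> a * b \<notin> H}"
  define f where "f = (\<lambda>(a, b). a * b :: nat)"
  have finL: "finite L" by (rule finite_subset[of _ "A \<times> A"]) (use assms in \<open>auto simp: L_def\<close>)
  have finE: "finite E" by (rule finite_subset[of _ "A \<times> A"]) (use assms in \<open>auto simp: E_def\<close>)
  have finV: "finite V" by (rule finite_subset[OF _ finL]) (auto simp: V_def)
  have finD: "finite D" using assms by (simp add: D_def)
  have "A * A \<subseteq> H \<union> f ` (L - V) \<union> f ` D"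
  proof
    fix n assume "n \<in> A * A"
    then obtain a b where ab: "a \<in> A" "b \<in> A" "n = a * b" by (auto simp: set_times_def)
    define x y where "x = min a b" and "y = max a b"
    have xy: "x \<in> A" "y \<in> A" "n = x * y" "x \<le> y" using ab by (auto simp: x_def y_def min_def max_def)
    show "n \<in> H \<union> f ` (L - V) \<union> f ` D"
    proof (cases "x = y")
      case True
      hence "n \<in> f ` D" using xy by (auto simp: f_def D_def)
      thus ?thesis by blast
    next
      case False
      hence "(x, y) \<in> L" using xy by (auto simp: L_def)
      moreover have "n = f (x, y)" using xy by (simp add: f_def)
      moreover have "n \<in> H" if "(x, y) \<in> V" using that xy by (auto simp: V_def)
      ultimately show ?thesis by blast
    qed
  qed
  hence "card (A * A) \<le> card (H \<union> f ` (L - V) \<union> f ` D)"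
    using finL finD assms by (intro card_mono) auto
  also have "\<dots> \<le> card H + card (f ` (L - V)) + card (f ` D)"
    using card_Un_le[of "H \<union> f ` (L - V)" "f ` D"] card_Un_le[of H "f ` (L - V)"] by linarith
  also have "card (f ` D) \<le> card A"
    using card_image_le[OF finD, of f] card_image_le[OF assms(1), of "\<lambda>a. (a, a)"] unfolding D_def by linarith
  also have "card (f ` (L - V)) \<le> card (L - V)" using finL by (intro card_image_le) auto
  also have "card (L - V) = card L - card V"
    using finV by (intro card_Diff_subset) (auto simp: V_def)
  finally have "real (card (A * A)) \<le> real (card H + (card L - card V) + card A)" by linarith
  moreover have "card V \<le> card L" using finL by (intro card_mono) (auto simp: V_def)
  ultimately have 1: "real (card (A * A)) \<le> real (card H) + real (card L) - real (card V) + real (card A)"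
    by linarith
  have "LS \<subseteq> V \<union> E" by (auto simp: LS_def V_def E_def L_def)
  hence "card LS \<le> card (V \<union> E)" using finV finE by (intro card_mono) auto
  also have "\<dots> \<le> card V + card E" by (rule card_Un_le)
  finally have 2: "real (card LS) \<le> real (card V) + real (card E)" by linarith
  have 3: "2 * real (card L) = (real (card A))\<^sup>2 - real (card A)"
    unfolding L_def using assms by (intro card_less_pairs) auto
  have 4: "2 * real (card LS) = (real (card (A \<inter> S)))\<^sup>2 - real (card (A \<inter> S))"
    unfolding LS_def using assms by (intro card_less_pairs) auto
  show ?thesis using 1 2 3 4 unfolding E_def[symmetric] by argo
qed

section \<open>The random set\<close>

lemma set_random_set_pmf: "A \<in> set_pmf (random_set_pmf N \<alpha>) \<Longrightarrow> A \<subseteq> {1..N}"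
  by (auto simp: random_set_pmf_def)

lemma finite_set_random_set_pmf: "finite (set_pmf (random_set_pmf N \<alpha>))"
  by (rule finite_subset[of _ "Pow {1..N}"]) (use set_random_set_pmf in auto)

lemma integrable_random_set_pmf:
  "integrable (measure_pmf (random_set_pmf N \<alpha>)) (f :: nat set \<Rightarrow> real)"
  by (intro integrable_measure_pmf_finite finite_set_random_set_pmf)

lemma prob_subset_random_set:
  assumes "D \<subseteq> {1..N}" "0 \<le> \<alpha>" "\<alpha> \<le> 1"
  shows "measure_pmf.prob (random_set_pmf N \<alpha>) {A. D \<subseteq> A} = \<alpha> ^ card D"
proof -
  have "measure_pmf.prob (random_set_pmf N \<alpha>) {A. D \<subseteq> A} =
     measure_pmf.prob (Pi_pmf {1..N} False (\<lambda>_. bernoulli_pmf \<alpha>)) ((\<lambda>f. {n \<in> {1..N}. f n}) -` {A. D \<subseteq> A})"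
    unfolding random_set_pmf_def by (rule measure_map_pmf)
  also have "(\<lambda>f. {n \<in> {1..N}. f n}) -` {A. D \<subseteq> A} = Pi {1..N} (\<lambda>n. if n \<in> D then {True} else UNIV)"
    using assms by (auto simp: Pi_def subset_iff)
  also have "measure_pmf.prob (Pi_pmf {1..N} False (\<lambda>_. bernoulli_pmf \<alpha>)) \<dots>
     = (\<Prod>n\<in>{1..N}. measure_pmf.prob (bernoulli_pmf \<alpha>) (if n \<in> D then {True} else UNIV))"
    by (rule measure_Pi_pmf_Pi) simp
  also have "\<dots> = (\<Prod>n\<in>{1..N}. if n \<in> D then \<alpha> else 1)"
    using assms by (intro prod.cong) (auto simp: measure_pmf_single)
  also have "\<dots> = (\<Prod>n\<in>{1..N} \<inter> D. \<alpha>)" by (simp add: prod.If_cases Int_def)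
  also have "{1..N} \<inter> D = D" using assms by auto
  finally show ?thesis by simp
qed

text \<open>Linearity of expectation, with each configuration encoded as a set \<open>D e\<close>,
  so that a repeated entry of a tuple is charged only once.\<close>

lemma expectation_count_subsets:
  assumes "finite E" "\<And>e. e \<in> E \<Longrightarrow> D e \<subseteq> {1..N}" "0 \<le> \<alpha>" "\<alpha> \<le> 1"
  shows "measure_pmf.expectation (random_set_pmf N \<alpha>) (\<lambda>A. real (card {e \<in> E. D e \<subseteq> A})) = (\<Sum>e\<in>E. \<alpha> ^ card (D e))"
proof -
  let ?M = "measure_pmf (random_set_pmf N \<alpha>)"
  have "real (card {e \<in> E. D e \<subseteq> A}) = (\<Sum>e\<in>E. indicator {A. D e \<subseteq> A} A)" for A
    using assms(1) by (simp add: indicator_def sum.If_cases Int_def)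
  hence "integral\<^sup>L ?M (\<lambda>A. real (card {e \<in> E. D e \<subseteq> A})) = integral\<^sup>L ?M (\<lambda>A. \<Sum>e\<in>E. indicator {A. D e \<subseteq> A} A)"
    by simp
  also have "\<dots> = (\<Sum>e\<in>E. integral\<^sup>L ?M (indicator {A. D e \<subseteq> A}))"
    by (intro Bochner_Integration.integral_sum integrable_random_set_pmf)
  also have "\<dots> = (\<Sum>e\<in>E. \<alpha> ^ card (D e))"
    using assms prob_subset_random_set by (intro sum.cong) auto
  finally show ?thesis .
qed

lemma prob_random_set_ge_le:
  assumes "c > 0" "\<And>A. f A \<ge> 0"
  shows "measure_pmf.prob (random_set_pmf N \<alpha>) {A. f A \<ge> c} \<le> measure_pmf.expectation (random_set_pmf N \<alpha>) f / c"
proof -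
  have "measure (measure_pmf (random_set_pmf N \<alpha>)) {A \<in> space (measure_pmf (random_set_pmf N \<alpha>)). f A \<ge> c}
    \<le> measure_pmf.expectation (random_set_pmf N \<alpha>) f / c"
    using assms by (intro integral_Markov_inequality_measure[where A = "{}"] integrable_random_set_pmf) auto
  thus ?thesis by simp
qed

text \<open>The variance of a binomial variable is at most its mean. The second moment counts pairs
  through the set of their entries, which has a single element on the diagonal.\<close>

lemma expectation_card_Int_square_deviation_le:
  assumes S: "S \<subseteq> {1..N}" and \<alpha>: "0 \<le> \<alpha>" "\<alpha> \<le> 1"
  shows "measure_pmf.expectation (random_set_pmf N \<alpha>) (\<lambda>A. (real (card (A \<inter> S)) - \<alpha> * real (card S))\<^sup>2) \<le> \<alpha> * real (card S)"
proof -
  let ?M = "measure_pmf (random_set_pmf N \<alpha>)"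
  define s where "s = real (card S)"
  have fin: "finite S" using S finite_subset by blast
  have 1: "real (card (A \<inter> S)) = real (card {a\<in>S. {a} \<subseteq> A})" for A
    by (intro arg_cong[of _ _ "\<lambda>X. real (card X)"]) auto
  have E1: "integral\<^sup>L ?M (\<lambda>A. real (card (A \<inter> S))) = \<alpha> * s"
    unfolding 1 using S \<alpha> fin by (subst expectation_count_subsets) (auto simp: s_def)
  have 2: "(real (card (A \<inter> S)))\<^sup>2 = real (card {e\<in>S \<times> S. {fst e, snd e} \<subseteq> A})" for A
  proof -
    have "{e\<in>S \<times> S. {fst e, snd e} \<subseteq> A} = (A \<inter> S) \<times> (A \<inter> S)" by auto
    thus ?thesis by (simp add: card_cartesian_product power2_eq_square)
  qed
  have "integral\<^sup>L ?M (\<lambda>A. (real (card (A \<inter> S)))\<^sup>2) = (\<Sum>e\<in>S \<times> S. \<alpha> ^ card {fst e, snd e})"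
    unfolding 2 using S \<alpha> fin by (subst expectation_count_subsets) auto
  also have "\<dots> = (\<Sum>a\<in>S. \<Sum>b\<in>S. \<alpha>\<^sup>2 + (if a = b then \<alpha> - \<alpha>\<^sup>2 else 0))"
    unfolding sum.cartesian_product by (intro sum.cong) (auto simp: card_insert_if power2_eq_square)
  also have "\<dots> = s\<^sup>2 * \<alpha>\<^sup>2 + s * (\<alpha> - \<alpha>\<^sup>2)"
    using fin by (simp add: sum.distrib s_def power2_eq_square algebra_simps)
  finally have E2: "integral\<^sup>L ?M (\<lambda>A. (real (card (A \<inter> S)))\<^sup>2) = s\<^sup>2 * \<alpha>\<^sup>2 + s * (\<alpha> - \<alpha>\<^sup>2)" .
  have "integral\<^sup>L ?M (\<lambda>A. (real (card (A \<inter> S)) - \<alpha> * s)\<^sup>2)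
     = integral\<^sup>L ?M (\<lambda>A. (real (card (A \<inter> S)))\<^sup>2 - 2 * (\<alpha> * s) * real (card (A \<inter> S)) + (\<alpha> * s)\<^sup>2)"
    by (intro Bochner_Integration.integral_cong refl) (simp add: power2_diff)
  also have "\<dots> = s\<^sup>2 * \<alpha>\<^sup>2 + s * (\<alpha> - \<alpha>\<^sup>2) - 2 * (\<alpha> * s) * (\<alpha> * s) + (\<alpha> * s)\<^sup>2"
    by (simp add: integrable_random_set_pmf E1 E2 del: integral_mult_right_zero)
  also have "\<dots> = \<alpha> * s - s * \<alpha>\<^sup>2" by (simp add: power2_eq_square algebra_simps)
  also have "\<dots> \<le> \<alpha> * s" by (simp add: s_def)
  finally show ?thesis by (simp add: s_def)
qed

text \<open>Chebyshev's inequality. The parameter \<open>m\<close> is separate from the mean because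
  in the converse only a lower bound for the size of \<open>S\<close> is known.\<close>

lemma prob_card_Int_deviation_le:
  assumes S: "S \<subseteq> {1..N}" and \<alpha>: "0 \<le> \<alpha>" "\<alpha> \<le> 1" and m: "m > 0" "m \<le> \<alpha> * real (card S)"
  shows "measure_pmf.prob (random_set_pmf N \<alpha>) {A. \<bar>real (card (A \<inter> S)) - \<alpha> * real (card S)\<bar> \<ge> \<alpha> * real (card S) / 2} \<le> 4 / m"
proof -
  define t where "t = \<alpha> * real (card S)"
  have t: "t > 0" "m \<le> t" using m by (simp_all add: t_def)
  have "{A. \<bar>real (card (A \<inter> S)) - t\<bar> \<ge> t / 2} = {A. (real (card (A \<inter> S)) - t)\<^sup>2 \<ge> (t / 2)\<^sup>2}"
    using t by (simp add: abs_le_square_iff[symmetric])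
  hence "measure_pmf.prob (random_set_pmf N \<alpha>) {A. \<bar>real (card (A \<inter> S)) - t\<bar> \<ge> t / 2}
     = measure_pmf.prob (random_set_pmf N \<alpha>) {A. (real (card (A \<inter> S)) - t)\<^sup>2 \<ge> (t / 2)\<^sup>2}" by simp
  also have "\<dots> \<le> measure_pmf.expectation (random_set_pmf N \<alpha>) (\<lambda>A. (real (card (A \<inter> S)) - t)\<^sup>2) / (t / 2)\<^sup>2"
    using t by (intro prob_random_set_ge_le) auto
  also have "\<dots> \<le> t / (t / 2)\<^sup>2"
    using expectation_card_Int_square_deviation_le[OF S \<alpha>] unfolding t_def by (intro divide_right_mono) auto
  also have "\<dots> = 4 / t" using t by (simp add: power2_eq_square)
  also have "\<dots> \<le> 4 / m" using t m by (intro divide_left_mono) auto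
  finally show ?thesis by (simp add: t_def)
qed

section \<open>The two directions\<close>

text \<open>The three terms account for a deviation of \<open>card A\<close>, for pairs with too
  many prime factors, and for collisions among the remaining pairs. The last two are treated
  together by Markov's inequality for \<open>W\<close>.\<close>

lemma prob_product_set_deviation_le:
  fixes \<alpha> \<delta> e t :: real
  assumes \<alpha>: "0 \<le> \<alpha>" "\<alpha> \<le> 1" and N: "N \<ge> 1" and \<delta>: "\<delta> > 0"
    and \<mu>: "\<alpha> * real N > 0" "\<alpha> * real N \<ge> 4 / \<delta>"
    and few: "real (card {n\<in>{1..N}. real (bigomega n) > t}) \<le> e * real N"
  shows "measure_pmf.prob (random_set_pmf N \<alpha>)
       {A. \<bar>real (card (A * A)) - (real (card A))\<^sup>2 / 2\<bar> \<ge> \<delta> * ((real (card A))\<^sup>2 / 2)}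
     \<le> 4 / (\<alpha> * real N) + 32 * e / \<delta>
       + 16 / \<delta> * (\<alpha>\<^sup>2 * 2 powr (2 * t) * (39366 * (1 + ln (ln (8 * real N))) / ln (32 * real N)))"
proof -
  let ?p = "random_set_pmf N \<alpha>"
  define m where "m = \<alpha> * real N"
  define G where "G n \<longleftrightarrow> real (bigomega n) \<le> 2 * t" for n
  define B where "B = {z \<in> {1..N} \<times> {1..N}. fst z \<noteq> snd z \<and> \<not> G (fst z * snd z)}"
  define C where "C = {(a, b, c, d) \<in> mult_quads N. distinct [a, b, c, d] \<and> G (a * b)}"
  define DB where "DB z = {fst z, snd z}" for z :: "nat \<times> nat"
  define DC where "DC = (\<lambda>(a, b, c, d). {a, b, c, d :: nat})"
  define W where "W A = real (card {z\<in>B. DB z \<subseteq> A}) + real (card {z\<in>C. DC z \<subseteq> A})" for A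
  define V where "V = 39366 * (1 + ln (ln (8 * real N))) / ln (32 * real N)"
  define Ev :: "nat set set" where "Ev = {A. \<bar>real (card (A * A)) - (real (card A))\<^sup>2 / 2\<bar> \<ge> \<delta> * ((real (card A))\<^sup>2 / 2)}"
  define E1 where "E1 = {A. \<bar>real (card (A \<inter> {1..N})) - m\<bar> \<ge> m / 2}"
  \<comment> \<open>Outside \<open>E1\<close> one has \<open>card A > m / 2\<close>, so outside
    \<open>E2\<close> the value \<open>W A\<close> is below half of the allowed
    \<open>\<delta> * ((card A)^2 / 2)\<close>. The other half pays for the diagonal term
    \<open>card A / 2\<close>, by m \<ge> 4 / \<delta>.\<close>
  define E2 where "E2 = {A. W A \<ge> \<delta> * m\<^sup>2 / 16}"
  have finB: "finite B" by (simp add: B_def)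
  have finC: "finite C" by (rule finite_subset[OF _ finite_mult_quads[of N]]) (auto simp: C_def)
  have m: "m > 0" "m \<ge> 4 / \<delta>" using \<mu> by (simp_all add: m_def)
  have cardB: "real (card B) \<le> 2 * e * (real N)\<^sup>2"
  proof -
    define Z where "Z = {n\<in>{1..N}. real (bigomega n) > t}"
    \<comment> \<open>More than \<open>2 * t\<close> prime factors in a product force more than
      \<open>t\<close> in one of its two factors.\<close>
    have "B \<subseteq> Z \<times> {1..N} \<union> {1..N} \<times> Z"
      by (auto simp: B_def Z_def G_def bigomega_mult)
    hence "card B \<le> card (Z \<times> {1..N} \<union> {1..N} \<times> Z)" by (intro card_mono) (auto simp: Z_def)
    also have "\<dots> \<le> card (Z \<times> {1..N}) + card ({1..N} \<times> Z)" by (rule card_Un_le)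
    finally have "card B \<le> 2 * card Z * N" by (simp add: card_cartesian_product mult.commute)
    hence "real (card B) \<le> real (2 * card Z * N)" by (simp only: of_nat_le_iff)
    also have "\<dots> = 2 * real (card Z) * real N" by simp
    also have "\<dots> \<le> 2 * (e * real N) * real N"
      using few unfolding Z_def by (intro mult_right_mono mult_left_mono) auto
    finally show ?thesis by (simp add: power2_eq_square)
  qed
  have cardC: "real (card C) \<le> 2 powr (2 * t) * ((real N)\<^sup>2 * V)"
  proof -
    have "card C \<le> card {(a, b, c, d) \<in> mult_quads N. real (bigomega (a * b)) \<le> 2 * t}"
      by (intro card_mono finite_subset[OF _ finite_mult_quads[of N]]) (auto simp: C_def G_def)
    hence "real (card C) \<le> real (card {(a, b, c, d) \<in> mult_quads N. real (bigomega (a * b)) \<le> 2 * t})" by simp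
    also have "\<dots> \<le> 2 powr (2 * t) * (39366 * (real N)\<^sup>2 * (1 + ln (ln (8 * real N))) / ln (32 * real N))"
      by (rule card_mult_quads_le[OF N])
    finally show ?thesis by (simp add: V_def mult_ac)
  qed
  have expB: "measure_pmf.expectation ?p (\<lambda>A. real (card {z\<in>B. DB z \<subseteq> A})) = \<alpha>\<^sup>2 * real (card B)"
  proof -
    have "measure_pmf.expectation ?p (\<lambda>A. real (card {z\<in>B. DB z \<subseteq> A})) = (\<Sum>z\<in>B. \<alpha> ^ card (DB z))"
      using finB \<alpha> by (intro expectation_count_subsets) (auto simp: B_def DB_def)
    also have "\<dots> = (\<Sum>z\<in>B. \<alpha>\<^sup>2)" by (intro sum.cong refl) (auto simp: B_def DB_def numeral_2_eq_2)
    finally show ?thesis by simp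
  qed
  have expC: "measure_pmf.expectation ?p (\<lambda>A. real (card {z\<in>C. DC z \<subseteq> A})) = \<alpha> ^ 4 * real (card C)"
  proof -
    have "measure_pmf.expectation ?p (\<lambda>A. real (card {z\<in>C. DC z \<subseteq> A})) = (\<Sum>z\<in>C. \<alpha> ^ card (DC z))"
      using finC \<alpha> by (intro expectation_count_subsets) (auto simp: C_def DC_def mult_quads_def)
    also have "\<dots> = (\<Sum>z\<in>C. \<alpha> ^ 4)"
    proof (rule sum.cong[OF refl])
      fix z assume "z \<in> C"
      then obtain a b c d where "z = (a, b, c, d)" "distinct [a, b, c, d]" by (auto simp: C_def)
      hence "card (DC z) = 4" using distinct_card[of "[a, b, c, d]"] by (simp add: DC_def)
      thus "\<alpha> ^ card (DC z) = \<alpha> ^ 4" by simp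
    qed
    finally show ?thesis by simp
  qed
  have expW: "measure_pmf.expectation ?p W \<le> 2 * e * m\<^sup>2 + m\<^sup>2 * (\<alpha>\<^sup>2 * 2 powr (2 * t) * V)"
  proof -
    have "measure_pmf.expectation ?p W = \<alpha>\<^sup>2 * real (card B) + \<alpha> ^ 4 * real (card C)"
      unfolding W_def expB[symmetric] expC[symmetric]
      by (intro Bochner_Integration.integral_add integrable_random_set_pmf)
    also have "\<dots> \<le> \<alpha>\<^sup>2 * (2 * e * (real N)\<^sup>2) + \<alpha> ^ 4 * (2 powr (2 * t) * ((real N)\<^sup>2 * V))"
      using cardB cardC \<alpha> by (intro add_mono mult_left_mono) auto
    also have "\<dots> = 2 * e * m\<^sup>2 + m\<^sup>2 * (\<alpha>\<^sup>2 * 2 powr (2 * t) * V)"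
      by (simp add: m_def power2_eq_square power4_eq_xxxx algebra_simps)
    finally show ?thesis .
  qed
  have incl: "Ev \<inter> set_pmf ?p \<subseteq> E1 \<union> E2"
  proof (rule subsetI, rule ccontr)
    fix A assume A: "A \<in> Ev \<inter> set_pmf ?p" and n: "A \<notin> E1 \<union> E2"
    have sub: "A \<subseteq> {1..N}" using A set_random_set_pmf by blast
    hence fin: "finite A" using finite_subset by blast
    have "A \<inter> {1..N} = A" using sub by auto
    hence "\<bar>real (card A) - m\<bar> < m / 2" using n by (simp add: E1_def)
    hence big: "real (card A) > m / 2" by linarith
    have W: "W A < \<delta> * m\<^sup>2 / 16" using n by (simp add: E2_def)
    have lower: "(real (card A))\<^sup>2 / 2 \<le> real (card (A * A)) + real (card A) / 2 + W A"
    proof -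
      have "{(a, b) \<in> A \<times> A. a \<noteq> b \<and> \<not> G (a * b)} = {z\<in>B. DB z \<subseteq> A}"
        using sub by (auto simp: B_def DB_def)
      moreover have "{(a, b, c, d) \<in> A \<times> A \<times> A \<times> A. distinct [a, b, c, d] \<and> a * b = c * d \<and> G (a * b)} = {z\<in>C. DC z \<subseteq> A}"
        using sub by (auto simp: C_def DC_def mult_quads_def)
      ultimately show ?thesis using card_product_set_ge[OF sub, of G] by (simp only: W_def add.assoc)
    qed
    have upper: "real (card (A * A)) \<le> (real (card A))\<^sup>2 / 2 + real (card A) / 2"
      using card_product_set_le[OF fin, of "{}" "{}"] by simp
    have W0: "W A \<ge> 0" by (simp add: W_def)
    have "2 / \<delta> < real (card A)" using big m by simp
    hence "2 < \<delta> * real (card A)" using \<delta> by (simp add: field_simps)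
    moreover have "real (card A) > 0" using big m by linarith
    ultimately have "2 * real (card A) < \<delta> * real (card A) * real (card A)" by (intro mult_strict_right_mono)
    hence 1: "real (card A) / 2 < \<delta> * ((real (card A))\<^sup>2 / 4)" by (simp add: power2_eq_square)
    have "(m / 2)\<^sup>2 \<le> (real (card A))\<^sup>2" using big m by (intro power_mono) auto
    hence "\<delta> * (m / 2)\<^sup>2 \<le> \<delta> * (real (card A))\<^sup>2" using \<delta> by (intro mult_left_mono) auto
    hence 2: "W A < \<delta> * ((real (card A))\<^sup>2 / 4)" using W by (simp add: power2_eq_square)
    have "\<bar>real (card (A * A)) - (real (card A))\<^sup>2 / 2\<bar> < \<delta> * ((real (card A))\<^sup>2 / 2)"
      using lower upper 1 2 W0 by (simp add: abs_if split: if_splits)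
    thus False using A by (simp add: Ev_def)
  qed
  have "measure_pmf.prob ?p Ev = measure_pmf.prob ?p (Ev \<inter> set_pmf ?p)"
    by (simp add: measure_Int_set_pmf)
  also have "\<dots> \<le> measure_pmf.prob ?p (E1 \<union> E2)" using incl by (intro measure_pmf.finite_measure_mono) auto
  also have "\<dots> \<le> measure_pmf.prob ?p E1 + measure_pmf.prob ?p E2"
    by (rule measure_Un_le) auto
  also have "measure_pmf.prob ?p E1 \<le> 4 / m"
    using prob_card_Int_deviation_le[of "{1..N}" N \<alpha> m] \<alpha> m by (simp add: E1_def m_def)
  also have "measure_pmf.prob ?p E2 \<le> measure_pmf.expectation ?p W / (\<delta> * m\<^sup>2 / 16)"
    unfolding E2_def using \<delta> m by (intro prob_random_set_ge_le) (auto simp: W_def)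
  also have "\<dots> \<le> (2 * e * m\<^sup>2 + m\<^sup>2 * (\<alpha>\<^sup>2 * 2 powr (2 * t) * V)) / (\<delta> * m\<^sup>2 / 16)"
    using expW \<delta> m by (intro divide_right_mono) auto
  also have "\<dots> = 32 * e / \<delta> + 16 / \<delta> * (\<alpha>\<^sup>2 * 2 powr (2 * t) * V)"
    using \<delta> m by (simp add: divide_simps) (simp add: algebra_simps)
  finally show ?thesis unfolding Ev_def m_def V_def by (simp only: add.assoc)
qed

text \<open>Balance in units of c^2 m^2, with m = \<alpha> N and n = card A: the pairs from
  \<open>S\<close> save at least 1/8, the linear terms cost at most 1/32, \<open>H\<close> at most
  1/64 and the escaping pairs at most 1/64. At least 1/16 is left, and n \<le> 2 m turns it into
  \<open>c^2 / 32\<close> times \<open>n^2 / 2\<close>.\<close>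

lemma prob_product_set_deviation_ge:
  fixes \<alpha> c r :: real
  assumes \<alpha>: "0 \<le> \<alpha>" "\<alpha> \<le> 1" and S: "S \<subseteq> {1..N}" "real (card S) \<ge> c * real N" and c: "c > 0"
    and \<mu>: "\<alpha> * real N > 0" "\<alpha> * real N \<ge> 64 / c\<^sup>2"
    and H: "finite H" "real (card H) \<le> c\<^sup>2 / 64 * (\<alpha> * real N)\<^sup>2"
    and few: "real (card {(a, b) \<in> S \<times> S. a \<noteq> b \<and> a * b \<notin> H}) \<le> r * (real N)\<^sup>2"
  shows "measure_pmf.prob (random_set_pmf N \<alpha>)
       {A. \<bar>real (card (A * A)) - (real (card A))\<^sup>2 / 2\<bar> \<ge> c\<^sup>2 / 32 * ((real (card A))\<^sup>2 / 2)}
     \<ge> 1 - (4 / (\<alpha> * real N) + 4 / (c * (\<alpha> * real N)) + 64 * r / c\<^sup>2)"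
proof -
  let ?p = "random_set_pmf N \<alpha>"
  define m where "m = \<alpha> * real N"
  define B where "B = {z \<in> S \<times> S. fst z \<noteq> snd z \<and> fst z * snd z \<notin> H}"
  define DB where "DB z = {fst z, snd z}" for z :: "nat \<times> nat"
  define W where "W A = real (card {z\<in>B. DB z \<subseteq> A})" for A
  define Ev :: "nat set set" where "Ev = {A. \<bar>real (card (A * A)) - (real (card A))\<^sup>2 / 2\<bar> \<ge> c\<^sup>2 / 32 * ((real (card A))\<^sup>2 / 2)}"
  define E1 where "E1 = {A. \<bar>real (card (A \<inter> {1..N})) - m\<bar> \<ge> m / 2}"
  define E2 where "E2 = {A. \<bar>real (card (A \<inter> S)) - \<alpha> * real (card S)\<bar> \<ge> \<alpha> * real (card S) / 2}"
  define E3 where "E3 = {A. W A \<ge> c\<^sup>2 / 64 * m\<^sup>2}"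
  have finS: "finite S" using S finite_subset by blast
  hence finB: "finite B" by (simp add: B_def)
  have m: "m > 0" "m \<ge> 64 / c\<^sup>2" using \<mu> by (simp_all add: m_def)
  have sm: "c * m \<le> \<alpha> * real (card S)"
    using mult_left_mono[OF S(2) \<alpha>(1)] by (simp add: m_def mult_ac)
  have "B = {(a, b) \<in> S \<times> S. a \<noteq> b \<and> a * b \<notin> H}" by (auto simp: B_def)
  hence cardB: "real (card B) \<le> r * (real N)\<^sup>2" using few by simp
  have expW: "measure_pmf.expectation ?p W \<le> r * m\<^sup>2"
  proof -
    have "measure_pmf.expectation ?p W = (\<Sum>z\<in>B. \<alpha> ^ card (DB z))"
      unfolding W_def using finB \<alpha> S by (intro expectation_count_subsets) (auto simp: B_def DB_def)
    also have "\<dots> = (\<Sum>z\<in>B. \<alpha>\<^sup>2)" by (intro sum.cong refl) (auto simp: B_def DB_def numeral_2_eq_2)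
    also have "\<dots> = \<alpha>\<^sup>2 * real (card B)" by simp
    also have "\<dots> \<le> \<alpha>\<^sup>2 * (r * (real N)\<^sup>2)" using cardB by (intro mult_left_mono) auto
    finally show ?thesis by (simp add: m_def power_mult_distrib mult_ac)
  qed
  have incl: "set_pmf ?p - (E1 \<union> E2 \<union> E3) \<subseteq> Ev"
  proof
    fix A assume A: "A \<in> set_pmf ?p - (E1 \<union> E2 \<union> E3)"
    have sub: "A \<subseteq> {1..N}" using A set_random_set_pmf by blast
    hence fin: "finite A" using finite_subset by blast
    define n s where "n = real (card A)" and "s = real (card (A \<inter> S))"
    have "A \<inter> {1..N} = A" using sub by auto
    hence "\<bar>n - m\<bar> < m / 2" using A by (simp add: E1_def n_def)
    hence n: "n \<le> 2 * m" using m by linarith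
    have n0: "n \<ge> 0" by (simp add: n_def)
    have "\<bar>s - \<alpha> * real (card S)\<bar> < \<alpha> * real (card S) / 2" using A by (simp add: E2_def s_def)
    hence s: "s \<ge> c * m / 2" using sm by linarith
    have sn: "s \<le> n" unfolding s_def n_def using fin by (simp add: card_mono)
    have W: "W A \<le> c\<^sup>2 / 64 * m\<^sup>2" using A by (simp add: E3_def)
    have "{(a, b) \<in> A \<times> A. a \<in> S \<and> b \<in> S \<and> a \<noteq> b \<and> a * b \<notin> H} = {z\<in>B. DB z \<subseteq> A}"
      by (auto simp: B_def DB_def)
    hence "real (card (A * A)) \<le> n\<^sup>2 / 2 + n / 2 - (s\<^sup>2 - s) / 2 + real (card H) + W A"
      using card_product_set_le[OF fin H(1), of S] by (simp only: W_def n_def s_def)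
    also have "\<dots> \<le> n\<^sup>2 / 2 + n - s\<^sup>2 / 2 + c\<^sup>2 / 64 * m\<^sup>2 + c\<^sup>2 / 64 * m\<^sup>2"
      using W H(2) sn unfolding m_def[symmetric] by (simp add: diff_divide_distrib)
    finally have 1: "real (card (A * A)) \<le> n\<^sup>2 / 2 + n - s\<^sup>2 / 2 + c\<^sup>2 / 64 * m\<^sup>2 + c\<^sup>2 / 64 * m\<^sup>2" .
    have "(c * m / 2)\<^sup>2 \<le> s\<^sup>2" using s c m by (intro power_mono) auto
    hence 2: "s\<^sup>2 / 2 \<ge> c\<^sup>2 * m\<^sup>2 / 8" by (simp add: power_mult_distrib power_divide)
    have 3: "n \<le> c\<^sup>2 / 32 * m\<^sup>2"
    proof -
      have "64 \<le> c\<^sup>2 * m" using m c by (simp add: field_simps)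
      hence "64 * m \<le> c\<^sup>2 * m * m" using m by (intro mult_right_mono) auto
      thus ?thesis using n by (simp add: power2_eq_square)
    qed
    have "real (card (A * A)) \<le> n\<^sup>2 / 2 - c\<^sup>2 * m\<^sup>2 / 16" using 1 2 3 by simp
    moreover have "c\<^sup>2 / 32 * (n\<^sup>2 / 2) \<le> c\<^sup>2 * m\<^sup>2 / 16"
    proof -
      have "n\<^sup>2 \<le> (2 * m)\<^sup>2" using n n0 by (intro power_mono) auto
      hence "c\<^sup>2 * n\<^sup>2 \<le> c\<^sup>2 * (2 * m)\<^sup>2" by (intro mult_left_mono) auto
      thus ?thesis by (simp add: power_mult_distrib)
    qed
    ultimately have "c\<^sup>2 / 32 * (n\<^sup>2 / 2) \<le> \<bar>real (card (A * A)) - n\<^sup>2 / 2\<bar>" by linarith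
    thus "A \<in> Ev" by (simp only: Ev_def n_def mem_Collect_eq)
  qed
  have "1 - measure_pmf.prob ?p (E1 \<union> E2 \<union> E3) = measure_pmf.prob ?p (UNIV - (E1 \<union> E2 \<union> E3))"
    using measure_pmf.prob_compl[of "E1 \<union> E2 \<union> E3" ?p] by simp
  also have "\<dots> = measure_pmf.prob ?p ((UNIV - (E1 \<union> E2 \<union> E3)) \<inter> set_pmf ?p)"
    by (rule measure_Int_set_pmf[symmetric])
  also have "\<dots> \<le> measure_pmf.prob ?p Ev"
    using incl by (intro measure_pmf.finite_measure_mono) auto
  finally have main: "1 - measure_pmf.prob ?p (E1 \<union> E2 \<union> E3) \<le> measure_pmf.prob ?p Ev" .
  have "measure_pmf.prob ?p (E1 \<union> E2 \<union> E3) \<le> measure_pmf.prob ?p (E1 \<union> E2) + measure_pmf.prob ?p E3"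
    by (rule measure_Un_le) auto
  moreover have "measure_pmf.prob ?p (E1 \<union> E2) \<le> measure_pmf.prob ?p E1 + measure_pmf.prob ?p E2"
    by (rule measure_Un_le) auto
  moreover have "measure_pmf.prob ?p E1 \<le> 4 / m"
    using prob_card_Int_deviation_le[of "{1..N}" N \<alpha> m] \<alpha> m by (simp add: E1_def m_def)
  moreover have "measure_pmf.prob ?p E2 \<le> 4 / (c * m)"
    unfolding E2_def using \<alpha> S m c sm by (intro prob_card_Int_deviation_le) auto
  moreover have "measure_pmf.prob ?p E3 \<le> 64 * r / c\<^sup>2"
  proof -
    have "measure_pmf.prob ?p E3 \<le> measure_pmf.expectation ?p W / (c\<^sup>2 / 64 * m\<^sup>2)"
      unfolding E3_def using c m by (intro prob_random_set_ge_le) (auto simp: W_def)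
    also have "\<dots> \<le> r * m\<^sup>2 / (c\<^sup>2 / 64 * m\<^sup>2)" using expW by (intro divide_right_mono) auto
    also have "\<dots> = 64 * r / c\<^sup>2" using m c by (simp add: field_simps)
    finally show ?thesis .
  qed
  ultimately show ?thesis using main unfolding Ev_def m_def by linarith
qed

text \<open>Compared with the sum of the two counts, \<open>a * b\<close> loses only the primes of
  \<open>P\<close> common to \<open>a\<close> and \<open>b\<close>. Their mean number over all pairs
  is at most the sum of 1/p^2, hence at most 1, and Markov's inequality with threshold
  \<open>k\<close> applies.\<close>

lemma card_few_common_primes:
  fixes P :: "nat set" and k t :: real and N :: nat
  assumes P: "finite P" "\<And>p. p \<in> P \<Longrightarrow> prime p" and k: "k > 0"
  defines "S \<equiv> {n\<in>{1..N}. real (ndiv P n) \<ge> t}"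
  defines "H \<equiv> {n\<in>{1..N * N}. real (card (prime_factors n)) \<ge> 2 * t - k}"
  shows "real (card {(a, b) \<in> S \<times> S. a \<noteq> b \<and> a * b \<notin> H}) \<le> 1 / k * (real N)\<^sup>2"
proof -
  define E where "E = {(a, b) \<in> S \<times> S. a \<noteq> b \<and> a * b \<notin> H}"
  define com where "com = (\<lambda>(a, b). card {p\<in>P. p dvd a \<and> p dvd b})"
  have sub: "E \<subseteq> {1..N} \<times> {1..N}" by (auto simp: E_def S_def)
  have "k * real (card E) = (\<Sum>z\<in>E. k)" by simp
  also have "\<dots> \<le> (\<Sum>z\<in>E. real (com z))"
  proof (rule sum_mono)
    fix z assume z: "z \<in> E"
    then obtain a b where ab: "z = (a, b)" "a \<in> {1..N}" "b \<in> {1..N}" "real (ndiv P a) \<ge> t" "real (ndiv P b) \<ge> t" "a * b \<notin> H"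
      by (auto simp: E_def S_def)
    have "1 * 1 \<le> a * b" "a * b \<le> N * N" using ab by (auto intro!: mult_le_mono simp del: mult_1_left)
    hence "real (card (prime_factors (a * b))) < 2 * t - k" using ab by (simp add: H_def)
    moreover have "ndiv P a + ndiv P b \<le> card (prime_factors (a * b)) + com z"
    proof -
      have "ndiv P a + ndiv P b = card ({p\<in>P. p dvd a} \<union> {p\<in>P. p dvd b}) + card ({p\<in>P. p dvd a} \<inter> {p\<in>P. p dvd b})"
        unfolding ndiv_def using P by (intro card_Un_Int) auto
      also have "{p\<in>P. p dvd a} \<inter> {p\<in>P. p dvd b} = {p\<in>P. p dvd a \<and> p dvd b}" by auto
      also have "card ({p\<in>P. p dvd a} \<union> {p\<in>P. p dvd b}) \<le> card (prime_factors (a * b))"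
        using P ab by (intro card_mono) (auto simp: in_prime_factors_iff)
      finally show ?thesis by (simp add: com_def ab)
    qed
    ultimately show "k \<le> real (com z)" using ab by linarith
  qed
  also have "\<dots> \<le> (\<Sum>z\<in>{1..N} \<times> {1..N}. real (com z))"
    using sub by (intro sum_mono2) auto
  also have "\<dots> = (\<Sum>z\<in>{1..N} \<times> {1..N}. \<Sum>p\<in>{p\<in>P. p dvd fst z \<and> p dvd snd z}. 1)"
    by (intro sum.cong) (auto simp: com_def)
  also have "\<dots> = (\<Sum>p\<in>P. \<Sum>z\<in>{z\<in>{1..N} \<times> {1..N}. p dvd fst z \<and> p dvd snd z}. 1)"
    using P by (intro sum.swap_restrict) auto
  also have "\<dots> \<le> (\<Sum>p\<in>P. (real N)\<^sup>2 * (1 / (real p)\<^sup>2))"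
  proof (rule sum_mono)
    fix p assume p: "p \<in> P"
    have "{z\<in>{1..N} \<times> {1..N}. p dvd fst z \<and> p dvd snd z} = {n\<in>{1..N}. p dvd n} \<times> {n\<in>{1..N}. p dvd n}" by auto
    hence "card {z\<in>{1..N} \<times> {1..N}. p dvd fst z \<and> p dvd snd z} = (N div p) * (N div p)"
      using card_multiples[of p N] P p by (simp only: card_cartesian_product prime_gt_0_nat)
    hence "(\<Sum>z\<in>{z\<in>{1..N} \<times> {1..N}. p dvd fst z \<and> p dvd snd z}. 1) = (real (N div p))\<^sup>2"
      by (simp only: sum_constant power2_eq_square of_nat_mult mult_1_right)
    also have "\<dots> \<le> (real N / real p)\<^sup>2" by (intro power_mono div_le_real) auto
    finally show "(\<Sum>z\<in>{z\<in>{1..N} \<times> {1..N}. p dvd fst z \<and> p dvd snd z}. 1) \<le> (real N)\<^sup>2 * (1 / (real p)\<^sup>2)"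
      by (simp add: power_divide)
  qed
  also have "\<dots> = (real N)\<^sup>2 * (\<Sum>p\<in>P. 1 / (real p)\<^sup>2)" by (simp only: sum_distrib_left)
  also have "\<dots> \<le> (real N)\<^sup>2 * 1"
    using P prime_ge_2_nat by (intro mult_left_mono sum_inverse_squares_le) auto
  finally show ?thesis using k by (simp add: E_def field_simps)
qed

text \<open>The growth of \<open>N * \<alpha> N\<close> excludes sets of bounded expected size. For
  \<open>\<alpha> N = 1 / (N + 1)\<close>, say, the set is empty with probability tending to 1/e, an
  outcome that belongs to the event in \<open>asymp_whp\<close>, while the quotient tends to
  -infinity; the equivalence would fail.\<close>

theorem theorem1p5:
  fixes \<alpha> :: "nat \<Rightarrow> real"
  assumes "\<And>N. N \<ge> 1 \<Longrightarrow> 0 \<le> \<alpha> N \<and> \<alpha> N < 1"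
    and "filterlim (\<lambda>N. real N * \<alpha> N) at_top sequentially"
  shows "asymp_whp (\<lambda>N. measure_pmf (random_set_pmf N (\<alpha> N)))
           (\<lambda>N A. real (card (A * A))) (\<lambda>N A. (real (card A))\<^sup>2 / 2)
     \<longleftrightarrow> filterlim (\<lambda>N. ln ((\<alpha> N)\<^sup>2 * ln (real N) powr (ln 4 - 1)) / sqrt (ln (ln (real N))))
           at_bot sequentially"
proof -
  define pr where "pr \<delta> N = measure_pmf.prob (random_set_pmf N (\<alpha> N))
     {A :: nat set. \<bar>real (card (A * A)) - (real (card A))\<^sup>2 / 2\<bar> \<ge> \<delta> * ((real (card A))\<^sup>2 / 2)}" for \<delta> N
  define l where "l N = ln (ln (real N))" for N
  define \<rho> where "\<rho> N = ln ((\<alpha> N)\<^sup>2 * ln (real N) powr (ln 4 - 1)) / sqrt (l N)" for N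
  define \<mu> where "\<mu> N = \<alpha> N * real N" for N
  have whp: "asymp_whp (\<lambda>N. measure_pmf (random_set_pmf N (\<alpha> N)))
           (\<lambda>N A. real (card (A * A))) (\<lambda>N A. (real (card A))\<^sup>2 / 2) \<longleftrightarrow> (\<forall>\<delta>>0. pr \<delta> \<longlonglongrightarrow> 0)"
    by (simp add: asymp_whp_def pr_def[abs_def])
  have \<mu>: "filterlim \<mu> at_top sequentially"
    unfolding \<mu>_def using assms(2) by (simp only: mult.commute)
  have l: "filterlim l at_top sequentially" unfolding l_def by real_asymp
  have ln_4: "ln 4 = 2 * ln (2::real)" using ln_realpow[of 2 2] by simp
  \<comment> \<open>Solves the definition of \<rho> for \<alpha>^2. Positivity of
    \<open>\<mu> N\<close> keeps away from the default value \<open>ln 0 = 0\<close>.\<close>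
  have \<rho>: "\<alpha> N ^ 2 = exp (\<rho> N * sqrt (l N) - (ln 4 - 1) * l N)" "ln (real N) = exp (l N)"
    if "\<mu> N > 0" "N \<ge> 3" "l N \<ge> 1" for N
  proof -
    have a: "\<alpha> N > 0" using that by (simp add: \<mu>_def zero_less_mult_iff)
    have N: "ln (real N) > 0" using that by simp
    show e: "ln (real N) = exp (l N)" using N by (simp add: l_def)
    have "\<rho> N * sqrt (l N) = ln ((\<alpha> N)\<^sup>2 * exp (l N) powr (ln 4 - 1))"
      using that by (simp add: \<rho>_def e)
    also have "\<dots> = ln ((\<alpha> N)\<^sup>2) + (ln 4 - 1) * l N"
      using a by (simp add: ln_mult_pos exp_powr_real ln_powr)
    finally have "\<rho> N * sqrt (l N) - (ln 4 - 1) * l N = ln ((\<alpha> N)\<^sup>2)" by simp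
    thus "\<alpha> N ^ 2 = exp (\<rho> N * sqrt (l N) - (ln 4 - 1) * l N)" using a by simp
  qed
  have "(\<forall>\<delta>>0. pr \<delta> \<longlonglongrightarrow> 0) \<longleftrightarrow> filterlim \<rho> at_bot sequentially"
  proof
    assume lim: "filterlim \<rho> at_bot sequentially"
    show "\<forall>\<delta>>0. pr \<delta> \<longlonglongrightarrow> 0"
    proof (intro allI impI)
      fix \<delta> :: real assume \<delta>: "\<delta> > 0"
      have small: "eventually (\<lambda>N. pr \<delta> N < \<epsilon>) sequentially" if \<epsilon>: "\<epsilon> > 0" for \<epsilon>
      proof -
        \<comment> \<open>Each of the three terms gets \<epsilon>/3:
          \<open>32 * e / \<delta>\<close> by this choice, \<open>4 / \<mu> N\<close> by
          \<open>\<mu> N > 12 / \<epsilon>\<close>, and the collision term by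
          \<open>g N < \<epsilon> * \<delta> / 48\<close>.\<close>
        define e where "e = \<epsilon> * \<delta> / 96"
        have e: "e > 0" using \<epsilon> \<delta> by (simp add: e_def)
        obtain K where K: "K > 0"
          "eventually (\<lambda>N. real (card {n\<in>{1..N}. real (bigomega n) > l N + K * sqrt (l N)}) \<le> e * real N) sequentially"
          unfolding l_def by (rule bigomega_large_proportion[OF e])
        \<comment> \<open>What remains of the collision term once \<open>ln N\<close> has cancelled:
          a factor of order \<open>l N\<close> against \<open>exp (- sqrt (l N))\<close>.\<close>
        define g where "g N = 39366 * (1 + ln (ln (8 * real N))) * exp (- sqrt (l N))" for N
        have "g \<longlonglongrightarrow> 0" unfolding g_def l_def by real_asymp
        hence "eventually (\<lambda>N. g N < \<epsilon> * \<delta> / 48) sequentially"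
          using \<epsilon> \<delta> by (intro order_tendstoD) auto
        \<comment> \<open>As \<open>ln 2 < 1\<close>, this leaves \<rho> N + 2 K ln 2 \<le> -1, the
          source of the decay \<open>exp (- sqrt (l N))\<close>.\<close>
        moreover have "eventually (\<lambda>N. \<rho> N \<le> - (2 * K + 1)) sequentially"
          using lim by (simp add: filterlim_at_bot)
        moreover have "eventually (\<lambda>N. l N \<ge> 1) sequentially" using l by (simp add: filterlim_at_top)
        moreover have "eventually (\<lambda>N. \<mu> N \<ge> max (4 / \<delta>) (12 / \<epsilon> + 1)) sequentially"
          using \<mu> by (simp only: filterlim_at_top)
        moreover have "eventually (\<lambda>N::nat. N \<ge> 3) sequentially" by (rule eventually_ge_at_top)
        ultimately show ?thesis using K(2)
        proof eventually_elim
          case (elim N)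
          have \<alpha>: "0 \<le> \<alpha> N" "\<alpha> N \<le> 1" using assms(1)[of N] elim by auto
          have "12 / \<epsilon> > 0" using \<epsilon> by simp
          hence \<mu>0: "\<mu> N > 0" "\<mu> N \<ge> 4 / \<delta>" "\<mu> N > 12 / \<epsilon>" using elim by linarith+
          have N8: "1 + ln (ln (8 * real N)) \<ge> 0" "ln (32 * real N) \<ge> ln (real N)" "ln (real N) > 0"
          proof -
            have "ln 8 \<le> ln (8 * real N)" using elim by simp
            hence "ln (8 * real N) \<ge> 1" using ln_8_ge_1 by linarith
            thus "1 + ln (ln (8 * real N)) \<ge> 0" by simp
            show "ln (32 * real N) \<ge> ln (real N)" "ln (real N) > 0" using elim by simp_all
          qed
          define t where "t = l N + K * sqrt (l N)"
          have "pr \<delta> N \<le> 4 / \<mu> N + 32 * e / \<delta>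
              + 16 / \<delta> * ((\<alpha> N)\<^sup>2 * 2 powr (2 * t) * (39366 * (1 + ln (ln (8 * real N))) / ln (32 * real N)))"
            unfolding pr_def \<mu>_def
            using \<alpha> \<delta> \<mu>0 elim by (intro prob_product_set_deviation_le) (auto simp: \<mu>_def t_def)
          also have "4 / \<mu> N < \<epsilon> / 3" using \<mu>0 \<epsilon> by (simp add: field_simps)
          also have "32 * e / \<delta> = \<epsilon> / 3" using \<delta> by (simp add: e_def)
          also have "(\<alpha> N)\<^sup>2 * 2 powr (2 * t) * (39366 * (1 + ln (ln (8 * real N))) / ln (32 * real N)) \<le> g N"
          proof -
            have "(\<alpha> N)\<^sup>2 * 2 powr (2 * t) = exp (\<rho> N * sqrt (l N) - (ln 4 - 1) * l N) * exp (2 * t * ln 2)"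
              using \<rho>[of N] \<mu>0 elim by (simp add: powr_def)
            also have "\<dots> = exp (l N + (\<rho> N + 2 * K * ln 2) * sqrt (l N))"
              unfolding exp_add[symmetric] by (simp add: t_def ln_4 algebra_simps)
            also have "(\<rho> N + 2 * K * ln 2) * sqrt (l N) \<le> (- 1) * sqrt (l N)"
            proof (intro mult_right_mono)
              have "K * ln 2 \<le> K * 1" using K ln_2_less_1 by (intro mult_left_mono) auto
              thus "\<rho> N + 2 * K * ln 2 \<le> - 1" using elim by linarith
            qed (use elim in auto)
            hence "exp (l N + (\<rho> N + 2 * K * ln 2) * sqrt (l N)) \<le> exp (l N + (- 1) * sqrt (l N))" by simp
            also have "\<dots> = ln (real N) * exp (- sqrt (l N))"
              using \<rho>(2)[of N] \<mu>0 elim by (simp flip: exp_add)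
            finally have bound: "(\<alpha> N)\<^sup>2 * 2 powr (2 * t) \<le> ln (real N) * exp (- sqrt (l N))" .
            have "(\<alpha> N)\<^sup>2 * 2 powr (2 * t) * (39366 * (1 + ln (ln (8 * real N))) / ln (32 * real N))
              \<le> ln (real N) * exp (- sqrt (l N)) * (39366 * (1 + ln (ln (8 * real N))) / ln (real N))"
              by (rule mult_mono[OF bound]) (use N8 in \<open>auto intro!: divide_left_mono\<close>)
            also have "\<dots> = g N" using N8 by (simp add: g_def)
            finally show ?thesis .
          qed
          hence "(\<alpha> N)\<^sup>2 * 2 powr (2 * t) * (39366 * (1 + ln (ln (8 * real N))) / ln (32 * real N)) \<le> \<epsilon> * \<delta> / 48"
            using elim(1) by linarith
          hence "16 / \<delta> * ((\<alpha> N)\<^sup>2 * 2 powr (2 * t) * (39366 * (1 + ln (ln (8 * real N))) / ln (32 * real N))) \<le> 16 / \<delta> * (\<epsilon> * \<delta> / 48)"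
            using \<delta> by (intro mult_left_mono) auto
          also have "16 / \<delta> * (\<epsilon> * \<delta> / 48) = \<epsilon> / 3" using \<delta> by simp
          finally show ?case by simp
        qed
      qed
      show "pr \<delta> \<longlonglongrightarrow> 0"
      proof (rule order_tendstoI)
        fix a :: real assume "a < 0"
        moreover have "0 \<le> pr \<delta> N" for N by (simp add: pr_def)
        ultimately have "a < pr \<delta> N" for N by (rule less_le_trans)
        thus "eventually (\<lambda>N. a < pr \<delta> N) sequentially" by simp
      qed (rule small)
    qed
  next
    assume whp: "\<forall>\<delta>>0. pr \<delta> \<longlonglongrightarrow> 0"
    show "filterlim \<rho> at_bot sequentially"
      unfolding filterlim_at_bot
    proof (intro allI, rule ccontr)
      fix Z assume "\<not> eventually (\<lambda>N. \<rho> N \<le> Z) sequentially"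
      hence freq: "frequently (\<lambda>N. \<rho> N > Z) sequentially"
        by (simp add: frequently_def not_less)
      \<comment> \<open>On the scale \<open>sqrt (l N)\<close> in the exponent, the density of
        \<open>H\<close> contributes \<open>- (2 * K - 1) * ln 2\<close>, and \<alpha>^2 contributes
        \<open>\<rho> N > Z\<close>. By ln 2 \<ge> 2/3 this \<open>K\<close> leaves a margin of
        1.\<close>
      define K where "K = \<bar>Z\<bar> + 2"
      have K: "K > 0" by (simp add: K_def)
      obtain c where c: "c > 0" and proportion: "eventually (\<lambda>N. \<exists>P. finite P \<and> (\<forall>p\<in>P. prime p) \<and> c * real N \<le>
         real (card {n\<in>{1..N}. real (ndiv P n) \<ge> l N + K * sqrt (l N)})) sequentially"
        unfolding l_def by (rule many_prime_factors_proportion[OF K])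
      have "(\<lambda>N. 3 * exp (- sqrt (l N))) \<longlonglongrightarrow> 0" unfolding l_def by real_asymp
      hence "eventually (\<lambda>N. 3 * exp (- sqrt (l N)) < c\<^sup>2 / 64) sequentially"
        by (rule order_tendstoD) (use c in simp)
      moreover have "(\<lambda>N. 1 / sqrt (l N)) \<longlonglongrightarrow> 0" unfolding l_def by real_asymp
      hence "eventually (\<lambda>N. 1 / sqrt (l N) < c\<^sup>2 / 512) sequentially"
        using c by (intro order_tendstoD) auto
      moreover have "eventually (\<lambda>N. l N \<ge> 1) sequentially" using l by (simp add: filterlim_at_top)
      moreover have "eventually (\<lambda>N. \<mu> N \<ge> max (64 / c\<^sup>2) (max 32 (32 / c))) sequentially"
        using \<mu> by (simp only: filterlim_at_top)
      moreover have "eventually (\<lambda>N::nat. N \<ge> 3) sequentially" by (rule eventually_ge_at_top)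
      moreover have "pr (c\<^sup>2 / 32) \<longlonglongrightarrow> 0" using whp c by simp
      hence "eventually (\<lambda>N. pr (c\<^sup>2 / 32) N < 1 / 2) sequentially"
        by (rule order_tendstoD) auto
      ultimately have "eventually (\<lambda>N. \<not> \<rho> N > Z) sequentially" using proportion
      proof eventually_elim
        case (elim N)
        show ?case
        proof
          assume Z: "\<rho> N > Z"
          have \<alpha>: "0 \<le> \<alpha> N" "\<alpha> N \<le> 1" using assms(1)[of N] elim by auto
          have \<mu>0: "\<mu> N \<ge> 64 / c\<^sup>2" "\<mu> N \<ge> 32" "\<mu> N \<ge> 32 / c" using elim by auto
          obtain P where P: "finite P" "\<forall>p\<in>P. prime p"
            "c * real N \<le> real (card {n\<in>{1..N}. real (ndiv P n) \<ge> l N + K * sqrt (l N)})"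
            using elim by blast
          define t where "t = l N + K * sqrt (l N)"
          \<comment> \<open>The subtracted \<open>sqrt (l N)\<close> allows for common primes of the
            two factors; the pairs sharing more are a proportion of at most
            \<open>1 / sqrt (l N)\<close>, which tends to 0.\<close>
          define T where "T = 2 * t - sqrt (l N)"
          define S where "S = {n\<in>{1..N}. real (ndiv P n) \<ge> t}"
          define H where "H = {n\<in>{1..N * N}. real (card (prime_factors n)) \<ge> T}"
          have lN: "ln (real N) = exp (l N)" "(\<alpha> N)\<^sup>2 = exp (\<rho> N * sqrt (l N) - (ln 4 - 1) * l N)"
            using \<rho>[of N] \<mu>0 elim by auto
          have cardH: "real (card H) \<le> c\<^sup>2 / 64 * (\<mu> N)\<^sup>2"
          proof -
            have "2 powr T * real (card H) \<le> real (N * N) * (1 + ln (real (N * N)))"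
              unfolding H_def using elim by (intro card_many_prime_factors_le) auto
            also have "\<dots> = (real N)\<^sup>2 * (1 + 2 * exp (l N))"
              using elim by (simp add: ln_mult power2_eq_square lN)
            also have "\<dots> \<le> (real N)\<^sup>2 * (3 * exp (l N))" using elim by (intro mult_left_mono) auto
            finally have "real (card H) \<le> (real N)\<^sup>2 * (3 * exp (l N)) / 2 powr T"
              by (simp add: field_simps)
            also have "\<dots> = (real N)\<^sup>2 * (3 * (exp (l N) / 2 powr T))" by simp
            also have "exp (l N) / 2 powr T \<le> (\<alpha> N)\<^sup>2 * exp (- sqrt (l N))"
            proof -
              have "exp (l N) / 2 powr T = exp (l N - T * ln 2)" by (simp add: powr_def exp_diff)
              also have "\<dots> \<le> exp (\<rho> N * sqrt (l N) - (ln 4 - 1) * l N + (- sqrt (l N)))"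
              proof -
                have "(2 * K - 1) * (2 / 3) \<le> (2 * K - 1) * ln 2"
                  using ln2_ge_two_thirds by (intro mult_left_mono) (auto simp: K_def)
                moreover have "(2 * K - 1) * (2 / 3) \<ge> \<bar>Z\<bar> + 1" by (simp add: K_def)
                ultimately have "- ((2 * K - 1) * ln 2) \<le> \<rho> N - 1" using Z by linarith
                hence "- ((2 * K - 1) * ln 2) * sqrt (l N) \<le> (\<rho> N - 1) * sqrt (l N)"
                  using elim by (intro mult_right_mono) auto
                thus ?thesis by (simp add: T_def t_def ln_4 algebra_simps)
              qed
              finally show ?thesis by (simp only: lN(2) exp_add)
            qed
            hence "(real N)\<^sup>2 * (3 * (exp (l N) / 2 powr T)) \<le> (real N)\<^sup>2 * (3 * ((\<alpha> N)\<^sup>2 * exp (- sqrt (l N))))"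
              by (intro mult_left_mono) auto
            also have "\<dots> = (\<mu> N)\<^sup>2 * (3 * exp (- sqrt (l N)))" by (simp add: \<mu>_def power_mult_distrib)
            also have "\<dots> \<le> (\<mu> N)\<^sup>2 * (c\<^sup>2 / 64)" using elim by (intro mult_left_mono) auto
            finally show ?thesis by (simp add: mult.commute)
          qed
          have "1 - (4 / \<mu> N + 4 / (c * \<mu> N) + 64 * (1 / sqrt (l N)) / c\<^sup>2) \<le> pr (c\<^sup>2 / 32) N"
            unfolding pr_def \<mu>_def
          proof (rule prob_product_set_deviation_ge[OF \<alpha>, of S])
            show "S \<subseteq> {1..N}" by (auto simp: S_def)
            show "c * real N \<le> real (card S)" using P by (simp add: S_def t_def)
            show "\<alpha> N * real N > 0" "\<alpha> N * real N \<ge> 64 / c\<^sup>2" using \<mu>0 by (simp_all add: \<mu>_def)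
            show "finite H" by (simp add: H_def)
            show "real (card H) \<le> c\<^sup>2 / 64 * (\<alpha> N * real N)\<^sup>2" using cardH by (simp add: \<mu>_def)
            show "real (card {(a, b) \<in> S \<times> S. a \<noteq> b \<and> a * b \<notin> H}) \<le> 1 / sqrt (l N) * (real N)\<^sup>2"
              unfolding S_def H_def T_def using P elim by (intro card_few_common_primes) auto
          qed (use c in auto)
          \<comment> \<open>Each of the three failure terms is at most 1/8, so the deviation has
            probability at least 5/8, against the limit 0 that was assumed.\<close>
          moreover have "4 / \<mu> N \<le> 1 / 8" using \<mu>0 by (simp add: field_simps)
          moreover have "32 \<le> c * \<mu> N" using \<mu>0 c by (simp add: field_simps)
          hence "4 / (c * \<mu> N) \<le> 1 / 8" by (simp add: field_simps)
          moreover have "64 * (1 / sqrt (l N)) / c\<^sup>2 \<le> 64 * (c\<^sup>2 / 512) / c\<^sup>2"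
            using elim by (intro divide_right_mono mult_left_mono) auto
          hence "64 * (1 / sqrt (l N)) / c\<^sup>2 \<le> 1 / 8" using c by simp
          ultimately have "pr (c\<^sup>2 / 32) N \<ge> 5 / 8" by linarith
          thus False using elim by linarith
        qed
      qed
      thus False using freq by (simp add: frequently_def)
    qed
  qed
  thus ?thesis unfolding whp \<rho>_def l_def .
qed

end
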